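(* Let $\theta_0^{\mathrm{AUC}}:=\int\Pr(R>\alpha\mid Y=1)\,d\Pr(R\le\alpha\mid Y=0)$. Define $$\hat\theta_n:=\int\frac{\sum_{i=1}^nI(R_i>\alpha)Y_i}{\sum_{i=1}^nY_i}\,d\left(\frac{\sum_{i=1}^nI(R_i\le\alpha)(1-Y_i)}{\sum_{i=1}^n(1-Y_i)}\right),$$ $$\hat\theta_n^f:=\int\frac{\sum_{i=1}^nI(R_i>\alpha)f(X_i)}{\sum_{i=1}^nf(X_i)}\,d\left(\frac{\sum_{i=1}^nI(R_i\le\alpha)(1-f(X_i))}{\sum_{i=1}^n(1-f(X_i))}\right).$$ Let $\phi^{\mathrm{AUC}}(R_i,Y_i)$ and $\phi^{\mathrm{AUC}}(R_i,f(X_i))$ denote their influence functions (evaluated at a single observation), respectively. Furthermore, define $$\hat\theta_{n+N}^f:=\int\frac{\sum_{i=1}^{n+N}I(R_i>\alpha)f(X_i)}{\sum_{i=1}^{n+N}f(X_i)}\,d\left(\frac{\sum_{i=1}^{n+N}I(R_i\le\alpha)(1-f(X_i))}{\sum_{i=1}^{n+N}(1-f(X_i))}\right).$$ Then $$\phi^{\mathrm{AUC}}(R_i,Y_i)=\frac{1-Y_i}{\mathbb E[1-Y]}\left(1-\frac{\mathbb E[I(R\le\alpha)Y]}{\mathbb E[Y]}\right)\bigg|_{\alpha=R_i}+\frac{Y_i}{\mathbb E[Y]}\,\frac{\mathbb E[I(R\le\alpha)(1-Y)]}{\mathbb E[1-Y]}\bigg|_{\alpha=R_i}-\left(\frac{1-Y_i}{\mathbb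 E[1-Y]}+\frac{Y_i}{\mathbb E[Y]}\right)\int\frac{\mathbb E[I(R>\alpha)Y]}{\mathbb E[Y]}\,d\left(\frac{\mathbb E[I(R\le\alpha)(1-Y)]}{\mathbb E[1-Y]}\right)$$ and $$\phi^{\mathrm{AUC}}(R_i,f(X_i))=\frac{1-f(X_i)}{\mathbb E[1-f(X)]}\left(1-\frac{\mathbb E[I(R\le\alpha)f(X)]}{\mathbb E[f(X)]}\right)\bigg|_{\alpha=R_i}+\frac{f(X_i)}{\mathbb E[f(X)]}\,\frac{\mathbb E[I(R\le\alpha)(1-f(X))]}{\mathbb E[1-f(X)]}\bigg|_{\alpha=R_i}-\left(\frac{1-f(X_i)}{\mathbb E[1-f(X)]}+\frac{f(X_i)}{\mathbb E[f(X)]}\right)\int\frac{\mathbb E[I(R>\alpha)f(X)]}{\mathbb E[f(X)]}\,d\left(\frac{\mathbb E[I(R\le\alpha)(1-f(X))]}{\mathbb E[1-f(X)]}\right).$$ Furthermore, defining $\hat\theta^{\mathrm{PP}}:=\hat\theta_n+\hat\omega\,(\hat\theta^f_{n+N}-\hat\theta^f_n)$, and supposing that $\frac nN\to\lambda$ and $$\hat\omega\xrightarrow{p}\frac{\mathbb E[\phi^{\mathrm{AUC}}(R,Y)\,\phi^{\mathrm{AUC}}(R,f(X))]}{\mathbb E[\phi^{\mathrm{AUC}}(R,f(X))^2]},$$ it follows that $$\sqrt n\,\big(\hat\theta^{\mathrm{PP}}-\theta_0^{\mathrm{AUC}}\big)\xrightarrow{d}N\left(0,\ \mathbb E[\phi^{\mathrm{AUC}}(R,Y)^2]-\frac{\big(\mathbb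 E[\phi^{\mathrm{AUC}}(R,Y)\,\phi^{\mathrm{AUC}}(R,f(X))]\big)^2}{(1+\lambda)\,\mathbb E[\phi^{\mathrm{AUC}}(R,f(X))^2]}\right).$$
   Context: Setting: $Y\in\{0,1\}$; $R$ is a biomarker, which is one of the elements of the covariate vector $X$; $f$ is a deterministic prediction model with $f(X)\ge0$ and $\mathbb E[f(X)]\big(1-\mathbb E[f(X)]\big)\ne0$. The labeled data $(R_i,f(X_i),Y_i)_{i=1}^n$ are i.i.d. copies of $(R,f(X),Y)$; the unlabeled data $(R_i,f(X_i))_{i=n+1}^{n+N}$ are i.i.d. copies of $(R,f(X))$, independent of the labeled data. Integrals are Stieltjes integrals in the threshold $\alpha$, and $I(\cdot)$ is the indicator function. An estimator based on $n$ observations has influence function $\phi$ for its target if its estimation error equals the average of $\phi$ over the $n$ observations plus $o_p(n^{-1/2})$; the target of $\hat\theta_n$ is $\theta_0^{\mathrm{AUC}}$, and that of $\hat\theta_n^f$ is the same expression with $f(X)$ in place of $Y$, namely $\int\frac{\mathbb E[I(R>\alpha)f(X)]}{\mathbb E[f(X)]}\,d\big(\frac{\mathbb E[I(R\le\alpha)(1-f(X))]}{\mathbb E[1-f(X)]}\big)$. The standing assumption for such rectified estimators is that this latter target is finite and well defined and that there is no first-order degeneracy in the errors of $\hat\theta_n^f$ and $\hat\theta_{n+N}^f$.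
   Formalization: Adds that integrand and integrator of the population integrals (for Y and for f(X)) have no common jump, since with ties the stated influence function has nonzero mean and is wrong, and that E[f(X)^2] is finite, so that E[φ(R,f(X))^2] in the limit is finite and the expansion holds. *)

theory Defs
  imports "HOL-Probability.Probability"
begin

text \<open>Lebesgue--Stieltjes integral over the real line against a right-continuous integrator \<open>F\<close> of
  locally bounded variation, given as a difference of two nondecreasing right-continuous functions.
  Signed integrators are needed since \<open>1 - f X\<close> may be negative, and a Riemann--Stieltjes
  integral would not do: one observation with \<open>0 < f X < 1\<close> makes integrand and
  integrator of the empirical integral jump at the same point.\<close>

definition mono_rcont :: "(real \<Rightarrow> real) \<Rightarrow> bool" where
  "mono_rcont F \<longleftrightarrow> mono F \<and> (\<forall>a. continuous (at_right a) F)"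

definition has_stieltjes_integral :: "(real \<Rightarrow> real) \<Rightarrow> (real \<Rightarrow> real) \<Rightarrow> real \<Rightarrow> bool" where
  "has_stieltjes_integral g F I \<longleftrightarrow>
     (\<exists>F1 F2. mono_rcont F1 \<and> mono_rcont F2 \<and> (\<forall>a. F a = F1 a - F2 a) \<and>
        integrable (interval_measure F1) g \<and> integrable (interval_measure F2) g \<and>
        I = integral\<^sup>L (interval_measure F1) g - integral\<^sup>L (interval_measure F2) g)"

definition stieltjes_integral :: "(real \<Rightarrow> real) \<Rightarrow> (real \<Rightarrow> real) \<Rightarrow> real" where
  "stieltjes_integral g F = (THE I. has_stieltjes_integral g F I)"

text \<open>The integral does not depend on the decomposition of the integrator.\<close>

lemma mono_rcont_add:
  assumes "mono_rcont F" "mono_rcont G"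
  shows "mono_rcont (\<lambda>a. F a + G a)"
  using assms unfolding mono_rcont_def
  by (auto simp: mono_def intro!: add_mono continuous_add)

lemma emeasure_interval_measure_add:
  assumes F: "mono_rcont F" and G: "mono_rcont G" and A: "A \<in> sets borel"
  shows "emeasure (interval_measure (\<lambda>a. F a + G a)) A =
         emeasure (interval_measure F) A + emeasure (interval_measure G) A"
proof -
  define N where "N = measure_of UNIV (sets borel)
     (\<lambda>A. emeasure (interval_measure F) A + emeasure (interval_measure G) A)"
  have setsN: "sets N = sets borel"
    unfolding N_def using sets.sigma_sets_eq[of "borel :: real measure"] by (simp add: sets_measure_of)
  have ca: "countably_additive (sets borel)
     (\<lambda>A. emeasure (interval_measure F) A + emeasure (interval_measure G) A)"
    unfolding countably_additive_def
  proof (intro allI impI)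
    fix A :: "nat \<Rightarrow> real set"
    assume A: "range A \<subseteq> sets borel" "disjoint_family A" "(\<Union>i. A i) \<in> sets borel"
    show "(\<Sum>i. emeasure (interval_measure F) (A i) + emeasure (interval_measure G) (A i)) =
      emeasure (interval_measure F) (\<Union>i. A i) + emeasure (interval_measure G) (\<Union>i. A i)"
      using A suminf_emeasure[of A "interval_measure F"] suminf_emeasure[of A "interval_measure G"]
      by (subst suminf_add[symmetric]) (auto intro: summableI)
  qed
  have emN: "emeasure N A = emeasure (interval_measure F) A + emeasure (interval_measure G) A"
    if "A \<in> sets borel" for A
    using that ca setsN unfolding N_def
    by (intro emeasure_measure_of) (auto simp: positive_def setsN[unfolded N_def])
  have mF: "\<And>x y. x \<le> y \<Longrightarrow> F x \<le> F y" and cF: "\<And>a. continuous (at_right a) F"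
    and mG: "\<And>x y. x \<le> y \<Longrightarrow> G x \<le> G y" and cG: "\<And>a. continuous (at_right a) G"
    using F G by (auto simp: mono_rcont_def mono_def)
  have em: "emeasure (interval_measure (\<lambda>a. F a + G a)) {a<..b} = emeasure N {a<..b}" if "a \<le> b" for a b
    using mF[OF that] mG[OF that] mF mG cF cG that
    by (subst emeasure_interval_measure_Ioc)
       (auto simp: emN emeasure_interval_measure_Ioc add_mono continuous_add
         algebra_simps simp flip: ennreal_plus)
  have "interval_measure (\<lambda>a. F a + G a) = N"
  proof (rule measure_eqI_generator_eq[where E="range (\<lambda>(a, b). {a<..b})" and \<Omega>=UNIV
        and A="\<lambda>n. {- real n<..real n}"])
    show "Int_stable (range (\<lambda>(a, b). {a<..b::real}))"
      by (auto simp: Int_stable_def)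
    show "emeasure (interval_measure (\<lambda>a. F a + G a)) X = emeasure N X"
      if "X \<in> range (\<lambda>(a, b). {a<..b})" for X
    proof -
      from that obtain a b where "X = {a<..b}" by auto
      then show ?thesis using em[of a b] by (cases "a \<le> b") auto
    qed
    show "sets (interval_measure (\<lambda>a. F a + G a)) = sigma_sets UNIV (range (\<lambda>(a, b). {a<..b}))"
      "sets N = sigma_sets UNIV (range (\<lambda>(a, b). {a<..b}))"
      unfolding setsN sets_interval_measure by (subst borel_sigma_sets_Ioc, simp)+
    show "(\<Union>i. {- real i<..real i}) = UNIV"
    proof -
      have "\<exists>n. x \<in> {- real n<..real n}" for x :: real
        using reals_Archimedean2[of "\<bar>x\<bar>"] by (force simp: abs_less_iff intro: less_imp_le)
      then show ?thesis by blast
    qed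
    show "emeasure (interval_measure (\<lambda>a. F a + G a)) {- real i<..real i} \<noteq> \<infinity>" for i
      by (subst emeasure_interval_measure_Ioc)
         (auto simp: mF mG cF cG add_mono continuous_add)
  qed auto
  with emN[OF A] show ?thesis by simp
qed

lemma nn_integral_interval_measure_add:
  assumes F: "mono_rcont F" and G: "mono_rcont G" and u: "u \<in> borel_measurable borel"
  shows "(\<integral>\<^sup>+x. u x \<partial>interval_measure (\<lambda>a. F a + G a)) =
         (\<integral>\<^sup>+x. u x \<partial>interval_measure F) + (\<integral>\<^sup>+x. u x \<partial>interval_measure G)"
  using u
proof (induction u rule: borel_measurable_induct)
  case (cong f g)
  then have "f = g" by auto
  with cong show ?case by simp
next
  case (mult u c)
  then show ?case by (simp add: nn_integral_cmult distrib_left)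
next
  case (add u v)
  then show ?case by (simp add: nn_integral_add ac_simps)
next
  case (set A)
  then show ?case by (simp add: emeasure_interval_measure_add[OF F G])
next
  case (seq U)
  have eq: "(SUP i. U i) = (\<lambda>x. SUP i. U i x)" by (simp add: fun_eq_iff image_comp)
  have m: "U i \<in> borel_measurable (interval_measure H)" for i H using seq by simp
  have mono: "incseq (\<lambda>i. integral\<^sup>N (interval_measure H) (U i))" for H
    using seq by (intro incseq_SucI nn_integral_mono) (auto simp: incseq_Suc_iff le_fun_def)
  have *: "(\<integral>\<^sup>+x. (SUP i. U i x) \<partial>interval_measure H) = (SUP i. integral\<^sup>N (interval_measure H) (U i))" for H
    using seq m by (intro nn_integral_monotone_convergence_SUP)
  show ?case
    unfolding eq * using seq by (simp add: ennreal_SUP_add[OF mono mono])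
qed

lemma integral_interval_measure_add:
  fixes g :: "real \<Rightarrow> real"
  assumes F: "mono_rcont F" and G: "mono_rcont G"
    and iF: "integrable (interval_measure F) g" and iG: "integrable (interval_measure G) g"
  shows "integral\<^sup>L (interval_measure (\<lambda>a. F a + G a)) g =
         integral\<^sup>L (interval_measure F) g + integral\<^sup>L (interval_measure G) g"
proof -
  have m: "g \<in> borel_measurable borel" using borel_measurable_integrable[OF iF] by simp
  note add = nn_integral_interval_measure_add[OF F G]
  have fin: "(\<integral>\<^sup>+x. ennreal (g x) \<partial>interval_measure F) < \<infinity>" "(\<integral>\<^sup>+x. ennreal (- g x) \<partial>interval_measure F) < \<infinity>"
    "(\<integral>\<^sup>+x. ennreal (g x) \<partial>interval_measure G) < \<infinity>" "(\<integral>\<^sup>+x. ennreal (- g x) \<partial>interval_measure G) < \<infinity>"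
    using iF iG by (auto simp: real_integrable_def top.not_eq_extremum)
  have "integrable (interval_measure (\<lambda>a. F a + G a)) g"
    using fin m by (auto simp: real_integrable_def add less_top)
  then show ?thesis
    using iF iG fin m by (simp add: real_lebesgue_integral_def add enn2real_plus less_top)
qed

lemma has_stieltjes_integral_unique:
  assumes "has_stieltjes_integral g F I" "has_stieltjes_integral g F J"
  shows "I = J"
proof -
  obtain F1 F2 where F: "mono_rcont F1" "mono_rcont F2" "\<And>a. F a = F1 a - F2 a"
    "integrable (interval_measure F1) g" "integrable (interval_measure F2) g"
    "I = integral\<^sup>L (interval_measure F1) g - integral\<^sup>L (interval_measure F2) g"
    using assms(1) by (auto simp: has_stieltjes_integral_def)
  obtain G1 G2 where G: "mono_rcont G1" "mono_rcont G2" "\<And>a. F a = G1 a - G2 a"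
    "integrable (interval_measure G1) g" "integrable (interval_measure G2) g"
    "J = integral\<^sup>L (interval_measure G1) g - integral\<^sup>L (interval_measure G2) g"
    using assms(2) by (auto simp: has_stieltjes_integral_def)
  have "(\<lambda>a. F1 a + G2 a) = (\<lambda>a. G1 a + F2 a)"
  proof
    fix a show "F1 a + G2 a = G1 a + F2 a" using F(3)[of a] G(3)[of a] by simp
  qed
  then have "integral\<^sup>L (interval_measure F1) g + integral\<^sup>L (interval_measure G2) g =
             integral\<^sup>L (interval_measure G1) g + integral\<^sup>L (interval_measure F2) g"
    using integral_interval_measure_add[of F1 G2 g] integral_interval_measure_add[of G1 F2 g] F G
    by simp
  then show ?thesis using F G by simp
qed

lemma stieltjes_integral_eqI:
  "has_stieltjes_integral g F I \<Longrightarrow> stieltjes_integral g F = I"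
  unfolding stieltjes_integral_def
  by (rule the_equality) (auto intro: has_stieltjes_integral_unique)

text \<open>The empirical AUC functional of \<open>n\<close> realised pairs \<open>(r i, v i)\<close>, where \<open>v i\<close> is either
  an outcome or a prediction. (It is \<open>0\<close> on the event that one of the denominators vanishes.)\<close>

definition auc_estimate :: "nat \<Rightarrow> (nat \<Rightarrow> real) \<Rightarrow> (nat \<Rightarrow> real) \<Rightarrow> real" where
  "auc_estimate n r v =
     stieltjes_integral
       (\<lambda>\<alpha>. (\<Sum>i<n. of_bool (r i > \<alpha>) * v i) / (\<Sum>i<n. v i))
       (\<lambda>\<alpha>. (\<Sum>i<n. of_bool (r i \<le> \<alpha>) * (1 - v i)) / (\<Sum>i<n. 1 - v i))"

text \<open>Its population version, and the AUC in terms of conditional probabilities.\<close>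

definition auc_target :: "'a measure \<Rightarrow> ('a \<Rightarrow> real) \<Rightarrow> ('a \<Rightarrow> real) \<Rightarrow> real" where
  "auc_target M R V =
     stieltjes_integral
       (\<lambda>\<alpha>. (\<integral>w. of_bool (R w > \<alpha>) * V w \<partial>M) / (\<integral>w. V w \<partial>M))
       (\<lambda>\<alpha>. (\<integral>w. of_bool (R w \<le> \<alpha>) * (1 - V w) \<partial>M) / (\<integral>w. 1 - V w \<partial>M))"

definition auc_true :: "'a measure \<Rightarrow> ('a \<Rightarrow> real) \<Rightarrow> ('a \<Rightarrow> real) \<Rightarrow> real" where
  "auc_true M R Y =
     stieltjes_integral
       (\<lambda>\<alpha>. \<P>(w in M. R w > \<alpha> \<bar> Y w = 1))
       (\<lambda>\<alpha>. \<P>(w in M. R w \<le> \<alpha> \<bar> Y w = 0))"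

text \<open>Integrand and integrator of the population integral have no common discontinuity, i.e. the
  integral also makes sense as a classical Stieltjes integral. This holds whenever \<open>R\<close> has no atoms.\<close>

definition auc_no_common_jump :: "'a measure \<Rightarrow> ('a \<Rightarrow> real) \<Rightarrow> ('a \<Rightarrow> real) \<Rightarrow> bool" where
  "auc_no_common_jump M R V \<longleftrightarrow>
     (\<forall>r. isCont (\<lambda>\<alpha>. \<integral>w. of_bool (R w > \<alpha>) * V w \<partial>M) r \<or>
          isCont (\<lambda>\<alpha>. \<integral>w. of_bool (R w \<le> \<alpha>) * (1 - V w) \<partial>M) r)"

definition auc_influence ::
  "'a measure \<Rightarrow> ('a \<Rightarrow> real) \<Rightarrow> ('a \<Rightarrow> real) \<Rightarrow> real \<times> real \<Rightarrow> real" where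
  "auc_influence M R V = (\<lambda>(r, v).
     (1 - v) / (\<integral>w. 1 - V w \<partial>M) *
       (1 - (\<integral>w. of_bool (R w \<le> r) * V w \<partial>M) / (\<integral>w. V w \<partial>M))
     + v / (\<integral>w. V w \<partial>M) *
       ((\<integral>w. of_bool (R w \<le> r) * (1 - V w) \<partial>M) / (\<integral>w. 1 - V w \<partial>M))
     - ((1 - v) / (\<integral>w. 1 - V w \<partial>M) + v / (\<integral>w. V w \<partial>M)) * auc_target M R V)"

definition converges_in_prob :: "'a measure \<Rightarrow> (nat \<Rightarrow> 'a \<Rightarrow> real) \<Rightarrow> real \<Rightarrow> bool" where
  "converges_in_prob M Z c \<longleftrightarrow>
     (\<forall>n. Z n \<in> borel_measurable M) \<and>
     (\<forall>\<epsilon>>0. (\<lambda>n. \<P>(w in M. \<bar>Z n w - c\<bar> > \<epsilon>)) \<longlonglongrightarrow> 0)"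

text \<open>\<open>T n\<close> is an estimator of \<open>\<theta>\<close> based on the observations \<open>D 0, \<dots>, D (n - 1)\<close>.\<close>

definition is_influence_function ::
  "'a measure \<Rightarrow> (nat \<Rightarrow> 'a \<Rightarrow> 'b::topological_space) \<Rightarrow> (nat \<Rightarrow> 'a \<Rightarrow> real) \<Rightarrow> real \<Rightarrow> ('b \<Rightarrow> real) \<Rightarrow> bool"
  where
  "is_influence_function M D T \<theta> \<phi> \<longleftrightarrow>
     \<phi> \<in> borel_measurable borel \<and>
     converges_in_prob M
       (\<lambda>n w. sqrt (real n) * ((T n w - \<theta>) - (\<Sum>i<n. \<phi> (D i w)) / real n)) 0"

text \<open>The first \<open>n\<close> terms come from \<open>a\<close>, the following ones from \<open>b\<close>.\<close>

definition pooled :: "nat \<Rightarrow> (nat \<Rightarrow> 'b) \<Rightarrow> (nat \<Rightarrow> 'b) \<Rightarrow> nat \<Rightarrow> 'b" where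
  "pooled n a b i = (if i < n then a i else b (i - n))"

definition generated_events :: "'a measure \<Rightarrow> ('a \<Rightarrow> 'b::topological_space) \<Rightarrow> 'a set set" where
  "generated_events M Z = {Z -` A \<inter> space M | A. A \<in> sets borel}"

text \<open>\<open>N(m, v)\<close> as the law of \<open>m + sqrt v * Z\<close> for standard normal \<open>Z\<close>, so that \<open>v = 0\<close> gives the
  point mass at \<open>m\<close>.\<close>

definition normal_law :: "real \<Rightarrow> real \<Rightarrow> real measure" where
  "normal_law m v = distr std_normal_distribution borel (\<lambda>z. m + sqrt v * z)"

end

theory Submission
  imports Defs
begin

text \<open>The empirical AUC functional of pairs \<open>(r i, v i)\<close> is
  \<open>a / (b * (1 - b))\<close>, where \<open>b\<close> is the mean of the \<open>v i\<close> and \<open>a\<close> is the V-statistic with kernel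
  \<open>of_bool (r i < r j) * v j * (1 - v i)\<close>. Subtracting its Hajek projection from the kernel leaves a
  degenerate kernel, whose V-statistic has second moment \<open>O(1 / m\<^sup>2)\<close>; linearising the quotient then
  gives the influence function with an explicit bound on the remainder that depends on the sample
  size only, so that it also applies to the pooled samples. An influence function is unique because
  the summands of an i.i.d. sum that is \<open>o_p (sqrt n)\<close> vanish. The estimator is thus, up
  to a vanishing term, a sum of two independent normalised i.i.d. sums, over the labeled and over the
  unlabeled data, and the limit variance is read off from their characteristic functions.\<close>

section \<open>Stieltjes integrals against weighted distribution functions\<close>

text \<open>The obstacle is that \<open>f(X)\<close> is merely square integrable: it may exceed 1,
  so \<open>1 - V\<close> changes sign, integrators need not be monotone, and the denominator
  \<open>b * (1 - b)\<close> is not bounded away from 0. Integrals are therefore handled as signed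
  weights on a base measure, and the quotient is expanded only on the event that the sample mean is
  close to \<open>p\<close>; Chebyshev bounds the complement. All errors are of order
  \<open>1 / m\<close>, which beats the scale \<open>1 / sqrt n\<close> for any sample of size
  \<open>m \<ge> n\<close>. The diagonal of the V-statistic is kept because the Stieltjes integral
  produces it. The kernel vanishes there, but its degenerate part does not and enters the second
  moment separately. Competing influence functions come without any moment, so uniqueness cannot
  start from a variance and goes through characteristic functions. Outcome and prediction share one
  locale, interpreted twice. Both samples live in one independent family over
  \<open>nat + nat\<close>, of which the labeled sample and every pooled sample are injective
  reindexings.\<close>

lemma
  fixes R u :: "'a \<Rightarrow> real"
  assumes R[measurable]: "R \<in> borel_measurable M" and u: "integrable M u" "\<And>w. 0 \<le> u w"
  defines "N \<equiv> distr (density M u) borel R"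
  defines "F \<equiv> (\<lambda>\<alpha>. \<integral>w. of_bool (R w \<le> \<alpha>) * u w \<partial>M)"
  shows mono_rcont_weighted_cdf: "mono_rcont F"
    and interval_measure_weighted_cdf: "interval_measure F = N"
proof -
  have [measurable]: "u \<in> borel_measurable M" using u by simp
  have em: "emeasure N A = (\<integral>\<^sup>+w. ennreal (indicator A (R w) * u w) \<partial>M)" if [measurable]: "A \<in> sets borel" for A
  proof -
    have "emeasure N A = (\<integral>\<^sup>+w. ennreal (u w) * indicator (R -` A \<inter> space M) w \<partial>M)"
      unfolding N_def using that
      by (subst emeasure_distr) (auto intro!: emeasure_density)
    also have "\<dots> = (\<integral>\<^sup>+w. ennreal (indicator A (R w) * u w) \<partial>M)"
      by (intro nn_integral_cong) (auto split: split_indicator)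
    finally show ?thesis .
  qed
  have i: "integrable M (\<lambda>w. indicator A (R w) * u w)" if [measurable]: "A \<in> sets borel" for A
    by (rule Bochner_Integration.integrable_bound[OF u(1)]) (auto split: split_indicator)
  have em': "emeasure N A = ennreal (\<integral>w. indicator A (R w) * u w \<partial>M)" if [measurable]: "A \<in> sets borel" for A
    unfolding em[OF that] using i[OF that] u(2) by (intro nn_integral_eq_integral) auto
  \<comment> \<open>\<open>N\<close> is finite because \<open>u\<close> is integrable; finite Borel
    measures are determined by their distribution functions, which is how
    \<open>interval_measure F\<close> is recognised below.\<close>
  have "finite_borel_measure N"
  proof (intro finite_borel_measure.intro finite_measureI finite_borel_measure_axioms.intro)
    show "emeasure N (space N) \<noteq> \<infinity>"
      using em'[of UNIV] by (simp add: N_def space_distr)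
    show "sets N = sets borel" by (simp add: N_def)
  qed
  then interpret N: finite_borel_measure N .
  have c: "cdf N = F"
  proof
    fix \<alpha>
    have "cdf N \<alpha> = (\<integral>w. indicator {..\<alpha>} (R w) * u w \<partial>M)"
      unfolding cdf_def measure_def using em'[of "{..\<alpha>}"] u(2)
      by (simp add: integral_nonneg_AE)
    also have "\<dots> = F \<alpha>" unfolding F_def by (intro Bochner_Integration.integral_cong) (auto simp: indicator_def)
    finally show "cdf N \<alpha> = F \<alpha>" .
  qed
  show m: "mono_rcont F"
    unfolding c[symmetric] mono_rcont_def mono_def
    using N.cdf_nondecreasing N.cdf_is_right_cont by blast
  have mm: "\<And>x y. x \<le> y \<Longrightarrow> F x \<le> F y" "\<And>a. continuous (at_right a) F"
    using m by (auto simp: mono_rcont_def mono_def)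
  have b: "(F \<longlongrightarrow> 0) at_bot" using N.cdf_lim_at_bot c by simp
  have t: "(F \<longlongrightarrow> measure N (space N)) at_top" using N.cdf_lim_at_top c by simp
  have "finite_borel_measure (interval_measure F)"
    by (rule finite_borel_measure_interval_measure[OF mm b]) (use t in auto)
  moreover have "cdf (interval_measure F) = cdf N"
    unfolding c by (rule cdf_interval_measure[OF mm b])
  ultimately show "interval_measure F = N"
    using N.finite_borel_measure_axioms
    by (metis cdf_unique')
qed

text \<open>Positive and negative part of \<open>u\<close> supply the two monotone integrators that
  the definition demands. Leaving the base measure general lets one statement serve the population
  integral and, with a counting measure on the indices, the empirical one.\<close>

lemma stieltjes_integral_weighted_cdf:
  fixes R u g :: "_ \<Rightarrow> real"
  assumes R[measurable]: "R \<in> borel_measurable M" and u: "integrable M u"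
    and g[measurable]: "g \<in> borel_measurable borel" and bnd: "\<And>x. \<bar>g x\<bar> \<le> b"
  shows "stieltjes_integral g (\<lambda>\<alpha>. \<integral>w. of_bool (R w \<le> \<alpha>) * u w \<partial>M) = (\<integral>w. u w * g (R w) \<partial>M)"
proof (rule stieltjes_integral_eqI, unfold has_stieltjes_integral_def, intro exI conjI allI)
  have [measurable]: "u \<in> borel_measurable M" using u by simp
  let ?p = "\<lambda>w. max 0 (u w)" and ?m = "\<lambda>w. max 0 (- u w)"
  have p: "integrable M ?p" and m: "integrable M ?m" using u by auto
  show "mono_rcont (\<lambda>\<alpha>. \<integral>w. of_bool (R w \<le> \<alpha>) * ?p w \<partial>M)"
    "mono_rcont (\<lambda>\<alpha>. \<integral>w. of_bool (R w \<le> \<alpha>) * ?m w \<partial>M)"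
    by (rule mono_rcont_weighted_cdf[OF R p] mono_rcont_weighted_cdf[OF R m], simp)+
  have i: "integrable M (\<lambda>w. of_bool (R w \<le> \<alpha>) * v w)" if "integrable M v" for v :: "_ \<Rightarrow> real" and \<alpha>
  proof (rule Bochner_Integration.integrable_bound[OF that])
    show "(\<lambda>w. of_bool (R w \<le> \<alpha>) * v w) \<in> borel_measurable M"
      using borel_measurable_integrable[OF that] by measurable
  qed auto
  show "(\<integral>w. of_bool (R w \<le> \<alpha>) * u w \<partial>M) =
     (\<integral>w. of_bool (R w \<le> \<alpha>) * ?p w \<partial>M) - (\<integral>w. of_bool (R w \<le> \<alpha>) * ?m w \<partial>M)" for \<alpha>
    by (subst Bochner_Integration.integral_diff[symmetric, OF i[OF p] i[OF m]])
      (auto intro!: Bochner_Integration.integral_cong simp: max_def)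
  have gi: "integrable M (\<lambda>w. v w * g (R w))" if v: "integrable M v" for v :: "_ \<Rightarrow> real"
  proof (rule Bochner_Integration.integrable_bound[of _ "\<lambda>w. b * v w"])
    show "(\<lambda>w. v w * g (R w)) \<in> borel_measurable M"
      using borel_measurable_integrable[OF v] by measurable
    have "\<bar>v w * g (R w)\<bar> \<le> \<bar>b * v w\<bar>" for w
      using bnd[of "R w"] by (auto simp: abs_mult mult.commute[of b] intro!: mult_left_mono)
    then show "AE w in M. norm (v w * g (R w)) \<le> norm (b * v w)" by simp
  qed (use v in simp)
  have e: "(\<integral>x. g x \<partial>distr (density M v) borel R) = (\<integral>w. v w * g (R w) \<partial>M)"
    and ei: "integrable (distr (density M v) borel R) g"
    if v: "integrable M v" "\<And>w. 0 \<le> v w" for v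
  proof -
    have [measurable]: "v \<in> borel_measurable M" using v by simp
    show "(\<integral>x. g x \<partial>distr (density M v) borel R) = (\<integral>w. v w * g (R w) \<partial>M)"
      using v by (simp add: integral_distr integral_density)
    show "integrable (distr (density M v) borel R) g"
      using v gi[OF v(1)] by (simp add: integrable_distr_eq integrable_density)
  qed
  show "integrable (interval_measure (\<lambda>\<alpha>. \<integral>w. of_bool (R w \<le> \<alpha>) * ?p w \<partial>M)) g"
    "integrable (interval_measure (\<lambda>\<alpha>. \<integral>w. of_bool (R w \<le> \<alpha>) * ?m w \<partial>M)) g"
    unfolding interval_measure_weighted_cdf[OF R p max.cobounded1]
      interval_measure_weighted_cdf[OF R m max.cobounded1]
    by (rule ei[OF p max.cobounded1] ei[OF m max.cobounded1])+
  show "(\<integral>w. u w * g (R w) \<partial>M) =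
    (\<integral>x. g x \<partial>interval_measure (\<lambda>\<alpha>. \<integral>w. of_bool (R w \<le> \<alpha>) * ?p w \<partial>M)) -
    (\<integral>x. g x \<partial>interval_measure (\<lambda>\<alpha>. \<integral>w. of_bool (R w \<le> \<alpha>) * ?m w \<partial>M))"
    unfolding interval_measure_weighted_cdf[OF R p max.cobounded1]
      interval_measure_weighted_cdf[OF R m max.cobounded1] e[OF p max.cobounded1] e[OF m max.cobounded1]
    by (subst Bochner_Integration.integral_diff[symmetric, OF gi[OF p] gi[OF m]],
        auto intro!: Bochner_Integration.integral_cong simp: max_def)
qed

text \<open>The indices with counting measure act as base space. The integrator jumps at
  \<open>r i\<close> and the integrand, a strict inequality, is evaluated at that very point, so
  ties contribute nothing. Division by zero yields 0 on both sides, which covers vanishing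
  denominators.\<close>

lemma auc_estimate_eq:
  "auc_estimate n r v = (\<Sum>i<n. \<Sum>j<n. of_bool (r i < r j) * v j * (1 - v i)) /
     ((\<Sum>i<n. v i) * (\<Sum>i<n. 1 - v i))"
proof -
  let ?S = "\<Sum>i<n. v i" and ?T = "\<Sum>i<n. 1 - v i"
  let ?g = "\<lambda>\<alpha>. (\<Sum>i<n. of_bool (r i > \<alpha>) * v i) / ?S"
  have 1: "(\<lambda>\<alpha>. (\<Sum>i<n. of_bool (r i \<le> \<alpha>) * (1 - v i)) / ?T) =
    (\<lambda>\<alpha>. \<integral>i. of_bool (r i \<le> \<alpha>) * ((1 - v i) / ?T) \<partial>count_space {..<n})"
    by (simp add: lebesgue_integral_count_space_finite sum_divide_distrib)
  have "auc_estimate n r v = (\<integral>i. (1 - v i) / ?T * ?g (r i) \<partial>count_space {..<n})"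
    unfolding auc_estimate_def 1
  proof (rule stieltjes_integral_weighted_cdf)
    show "r \<in> borel_measurable (count_space {..<n})" by simp
    show "integrable (count_space {..<n}) (\<lambda>i. (1 - v i) / ?T)" by (simp add: integrable_count_space)
    show "?g \<in> borel_measurable borel" by measurable
    show "\<bar>?g x\<bar> \<le> (\<Sum>i<n. \<bar>v i\<bar>) / \<bar>?S\<bar>" for x
      unfolding abs_divide
      by (intro divide_right_mono order_trans[OF sum_abs] sum_mono) auto
  qed
  also have "\<dots> = (\<Sum>i<n. \<Sum>j<n. of_bool (r i < r j) * v j * (1 - v i)) / (?S * ?T)"
    by (simp add: lebesgue_integral_count_space_finite sum_divide_distrib sum_distrib_left mult_ac
      del: sum_mult_of_bool_eq sum_of_bool_mult_eq)
  finally show ?thesis .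
qed

section \<open>Degenerate kernels of independent variables\<close>

lemma integrable_mult_square:
  fixes f g :: "'a \<Rightarrow> real"
  assumes [measurable]: "f \<in> borel_measurable M" "g \<in> borel_measurable M"
    and "integrable M (\<lambda>w. (f w)\<^sup>2)" "integrable M (\<lambda>w. (g w)\<^sup>2)"
  shows "integrable M (\<lambda>w. f w * g w)"
proof (rule Bochner_Integration.integrable_bound[of _ "\<lambda>w. (f w)\<^sup>2 + (g w)\<^sup>2"])
  have "\<bar>a * b\<bar> \<le> a\<^sup>2 + b\<^sup>2" for a b :: real
    using sum_squares_bound[of "\<bar>a\<bar>" "\<bar>b\<bar>"] mult_nonneg_nonneg[OF abs_ge_zero abs_ge_zero, of a b]
    unfolding abs_mult power2_abs mult.assoc by linarith
  then show "AE w in M. norm (f w * g w) \<le> norm ((f w)\<^sup>2 + (g w)\<^sup>2)" by simp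
qed (use assms in auto)

lemma
  fixes K :: "'p \<Rightarrow> 'a \<Rightarrow> real"
  assumes P: "finite P" and m: "\<And>p. p \<in> P \<Longrightarrow> K p \<in> borel_measurable M"
    and i: "\<And>p. p \<in> P \<Longrightarrow> integrable M (\<lambda>w. (K p w)\<^sup>2)"
  shows integrable_square_sum: "integrable M (\<lambda>w. (\<Sum>p\<in>P. K p w)\<^sup>2)"
    and integral_square_sum: "(\<integral>w. (\<Sum>p\<in>P. K p w)\<^sup>2 \<partial>M) = (\<Sum>p\<in>P. \<Sum>q\<in>P. \<integral>w. K p w * K q w \<partial>M)"
proof -
  have e: "(\<lambda>w. (\<Sum>p\<in>P. K p w)\<^sup>2) = (\<lambda>w. \<Sum>p\<in>P. \<Sum>q\<in>P. K p w * K q w)"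
    by (simp add: power2_eq_square sum_product)
  have "integrable M (\<lambda>w. K p w * K q w)" if "p \<in> P" "q \<in> P" for p q
    using that m i by (intro integrable_mult_square) auto
  then show "integrable M (\<lambda>w. (\<Sum>p\<in>P. K p w)\<^sup>2)"
    "(\<integral>w. (\<Sum>p\<in>P. K p w)\<^sup>2 \<partial>M) = (\<Sum>p\<in>P. \<Sum>q\<in>P. \<integral>w. K p w * K q w \<partial>M)"
    unfolding e by (auto simp: Bochner_Integration.integral_sum)
qed

context prob_space
begin

lemma indep_vars_mean_square_sum:
  fixes X :: "'i \<Rightarrow> 'a \<Rightarrow> real"
  assumes I: "finite I" "indep_vars (\<lambda>_. borel) X I"
    and sq: "\<And>i. i \<in> I \<Longrightarrow> integrable M (\<lambda>w. (X i w)\<^sup>2)"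
    and mean: "\<And>i. i \<in> I \<Longrightarrow> expectation (X i) = 0"
  shows "expectation (\<lambda>w. (\<Sum>i\<in>I. X i w)\<^sup>2) = (\<Sum>i\<in>I. expectation (\<lambda>w. (X i w)\<^sup>2))"
proof -
  have m: "X i \<in> borel_measurable M" if "i \<in> I" for i
    using I(2) that by (auto simp: indep_vars_def2)
  have int: "integrable M (X i)" if "i \<in> I" for i
    using square_integrable_imp_integrable[OF m sq] that by simp
  have "expectation (\<lambda>w. X i w * X j w) = (if i = j then expectation (\<lambda>w. (X i w)\<^sup>2) else 0)"
    if "i \<in> I" "j \<in> I" for i j
  proof (cases "i = j")
    case False
    then show ?thesis
      using indep_vars_lebesgue_integral[of "{i, j}" X] indep_vars_subset[OF I(2), of "{i, j}"] that int mean
      by auto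
  qed (simp add: power2_eq_square)
  then show ?thesis
    by (simp add: integral_square_sum[OF I(1) m sq] I(1))
qed

text \<open>Extracts from a family over \<open>nat + nat\<close> the sequences that later arguments
  need: the labeled sample, the unlabeled one, or a pooled row.\<close>

lemma indep_vars_reindex:
  assumes q: "inj_on q I" and ind: "indep_vars M' X (q ` I)"
  shows "indep_vars (\<lambda>i. M' (q i)) (\<lambda>i. X (q i)) I"
  unfolding indep_vars_def2
proof (intro conjI ballI indep_setsI)
  let ?F = "\<lambda>s. {X s -` A \<inter> space M | A. A \<in> sets (M' s)}"
  have F: "indep_sets ?F (q ` I)" and rv: "\<And>i. i \<in> I \<Longrightarrow> X (q i) \<in> measurable M (M' (q i))"
    using ind by (auto simp: indep_vars_def2)
  show "X (q i) \<in> measurable M (M' (q i))" if "i \<in> I" for i using rv[OF that] .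
  show "?F (q i) \<subseteq> events" if "i \<in> I" for i using rv[OF that] by (auto intro: measurable_sets)
  fix A J assume J: "J \<noteq> {}" "J \<subseteq> I" "finite J" and A: "\<forall>j\<in>J. A j \<in> ?F (q j)"
  have qJ: "inj_on q J" using q J(2) by (rule inj_on_subset)
  define A' where "A' s = A (inv_into J q s)" for s
  have A': "A' (q j) = A j" if "j \<in> J" for j using qJ that by (simp add: A'_def)
  have "prob (\<Inter>s\<in>q ` J. A' s) = (\<Prod>s\<in>q ` J. prob (A' s))"
    by (rule indep_setsD[OF F]) (use J A A' in auto)
  then show "prob (\<Inter>j\<in>J. A j) = (\<Prod>j\<in>J. prob (A j))"
    using A' by (simp add: prod.reindex[OF qJ])
qed

text \<open>Fubini on the product law: with \<open>W\<close> frozen, the inner integral over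
  \<open>U\<close> is zero. This is how a degenerate kernel kills a mixed moment in which some index
  occurs only once.\<close>

lemma indep_var_integral_eq_0:
  fixes G :: "'b \<times> 'b \<Rightarrow> real"
  assumes ind: "indep_var S U T W" and G[measurable]: "G \<in> borel_measurable (S \<Otimes>\<^sub>M T)"
    and int: "integrable M (\<lambda>w. G (U w, W w))"
    and zero: "\<And>y. y \<in> space T \<Longrightarrow> expectation (\<lambda>w. G (U w, y)) = 0"
  shows "expectation (\<lambda>w. G (U w, W w)) = 0"
proof -
  have [measurable]: "U \<in> measurable M S" "W \<in> measurable M T"
    and d: "distr M S U \<Otimes>\<^sub>M distr M T W = distr M (S \<Otimes>\<^sub>M T) (\<lambda>x. (U x, W x))"
    using ind unfolding indep_var_distribution_eq by auto
  interpret S: prob_space "distr M S U" by (rule prob_space_distr) simp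
  interpret T: prob_space "distr M T W" by (rule prob_space_distr) simp
  interpret ST: pair_sigma_finite "distr M S U" "distr M T W" ..
  have i: "integrable (distr M S U \<Otimes>\<^sub>M distr M T W) (\<lambda>(x, y). G (x, y))"
    unfolding d using int by (simp add: integrable_distr_eq)
  have "expectation (\<lambda>w. G (U w, W w)) = integral\<^sup>L (distr M S U \<Otimes>\<^sub>M distr M T W) (\<lambda>(x, y). G (x, y))"
    unfolding d by (simp add: integral_distr)
  also have "\<dots> = (\<integral>y. (\<integral>x. G (x, y) \<partial>distr M S U) \<partial>distr M T W)"
    using ST.integral_snd[OF i] by simp
  also have "\<dots> = (\<integral>y. 0 \<partial>distr M T W)"
  proof (rule Bochner_Integration.integral_cong[OF refl])
    fix y assume "y \<in> space (distr M T W)"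
    then have y: "y \<in> space T" by simp
    then have "(\<lambda>x. G (x, y)) \<in> borel_measurable S" by measurable
    then show "(\<integral>x. G (x, y) \<partial>distr M S U) = 0"
      using zero[OF y] by (simp add: integral_distr)
  qed
  finally show ?thesis by simp
qed

lemma indep_vars_imp_indep_var_pair:
  assumes ind: "indep_vars (\<lambda>_. S) Z I" and "i \<in> I" "j \<in> I" "i \<noteq> j"
  shows "indep_var S (Z i) S (Z j)"
proof -
  have "indep_var (PiM {i} (\<lambda>_. S)) (\<lambda>w. restrict (\<lambda>j. Z j w) {i}) (PiM {j} (\<lambda>_. S)) (\<lambda>w. restrict (\<lambda>j. Z j w) {j})"
    by (rule indep_var_restrict[OF ind]) (use assms in auto)
  from indep_var_compose[OF this, of "\<lambda>g. g i" S "\<lambda>g. g j" S]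
  show ?thesis by (simp add: comp_def)
qed

text \<open>Of the roughly \<open>m^4\<close> mixed moments off the diagonal only those survive
  whose two index pairs agree as sets, so the order is \<open>m^2\<close>. The factor 4 is 2 for the
  two orderings of a pair times 2 from splitting the squared sum into off-diagonal and diagonal; the
  same splitting puts the 2 in front of the diagonal moment.\<close>

lemma degenerate_kernel_mean_square:
  fixes k :: "'b::second_countable_topology \<Rightarrow> 'b \<Rightarrow> real" and Z :: "nat \<Rightarrow> 'a \<Rightarrow> 'b"
  assumes ind: "indep_vars (\<lambda>_. borel) Z {..<m}"
    and law: "\<And>i. i < m \<Longrightarrow> distr M borel (Z i) = \<mu>"
    and k[measurable]: "(\<lambda>(x, y). k x y) \<in> borel_measurable (borel \<Otimes>\<^sub>M borel)"
    and deg: "\<And>y. (\<integral>x. k x y \<partial>\<mu>) = 0" "\<And>x. (\<integral>y. k x y \<partial>\<mu>) = 0"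
    and sq: "integrable (\<mu> \<Otimes>\<^sub>M \<mu>) (\<lambda>(x, y). (k x y)\<^sup>2)" "integrable \<mu> (\<lambda>x. (k x x)\<^sup>2)"
  shows "integrable M (\<lambda>w. (\<Sum>i<m. \<Sum>j<m. k (Z i w) (Z j w))\<^sup>2)"
    and "expectation (\<lambda>w. (\<Sum>i<m. \<Sum>j<m. k (Z i w) (Z j w))\<^sup>2) \<le>
      (real m)\<^sup>2 * (4 * (\<integral>(x, y). (k x y)\<^sup>2 \<partial>(\<mu> \<Otimes>\<^sub>M \<mu>)) + 2 * (\<integral>x. (k x x)\<^sup>2 \<partial>\<mu>))"
proof -
  let ?c = "\<integral>(x, y). (k x y)\<^sup>2 \<partial>(\<mu> \<Otimes>\<^sub>M \<mu>)" and ?d = "\<integral>x. (k x x)\<^sup>2 \<partial>\<mu>"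
  let ?K = "\<lambda>p w. k (Z (fst p) w) (Z (snd p) w)"
  define P where "P = {p \<in> {..<m} \<times> {..<m}. fst p \<noteq> snd p}"
  have [measurable]: "Z i \<in> borel_measurable M" if "i < m" for i
    using ind that by (auto simp: indep_vars_def2)
  have Km: "?K p \<in> borel_measurable M" if "p \<in> {..<m} \<times> {..<m}" for p
    using that by (auto simp: mem_Times_iff)
  have sym: "integrable M (\<lambda>w. (?K p w)\<^sup>2) \<and> expectation (\<lambda>w. (?K p w)\<^sup>2) = ?c" if "p \<in> P" for p
  proof -
    obtain i j where "p = (i, j)" by (cases p)
    with that have p: "p = (i, j)" "i < m" "j < m" "i \<noteq> j" by (auto simp: P_def)
    have "indep_var borel (Z i) borel (Z j)"
      using indep_vars_imp_indep_var_pair[OF ind] p by auto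
    then have d: "\<mu> \<Otimes>\<^sub>M \<mu> = distr M (borel \<Otimes>\<^sub>M borel) (\<lambda>x. (Z i x, Z j x))"
      using p law unfolding indep_var_distribution_eq by simp
    show ?thesis
      using sq(1) p unfolding d by (simp add: integrable_distr_eq integral_distr)
  qed
  have ii: "integrable M (\<lambda>w. (k (Z i w) (Z i w))\<^sup>2)" "expectation (\<lambda>w. (k (Z i w) (Z i w))\<^sup>2) = ?d" if "i < m" for i
    using sq(2) that law[OF that, symmetric] by (simp_all add: integrable_distr_eq integral_distr)
  have int: "integrable M (\<lambda>w. ?K p w * ?K q w)" if "p \<in> P" "q \<in> P" for p q
    using that sym Km by (intro integrable_mult_square) (auto simp: P_def)
  \<comment> \<open>The index \<open>i\<close> occurs once, so \<open>Z i\<close> is independent of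
    the others jointly and can be integrated out, in the first slot of the kernel or in the second.
    The other indices may coincide, hence the restriction to the set \<open>?J\<close>.\<close>
  have zero: "expectation (\<lambda>w. k (Z i w) (Z j w) * k (Z a w) (Z b w)) = 0"
      "expectation (\<lambda>w. k (Z j w) (Z i w) * k (Z a w) (Z b w)) = 0"
    if *: "i < m" "j < m" "a < m" "b < m" "i \<noteq> j" "a \<noteq> b" "i \<noteq> a" "i \<noteq> b" for i j a b
  proof -
    let ?J = "{j, a, b}"
    let ?W = "\<lambda>w. restrict (\<lambda>j. Z j w) ?J"
    let ?U = "\<lambda>w. restrict (\<lambda>j. Z j w) {i}"
    have iv: "indep_var (PiM {i} (\<lambda>_. borel)) ?U (PiM ?J (\<lambda>_. borel)) ?W"
      by (rule indep_var_restrict[OF ind]) (use * in auto)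
    have "expectation (\<lambda>w. case (?U w, ?W w) of (f, g) \<Rightarrow> k (f i) (g j) * k (g a) (g b)) = 0"
    proof (rule indep_var_integral_eq_0[OF iv])
      show "integrable M (\<lambda>w. case (?U w, ?W w) of (f, g) \<Rightarrow> k (f i) (g j) * k (g a) (g b))"
        using int[of "(i, j)" "(a, b)"] * by (simp add: P_def)
      show "expectation (\<lambda>w. case (?U w, y) of (f, g) \<Rightarrow> k (f i) (g j) * k (g a) (g b)) = 0" for y
        using deg(1)[of "y j"] * law[OF *(1), symmetric] by (simp add: integral_distr)
    qed measurable
    then show "expectation (\<lambda>w. k (Z i w) (Z j w) * k (Z a w) (Z b w)) = 0" by simp
    have "expectation (\<lambda>w. case (?U w, ?W w) of (f, g) \<Rightarrow> k (g j) (f i) * k (g a) (g b)) = 0"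
    proof (rule indep_var_integral_eq_0[OF iv])
      show "integrable M (\<lambda>w. case (?U w, ?W w) of (f, g) \<Rightarrow> k (g j) (f i) * k (g a) (g b))"
        using int[of "(j, i)" "(a, b)"] * by (simp add: P_def)
      show "expectation (\<lambda>w. case (?U w, y) of (f, g) \<Rightarrow> k (g j) (f i) * k (g a) (g b)) = 0" for y
        using deg(2)[of "y j"] * law[OF *(1), symmetric] by (simp add: integral_distr)
    qed measurable
    then show "expectation (\<lambda>w. k (Z j w) (Z i w) * k (Z a w) (Z b w)) = 0" by simp
  qed
  have le: "expectation (\<lambda>w. ?K p w * ?K q w) \<le> (if q = p \<or> q = prod.swap p then ?c else 0)" if "p \<in> P" "q \<in> P" for p q
  proof (cases "q = p \<or> q = prod.swap p")
    case True
    \<comment> \<open>The kernel need not be symmetric, so a swapped pair gives no equality; AM-GM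
      still bounds its moment by \<open>?c\<close>.\<close>
    have "expectation (\<lambda>w. ?K p w * ?K q w) \<le> expectation (\<lambda>w. ((?K p w)\<^sup>2 + (?K q w)\<^sup>2) / 2)"
    proof (rule integral_mono)
      show "integrable M (\<lambda>w. ((?K p w)\<^sup>2 + (?K q w)\<^sup>2) / 2)" using sym that by simp
      show "?K p w * ?K q w \<le> ((?K p w)\<^sup>2 + (?K q w)\<^sup>2) / 2" for w
        using sum_squares_bound[of "?K p w" "?K q w"] by simp
    qed (rule int[OF that])
    also have "\<dots> = ?c" using sym that by simp
    finally show ?thesis using True by simp
  next
    case False
    obtain i j a b where pq: "p = (i, j)" "q = (a, b)" by (cases p, cases q) auto
    have *: "i < m" "j < m" "a < m" "b < m" "i \<noteq> j" "a \<noteq> b" using that pq by (auto simp: P_def)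
    \<comment> \<open>Two different two-element index sets: some index of \<open>p\<close> is
      missing from \<open>q\<close>.\<close>
    from False pq * consider "i \<noteq> a" "i \<noteq> b" | "j \<noteq> a" "j \<noteq> b" by auto
    then have "expectation (\<lambda>w. ?K p w * ?K q w) = 0"
    proof cases
      case 1
      then show ?thesis unfolding pq fst_conv snd_conv using * by (intro zero(1)) auto
    next
      case 2
      then show ?thesis unfolding pq fst_conv snd_conv using * by (intro zero(2)) auto
    qed
    then show ?thesis using False by simp
  qed
  have fP: "finite P" by (simp add: P_def)
  have c0: "0 \<le> ?c" by (intro integral_nonneg_AE) auto
  have cardP: "real (card P) \<le> (real m)\<^sup>2"
  proof -
    have "card P \<le> card ({..<m} \<times> {..<m})" by (intro card_mono) (auto simp: P_def)
    then have "real (card P) \<le> real (m * m)" by (simp only: of_nat_le_iff card_cartesian_product card_lessThan)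
    then show ?thesis by (simp add: power2_eq_square)
  qed
  note off = integrable_square_sum[OF fP, of ?K M] integral_square_sum[OF fP, of ?K M]
  have off_int: "integrable M (\<lambda>w. (\<Sum>p\<in>P. ?K p w)\<^sup>2)"
    using sym Km by (intro off(1)) (auto simp: P_def)
  have off_le: "expectation (\<lambda>w. (\<Sum>p\<in>P. ?K p w)\<^sup>2) \<le> 2 * (real m)\<^sup>2 * ?c"
  proof -
    have "expectation (\<lambda>w. (\<Sum>p\<in>P. ?K p w)\<^sup>2) = (\<Sum>p\<in>P. \<Sum>q\<in>P. expectation (\<lambda>w. ?K p w * ?K q w))"
      using sym Km by (intro off(2)) (auto simp: P_def)
    also have "\<dots> \<le> (\<Sum>p\<in>P. \<Sum>q\<in>P. if q = p \<or> q = prod.swap p then ?c else 0)"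
      by (intro sum_mono le)
    also have "\<dots> \<le> (\<Sum>p\<in>P. 2 * ?c)"
    proof (rule sum_mono)
      fix p assume "p \<in> P"
      have "card (P \<inter> {q. q = p \<or> q = prod.swap p}) \<le> card {p, prod.swap p}"
        by (rule card_mono) auto
      also have "\<dots> \<le> 2" by (rule order_trans[OF card_insert_le_m1]) auto
      finally have "real (card (P \<inter> {q. q = p \<or> q = prod.swap p})) * ?c \<le> 2 * ?c"
        using c0 by (intro mult_right_mono) auto
      then show "(\<Sum>q\<in>P. if q = p \<or> q = prod.swap p then ?c else 0) \<le> 2 * ?c"
        using fP by (simp add: sum.If_cases)
    qed
    also have "\<dots> = real (card P) * (2 * ?c)" by simp
    also have "\<dots> \<le> (real m)\<^sup>2 * (2 * ?c)" using cardP c0 by (intro mult_right_mono) auto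
    finally show ?thesis by (simp add: mult_ac)
  qed
  let ?D = "\<lambda>w. \<Sum>i<m. k (Z i w) (Z i w)"
  have D_int: "integrable M (\<lambda>w. (?D w)\<^sup>2)"
    using ii by (intro integrable_square_sum) auto
  \<comment> \<open>Diagonal terms need not be centred, so there is no cancellation to exploit;
    Cauchy-Schwarz costs a factor \<open>m\<close>, which stays within the order
    \<open>m^2\<close>.\<close>
  have D_le: "expectation (\<lambda>w. (?D w)\<^sup>2) \<le> (real m)\<^sup>2 * ?d"
  proof -
    have "expectation (\<lambda>w. (?D w)\<^sup>2) \<le> expectation (\<lambda>w. real m * (\<Sum>i<m. (k (Z i w) (Z i w))\<^sup>2))"
    proof (rule integral_mono[OF D_int])
      show "(?D w)\<^sup>2 \<le> real m * (\<Sum>i<m. (k (Z i w) (Z i w))\<^sup>2)" for w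
        using sum_squared_le_sum_of_squares[of "\<lambda>i. k (Z i w) (Z i w)" "{..<m}"] by (simp add: mult.commute)
      show "integrable M (\<lambda>w. real m * (\<Sum>i<m. (k (Z i w) (Z i w))\<^sup>2))"
        by (intro integrable_mult_right Bochner_Integration.integrable_sum ii) auto
    qed
    also have "\<dots> = real m * (\<Sum>i<m. expectation (\<lambda>w. (k (Z i w) (Z i w))\<^sup>2))"
      by (subst integral_mult_right_zero, subst Bochner_Integration.integral_sum) (auto intro: ii(1))
    also have "(\<Sum>i<m. expectation (\<lambda>w. (k (Z i w) (Z i w))\<^sup>2)) = (\<Sum>i<m. ?d)"
      by (intro sum.cong ii) auto
    finally show ?thesis by (simp add: power2_eq_square)
  qed
  have split: "(\<Sum>i<m. \<Sum>j<m. k (Z i w) (Z j w)) = (\<Sum>p\<in>P. ?K p w) + ?D w" for w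
  proof -
    have "(\<Sum>i<m. \<Sum>j<m. k (Z i w) (Z j w)) = (\<Sum>p\<in>{..<m} \<times> {..<m}. ?K p w)"
      by (simp add: sum.cartesian_product case_prod_beta)
    also have "\<dots> = (\<Sum>p\<in>P. ?K p w) + (\<Sum>p\<in>(\<lambda>i. (i, i)) ` {..<m}. ?K p w)"
      by (subst sum.union_disjoint[symmetric]) (auto simp: P_def intro!: sum.cong)
    also have "(\<Sum>p\<in>(\<lambda>i. (i, i)) ` {..<m}. ?K p w) = ?D w"
      by (subst sum.reindex) (auto simp: inj_on_def)
    finally show ?thesis .
  qed
  have pm: "(a + b)\<^sup>2 \<le> 2 * a\<^sup>2 + 2 * b\<^sup>2" for a b :: real
    using sum_squares_bound[of a b] by (simp add: power2_sum)
  have [measurable]: "(\<lambda>w. \<Sum>p\<in>P. ?K p w) \<in> borel_measurable M"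
    using Km by (intro borel_measurable_sum) (auto simp: P_def)
  have [measurable]: "?D \<in> borel_measurable M" by (intro borel_measurable_sum) auto
  show I: "integrable M (\<lambda>w. (\<Sum>i<m. \<Sum>j<m. k (Z i w) (Z j w))\<^sup>2)"
    unfolding split
  proof (rule Bochner_Integration.integrable_bound)
    show "integrable M (\<lambda>w. 2 * (\<Sum>p\<in>P. ?K p w)\<^sup>2 + 2 * (?D w)\<^sup>2)" using off_int D_int by simp
    show "AE w in M. norm (((\<Sum>p\<in>P. ?K p w) + ?D w)\<^sup>2) \<le> norm (2 * (\<Sum>p\<in>P. ?K p w)\<^sup>2 + 2 * (?D w)\<^sup>2)"
      using pm by simp
  qed measurable
  have "expectation (\<lambda>w. (\<Sum>i<m. \<Sum>j<m. k (Z i w) (Z j w))\<^sup>2) \<le>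
    expectation (\<lambda>w. 2 * (\<Sum>p\<in>P. ?K p w)\<^sup>2 + 2 * (?D w)\<^sup>2)"
    using off_int D_int pm by (intro integral_mono[OF I]) (auto simp: split)
  also have "\<dots> \<le> (real m)\<^sup>2 * (4 * ?c + 2 * ?d)"
    using off_int D_int off_le D_le by (simp add: algebra_simps)
  finally show "expectation (\<lambda>w. (\<Sum>i<m. \<Sum>j<m. k (Z i w) (Z j w))\<^sup>2) \<le>
      (real m)\<^sup>2 * (4 * ?c + 2 * ?d)" .
qed

end

section \<open>The Hajek projection of the AUC kernel\<close>

lemma measurable_fst_borel[measurable]: "(fst :: real \<times> real \<Rightarrow> real) \<in> borel_measurable borel"
  and measurable_snd_borel[measurable]: "(snd :: real \<times> real \<Rightarrow> real) \<in> borel_measurable borel"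
  by (intro borel_measurable_continuous_onI continuous_intros)+

text \<open>The left limit of the weighted distribution function at \<open>r\<close> is the integral
  over \<open>R w < r\<close>, so its jump there is the integral over the level set. As
  \<open>u\<close> is signed, dominated convergence takes the place of monotonicity.\<close>

lemma integral_eq_level_0:
  fixes R u :: "'a \<Rightarrow> real"
  assumes R[measurable]: "R \<in> borel_measurable M" and u: "integrable M u"
    and cont: "isCont (\<lambda>\<alpha>. \<integral>w. of_bool (R w \<le> \<alpha>) * u w \<partial>M) r"
  shows "(\<integral>w. of_bool (R w = r) * u w \<partial>M) = 0"
proof -
  have [measurable]: "u \<in> borel_measurable M" using u by simp
  let ?F = "\<lambda>\<alpha>. \<integral>w. of_bool (R w \<le> \<alpha>) * u w \<partial>M"
  have i: "integrable M (\<lambda>w. of_bool (P w) * u w)" if [measurable]: "Measurable.pred M P" for P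
    by (rule Bochner_Integration.integrable_bound[OF u]) auto
  \<comment> \<open>Strictly below \<open>r\<close>, so that the indicators tend to that of
    \<open>R w < r\<close>.\<close>
  let ?s = "\<lambda>n::nat. r - 1 / real (Suc n)"
  have s: "?s \<longlonglongrightarrow> r" using tendsto_diff[OF tendsto_const LIMSEQ_inverse_real_of_nat, of r] by (simp add: inverse_eq_divide)
  have "(\<lambda>n. ?F (?s n)) \<longlonglongrightarrow> ?F r"
    using cont s by (rule isCont_tendsto_compose)
  moreover have "(\<lambda>n. ?F (?s n)) \<longlonglongrightarrow> (\<integral>w. of_bool (R w < r) * u w \<partial>M)"
  proof (rule integral_dominated_convergence[where w="\<lambda>w. \<bar>u w\<bar>"])
    show "AE w in M. (\<lambda>n. of_bool (R w \<le> ?s n) * u w) \<longlonglongrightarrow> of_bool (R w < r) * u w"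
    proof (rule AE_I2)
      fix w
      have "eventually (\<lambda>n. (R w \<le> ?s n) = (R w < r)) sequentially"
      proof (cases "R w < r")
        case True
        then have "eventually (\<lambda>n. R w < ?s n) sequentially" using s by (rule order_tendstoD(1)[rotated])
        then show ?thesis by eventually_elim (use True in auto)
      next
        case False
        have "\<not> R w \<le> ?s n" for n using False by (auto simp: not_le intro: less_le_trans[of _ r])
        with False show ?thesis by auto
      qed
      then have "eventually (\<lambda>n. of_bool (R w \<le> ?s n) * u w = of_bool (R w < r) * u w) sequentially"
        by eventually_elim simp
      then show "(\<lambda>n. of_bool (R w \<le> ?s n) * u w) \<longlonglongrightarrow> of_bool (R w < r) * u w"
        by (rule tendsto_eventually)
    qed
  qed (use u in auto)
  ultimately have eq: "?F r = (\<integral>w. of_bool (R w < r) * u w \<partial>M)" by (rule LIMSEQ_unique)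
  have "(\<integral>w. of_bool (R w = r) * u w \<partial>M) = ?F r - (\<integral>w. of_bool (R w < r) * u w \<partial>M)"
    by (subst Bochner_Integration.integral_diff[symmetric]) (auto intro!: i Bochner_Integration.integral_cong)
  then show ?thesis using eq by simp
qed

text \<open>Stands for either population, with \<open>V = Y\<close> or with \<open>V = f(X)\<close>.
  Nonnegativity and the absence of common jumps deal with atoms of \<open>R\<close>; square
  integrability controls the degenerate part and the limit variance.\<close>

locale auc_population = prob_space M for M :: "'a measure" +
  fixes R V :: "'a \<Rightarrow> real"
  assumes R[measurable]: "R \<in> borel_measurable M" and V[measurable]: "V \<in> borel_measurable M"
    and V_square: "integrable M (\<lambda>w. (V w)\<^sup>2)"
    and V_nonneg: "AE w in M. 0 \<le> V w"
    and nondegenerate: "(\<integral>w. V w \<partial>M) * (1 - (\<integral>w. V w \<partial>M)) \<noteq> 0"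
    and no_common_jump: "auc_no_common_jump M R V"
begin

definition p where "p = expectation V"
definition \<Delta> where "\<Delta> = p * (1 - p)"
definition \<mu> where "\<mu> = distr M borel (\<lambda>w. (R w, V w))"
definition G where "G r = (\<integral>w. of_bool (R w > r) * V w \<partial>M)"
definition H where "H r = (\<integral>w. of_bool (R w < r) * (1 - V w) \<partial>M)"
text \<open>The first argument acts as a control with weight \<open>1 - snd x\<close>, the second as
  a case with weight \<open>snd y\<close>.\<close>

definition kern :: "real \<times> real \<Rightarrow> real \<times> real \<Rightarrow> real"
  where "kern x y = of_bool (fst x < fst y) * snd y * (1 - snd x)"
text \<open>\<open>proj1\<close> is the integral of \<open>kern\<close> over its second argument,
  \<open>proj2\<close> the one over its first: the two summands of the Hajek projection before
  centring. \<open>H\<close> is strict because the kernel is.\<close>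

definition proj1 where "proj1 x = (1 - snd x) * G (fst x)"
definition proj2 where "proj2 y = snd y * H (fst y)"
abbreviation \<theta> where "\<theta> \<equiv> auc_target M R V"
abbreviation \<phi> where "\<phi> \<equiv> auc_influence M R V"
text \<open>Mean of \<open>kern\<close> under two independent copies, and thus
  \<open>\<Delta> * \<theta>\<close>.\<close>

definition numer where "numer = (\<integral>x. proj1 x \<partial>\<mu>)"
text \<open>The completely degenerate component of the Hoeffding decomposition; \<open>numer\<close>
  is added back because each projection removes the mean once.\<close>

definition degen where "degen x y = kern x y - proj1 x - proj2 y + numer"

lemma V_integrable: "integrable M V"
  using square_integrable_imp_integrable[OF V V_square] .

lemma \<Delta>_nonzero: "\<Delta> \<noteq> 0" "p \<noteq> 0" "1 - p \<noteq> 0"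
  using nondegenerate by (auto simp: \<Delta>_def p_def)

lemma integral_one_minus_V: "(\<integral>w. 1 - V w \<partial>M) = 1 - p"
  using V_integrable by (simp add: p_def prob_space)

lemma integrable_of_bool_mult:
  assumes "integrable M u" and [measurable]: "Measurable.pred M P"
  shows "integrable M (\<lambda>w. of_bool (P w) * u w :: real)"
  by (rule Bochner_Integration.integrable_bound[OF assms(1)])
    (use borel_measurable_integrable[OF assms(1)] in auto)

lemma G_eq: "G r = p - (\<integral>w. of_bool (R w \<le> r) * V w \<partial>M)"
  unfolding G_def p_def using V_integrable
  by (subst Bochner_Integration.integral_diff[symmetric])
    (auto intro!: integrable_of_bool_mult Bochner_Integration.integral_cong)

lemma G_measurable[measurable]: "G \<in> borel_measurable borel"
  unfolding G_def by measurable

lemma H_measurable[measurable]: "H \<in> borel_measurable borel"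
  unfolding H_def by measurable

lemma abs_integral_of_bool_le:
  fixes u :: "'a \<Rightarrow> real"
  assumes "integrable M u" and [measurable]: "Measurable.pred M P"
  shows "\<bar>\<integral>w. of_bool (P w) * u w \<partial>M\<bar> \<le> (\<integral>w. \<bar>u w\<bar> \<partial>M)"
proof -
  have "\<bar>\<integral>w. of_bool (P w) * u w \<partial>M\<bar> \<le> (\<integral>w. \<bar>of_bool (P w) * u w\<bar> \<partial>M)"
    using integral_norm_bound[of M "\<lambda>w. of_bool (P w) * u w"] by simp
  also have "\<dots> \<le> (\<integral>w. \<bar>u w\<bar> \<partial>M)"
    using integrable_of_bool_mult[OF assms] assms(1) by (intro integral_mono) auto
  finally show ?thesis .
qed

lemma G_bound: "\<bar>G r\<bar> \<le> (\<integral>w. \<bar>V w\<bar> \<partial>M)"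
  unfolding G_def using V_integrable by (intro abs_integral_of_bool_le) auto

lemma H_bound: "\<bar>H r\<bar> \<le> (\<integral>w. \<bar>1 - V w\<bar> \<partial>M)"
  unfolding H_def using V_integrable by (intro abs_integral_of_bool_le) auto

sublocale \<mu>: prob_space \<mu>
  unfolding \<mu>_def by (rule prob_space_distr) measurable

lemma sets_\<mu>[measurable_cong, simp]: "sets \<mu> = sets borel" and space_\<mu>[simp]: "space \<mu> = UNIV"
  by (simp_all add: \<mu>_def)

lemma prob_\<mu>[simp]: "measure \<mu> UNIV = 1"
  using \<mu>.prob_space by simp

lemma integral_\<mu>: "g \<in> borel_measurable borel \<Longrightarrow> (\<integral>x. g x \<partial>\<mu>) = (\<integral>w. g (R w, V w) \<partial>M)" for g :: "_ \<Rightarrow> real"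
  unfolding \<mu>_def by (rule integral_distr) auto

lemma integrable_\<mu>: "g \<in> borel_measurable borel \<Longrightarrow> integrable \<mu> g \<longleftrightarrow> integrable M (\<lambda>w. g (R w, V w))" for g :: "_ \<Rightarrow> real"
  unfolding \<mu>_def by (rule integrable_distr_eq) auto

lemma proj1_measurable[measurable]: "proj1 \<in> borel_measurable borel"
  and proj2_measurable[measurable]: "proj2 \<in> borel_measurable borel"
  unfolding proj1_def[abs_def] proj2_def[abs_def] by measurable

lemma target_eq: "\<theta> = numer / \<Delta>"
proof -
  let ?g = "\<lambda>\<alpha>. G \<alpha> / p"
  have "\<theta> = stieltjes_integral ?g (\<lambda>\<alpha>. \<integral>w. of_bool (R w \<le> \<alpha>) * ((1 - V w) / (1 - p)) \<partial>M)"
    unfolding auc_target_def integral_one_minus_V G_def p_def by simp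
  also have "\<dots> = (\<integral>w. (1 - V w) / (1 - p) * ?g (R w) \<partial>M)"
  proof (rule stieltjes_integral_weighted_cdf)
    show "\<bar>?g x\<bar> \<le> (\<integral>w. \<bar>V w\<bar> \<partial>M) / \<bar>p\<bar>" for x
      using G_bound by (simp add: divide_right_mono)
  qed (use V_integrable in auto)
  also have "\<dots> = (\<integral>w. proj1 (R w, V w) / \<Delta> \<partial>M)"
    by (simp add: proj1_def \<Delta>_def mult_ac)
  also have "\<dots> = numer / \<Delta>"
    unfolding numer_def by (subst integral_\<mu>) (auto simp: proj1_def)
  finally show ?thesis .
qed

lemma kern_measurable[measurable]: "(\<lambda>(x, y). kern x y) \<in> borel_measurable (borel \<Otimes>\<^sub>M borel)"
  unfolding kern_def[abs_def] by measurable

lemma degen_measurable[measurable]: "(\<lambda>(x, y). degen x y) \<in> borel_measurable (borel \<Otimes>\<^sub>M borel)"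
  unfolding degen_def[abs_def] by measurable

lemma integral_kern_right: "(\<integral>y. kern x y \<partial>\<mu>) = proj1 x"
proof -
  have "(\<integral>y. kern x y \<partial>\<mu>) = (\<integral>w. of_bool (fst x < R w) * V w * (1 - snd x) \<partial>M)"
    by (subst integral_\<mu>) (auto simp: kern_def)
  then show ?thesis by (simp add: proj1_def G_def mult.commute)
qed

lemma integral_kern_left: "(\<integral>x. kern x y \<partial>\<mu>) = proj2 y"
proof -
  have "(\<integral>x. kern x y \<partial>\<mu>) = (\<integral>w. snd y * (of_bool (R w < fst y) * (1 - V w)) \<partial>M)"
    by (subst integral_\<mu>) (auto simp: kern_def mult_ac)
  then show ?thesis by (simp add: proj2_def H_def)
qed

section \<open>Integrability and degeneracy of the kernel\<close>

lemma square_weight_integrable: "integrable \<mu> (\<lambda>x. (1 + \<bar>snd x\<bar>)\<^sup>2)"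
  using V_integrable V_square by (subst integrable_\<mu>) (auto simp: power2_sum)

lemma integrable_pair_weight: "integrable (\<mu> \<Otimes>\<^sub>M \<mu>) (\<lambda>z. (1 + \<bar>snd (fst z)\<bar>)\<^sup>2 * (1 + \<bar>snd (snd z)\<bar>)\<^sup>2)"
proof -
  interpret pp: pair_sigma_finite \<mu> \<mu> ..
  show ?thesis
    using square_weight_integrable
    by (intro pp.Fubini_integrable) (auto simp: case_prod_beta)
qed

lemma square_weight_ge: "1 + \<bar>v\<bar> \<le> (1 + \<bar>v\<bar>)\<^sup>2" for v :: real
  by (simp add: power2_eq_square algebra_simps)

text \<open>\<open>V\<close> may be unbounded, so kernel and projections are compared with the
  weight \<open>1 + \<bar>v\<bar>\<close>; its square is integrable because \<open>V\<close> has a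
  second moment, and on the product measure so is the product of two such squares.\<close>

lemma kern_bound: "\<bar>kern x y\<bar> \<le> (1 + \<bar>snd x\<bar>) * (1 + \<bar>snd y\<bar>)"
proof -
  have "\<bar>kern x y\<bar> \<le> \<bar>1 - snd x\<bar> * \<bar>snd y\<bar>"
    unfolding kern_def by (auto simp: abs_mult mult_ac)
  also have "\<dots> \<le> (1 + \<bar>snd x\<bar>) * (1 + \<bar>snd y\<bar>)" by (intro mult_mono) auto
  finally show ?thesis .
qed

lemma integrable_kern: "integrable (\<mu> \<Otimes>\<^sub>M \<mu>) (\<lambda>(x, y). kern x y)"
proof (rule Bochner_Integration.integrable_bound[OF integrable_pair_weight])
  show "AE z in \<mu> \<Otimes>\<^sub>M \<mu>. norm (case z of (x, y) \<Rightarrow> kern x y) \<le>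
      norm ((1 + \<bar>snd (fst z)\<bar>)\<^sup>2 * (1 + \<bar>snd (snd z)\<bar>)\<^sup>2)"
  proof (rule AE_I2)
    fix z
    have "\<bar>kern (fst z) (snd z)\<bar> \<le> (1 + \<bar>snd (fst z)\<bar>) * (1 + \<bar>snd (snd z)\<bar>)" by (rule kern_bound)
    also have "\<dots> \<le> (1 + \<bar>snd (fst z)\<bar>)\<^sup>2 * (1 + \<bar>snd (snd z)\<bar>)\<^sup>2"
      by (intro mult_mono square_weight_ge) auto
    finally show "norm (case z of (x, y) \<Rightarrow> kern x y) \<le> norm ((1 + \<bar>snd (fst z)\<bar>)\<^sup>2 * (1 + \<bar>snd (snd z)\<bar>)\<^sup>2)"
      by (simp add: case_prod_beta)
  qed
qed measurable

lemma proj1_bound: "\<bar>proj1 x\<bar> \<le> (\<integral>w. \<bar>V w\<bar> \<partial>M) * (1 + \<bar>snd x\<bar>)"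
proof -
  have "\<bar>proj1 x\<bar> = \<bar>G (fst x)\<bar> * \<bar>1 - snd x\<bar>" by (simp add: proj1_def abs_mult)
  also have "\<dots> \<le> (\<integral>w. \<bar>V w\<bar> \<partial>M) * (1 + \<bar>snd x\<bar>)" by (intro mult_mono G_bound) auto
  finally show ?thesis .
qed

lemma proj2_bound: "\<bar>proj2 x\<bar> \<le> (\<integral>w. \<bar>1 - V w\<bar> \<partial>M) * (1 + \<bar>snd x\<bar>)"
proof -
  have "\<bar>proj2 x\<bar> = \<bar>H (fst x)\<bar> * \<bar>snd x\<bar>" by (simp add: proj2_def abs_mult)
  also have "\<dots> \<le> (\<integral>w. \<bar>1 - V w\<bar> \<partial>M) * (1 + \<bar>snd x\<bar>)" by (intro mult_mono H_bound) auto
  finally show ?thesis .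
qed

lemma integrable_square_of_bound:
  fixes g :: "real \<times> real \<Rightarrow> real"
  assumes [measurable]: "g \<in> borel_measurable borel" and b: "\<And>x. \<bar>g x\<bar> \<le> c * (1 + \<bar>snd x\<bar>)"
  shows "integrable \<mu> (\<lambda>x. (g x)\<^sup>2)" "integrable \<mu> g"
proof -
  show i: "integrable \<mu> (\<lambda>x. (g x)\<^sup>2)"
  proof (rule Bochner_Integration.integrable_bound)
    show "integrable \<mu> (\<lambda>x. c\<^sup>2 * (1 + \<bar>snd x\<bar>)\<^sup>2)" using square_weight_integrable by simp
    have "(g x)\<^sup>2 \<le> c\<^sup>2 * (1 + \<bar>snd x\<bar>)\<^sup>2" for x
      unfolding power_mult_distrib[symmetric] using b by (rule power2_le_iff_abs_le[THEN iffD2, rotated])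
        (use order_trans[OF abs_ge_zero b] in auto)
    then show "AE x in \<mu>. norm ((g x)\<^sup>2) \<le> norm (c\<^sup>2 * (1 + \<bar>snd x\<bar>)\<^sup>2)" by simp
    show "(\<lambda>x. (g x)\<^sup>2) \<in> borel_measurable \<mu>"
      using borel_measurable_power[OF assms(1)] by (simp add: measurable_cong_sets[OF sets_\<mu> refl])
  qed
  have "g \<in> borel_measurable \<mu>"
    using assms(1) by (simp add: measurable_cong_sets[OF sets_\<mu> refl])
  then show "integrable \<mu> g"
    using i by (rule \<mu>.square_integrable_imp_integrable)
qed

lemmas proj1_square = integrable_square_of_bound[OF proj1_measurable proj1_bound]
lemmas proj2_square = integrable_square_of_bound[OF proj2_measurable proj2_bound]

text \<open>By Fubini both iterated integrals of \<open>kern\<close> agree, so one constant centres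
  both projections.\<close>

lemma integral_proj2: "(\<integral>x. proj2 x \<partial>\<mu>) = numer"
proof -
  interpret pp: pair_sigma_finite \<mu> \<mu> ..
  show ?thesis
    using pp.Fubini_integral[OF integrable_kern]
    by (simp add: integral_kern_left integral_kern_right numer_def)
qed

lemma integrable_kern_section: "integrable \<mu> (kern x)" "integrable \<mu> (\<lambda>x. kern x y)"
  by (rule integrable_square_of_bound[where c="1 + \<bar>snd x\<bar>"], use kern_bound[of x] in simp_all)
    (rule integrable_square_of_bound[where c="1 + \<bar>snd y\<bar>"], use kern_bound[of _ y] in \<open>simp_all add: mult.commute\<close>)

lemma degen_left: "(\<integral>x. degen x y \<partial>\<mu>) = 0" and degen_right: "(\<integral>y. degen x y \<partial>\<mu>) = 0"
  unfolding degen_def using integrable_kern_section proj1_square(2) proj2_square(2)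
  by (simp_all add: integral_kern_left integral_kern_right integral_proj2 numer_def \<mu>.prob_space)

lemma degen_square:
  "integrable (\<mu> \<Otimes>\<^sub>M \<mu>) (\<lambda>(x, y). (degen x y)\<^sup>2)" "integrable \<mu> (\<lambda>x. (degen x x)\<^sup>2)"
proof -
  define B1 where "B1 = (\<integral>w. \<bar>V w\<bar> \<partial>M)"
  define B2 where "B2 = (\<integral>w. \<bar>1 - V w\<bar> \<partial>M)"
  have B: "0 \<le> B1" "0 \<le> B2" by (simp_all add: B1_def B2_def)
  define c where "c = B1 + B2 + \<bar>numer\<bar>"
  show "integrable \<mu> (\<lambda>x. (degen x x)\<^sup>2)"
  proof (rule integrable_square_of_bound(1)[where c=c])
    show "\<bar>degen x x\<bar> \<le> c * (1 + \<bar>snd x\<bar>)" for x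
    proof -
      \<comment> \<open>\<open>kern x x = 0\<close> by strictness; on the diagonal only the
        projections and the constant remain.\<close>
      have "\<bar>degen x x\<bar> \<le> \<bar>proj1 x\<bar> + \<bar>proj2 x\<bar> + \<bar>numer\<bar>" by (simp add: degen_def kern_def)
      also have "\<dots> \<le> B1 * (1 + \<bar>snd x\<bar>) + B2 * (1 + \<bar>snd x\<bar>) + \<bar>numer\<bar> * (1 + \<bar>snd x\<bar>)"
        using proj1_bound[of x] proj2_bound[of x] unfolding B1_def B2_def
        by (intro add_mono) (auto simp: algebra_simps)
      finally show ?thesis by (simp add: c_def algebra_simps)
    qed
    have "(\<lambda>x. (case (x, x) of (x, y) \<Rightarrow> degen x y)) \<in> borel_measurable borel" by measurable
    then show "(\<lambda>x. degen x x) \<in> borel_measurable borel" by simp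
  qed
  show "integrable (\<mu> \<Otimes>\<^sub>M \<mu>) (\<lambda>(x, y). (degen x y)\<^sup>2)"
  proof (rule Bochner_Integration.integrable_bound)
    show "integrable (\<mu> \<Otimes>\<^sub>M \<mu>) (\<lambda>z. (1 + c)\<^sup>2 * ((1 + \<bar>snd (fst z)\<bar>)\<^sup>2 * (1 + \<bar>snd (snd z)\<bar>)\<^sup>2))"
      using integrable_pair_weight by simp
    show "AE z in \<mu> \<Otimes>\<^sub>M \<mu>. norm (case z of (x, y) \<Rightarrow> (degen x y)\<^sup>2) \<le>
        norm ((1 + c)\<^sup>2 * ((1 + \<bar>snd (fst z)\<bar>)\<^sup>2 * (1 + \<bar>snd (snd z)\<bar>)\<^sup>2))"
    proof (rule AE_I2)
      fix z :: "(real \<times> real) \<times> (real \<times> real)"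
      obtain x y where z: "z = (x, y)" by (cases z)
      let ?a = "1 + \<bar>snd x\<bar>" and ?b = "1 + \<bar>snd y\<bar>"
      \<comment> \<open>Both weights are at least 1, which lifts the bounds of the separate terms to
        the common product \<open>?a * ?b\<close>.\<close>
      have ab: "?a \<le> ?a * ?b" "?b \<le> ?a * ?b" "1 \<le> ?a * ?b"
        using mult_left_mono[of 1 ?b ?a] mult_right_mono[of 1 ?a ?b] mult_mono[of 1 ?a 1 ?b] by auto
      have "\<bar>degen x y\<bar> \<le> \<bar>kern x y\<bar> + \<bar>proj1 x\<bar> + \<bar>proj2 y\<bar> + \<bar>numer\<bar>"
        unfolding degen_def by linarith
      also have "\<dots> \<le> ?a * ?b + B1 * (?a * ?b) + B2 * (?a * ?b) + \<bar>numer\<bar> * (?a * ?b)"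
      proof (intro add_mono)
        show "\<bar>kern x y\<bar> \<le> ?a * ?b" by (rule kern_bound)
        show "\<bar>proj1 x\<bar> \<le> B1 * (?a * ?b)"
          using proj1_bound[of x] mult_left_mono[OF ab(1) B(1)] unfolding B1_def[symmetric] by (rule order_trans)
        show "\<bar>proj2 y\<bar> \<le> B2 * (?a * ?b)"
          using proj2_bound[of y] mult_left_mono[OF ab(2) B(2)] unfolding B2_def[symmetric] by (rule order_trans)
        show "\<bar>numer\<bar> \<le> \<bar>numer\<bar> * (?a * ?b)"
          using mult_left_mono[OF ab(3), of "\<bar>numer\<bar>"] by simp
      qed
      also have "\<dots> = (1 + c) * (?a * ?b)" unfolding c_def by (simp only: distrib_right mult_1_left add.assoc)
      finally have le: "\<bar>degen x y\<bar> \<le> (1 + c) * (?a * ?b)" .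
      have "(degen x y)\<^sup>2 \<le> ((1 + c) * (?a * ?b))\<^sup>2"
        using le by (rule power2_le_iff_abs_le[THEN iffD2, rotated]) (use order_trans[OF abs_ge_zero le] in simp)
      then show "norm (case z of (x, y) \<Rightarrow> (degen x y)\<^sup>2) \<le>
        norm ((1 + c)\<^sup>2 * ((1 + \<bar>snd (fst z)\<bar>)\<^sup>2 * (1 + \<bar>snd (snd z)\<bar>)\<^sup>2))"
        by (simp only: z prod.case fst_conv snd_conv power_mult_distrib real_norm_def) simp
    qed
    have "(\<lambda>z. (case z of (x, y) \<Rightarrow> degen x y)\<^sup>2) \<in> borel_measurable (borel \<Otimes>\<^sub>M borel)"
      by (intro borel_measurable_power degen_measurable)
    then show "(\<lambda>(x, y). (degen x y)\<^sup>2) \<in> borel_measurable (\<mu> \<Otimes>\<^sub>M \<mu>)"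
      unfolding measurable_cong_sets[OF sets_pair_measure_cong[OF sets_\<mu> sets_\<mu>] refl]
      by (simp only: case_prod_beta')
  qed
qed

text \<open>The linearisation at \<open>(numer, p)\<close> of \<open>a / (b * (1 - b))\<close>, with the Hajek projection
  \<open>proj1 + proj2 - 2 * numer\<close> of the kernel as increment of \<open>a\<close>.\<close>

definition lin where
  "lin x = (proj1 x + proj2 x) / \<Delta> - 2 * \<theta> - \<theta> * (1 - 2 * p) * (snd x - p) / \<Delta>"

lemma lin_measurable[measurable]: "lin \<in> borel_measurable borel"
  unfolding lin_def[abs_def] by measurable

lemma weighted_snd_square: "integrable \<mu> (\<lambda>x. (snd x - p)\<^sup>2)" "integrable \<mu> (\<lambda>x. snd x)"
  and integral_snd_minus_p: "(\<integral>x. snd x - p \<partial>\<mu>) = 0"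
proof -
  show 1: "integrable \<mu> (\<lambda>x. snd x)" using V_integrable by (subst integrable_\<mu>) auto
  show "integrable \<mu> (\<lambda>x. (snd x - p)\<^sup>2)"
    using V_square V_integrable by (subst integrable_\<mu>) (auto simp: power2_diff)
  have "(\<integral>x. snd x \<partial>\<mu>) = p" by (subst integral_\<mu>) (auto simp: p_def)
  then show "(\<integral>x. snd x - p \<partial>\<mu>) = 0" using 1 by (simp add: \<mu>.prob_space)
qed

lemma lin_square: "integrable \<mu> (\<lambda>x. (lin x)\<^sup>2)" "integrable \<mu> lin"
proof -
  define c where "c = ((\<integral>w. \<bar>V w\<bar> \<partial>M) + (\<integral>w. \<bar>1 - V w\<bar> \<partial>M)) / \<bar>\<Delta>\<bar> + 2 * \<bar>\<theta>\<bar> + \<bar>\<theta> * (1 - 2 * p) / \<Delta>\<bar> * (1 + \<bar>p\<bar>)"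
  have "\<bar>lin x\<bar> \<le> c * (1 + \<bar>snd x\<bar>)" for x
  proof -
    let ?a = "1 + \<bar>snd x\<bar>"
    have tri: "\<bar>a - 2 * t - b\<bar> \<le> \<bar>a\<bar> + 2 * \<bar>t\<bar> + \<bar>b\<bar>" for a t b :: real by linarith
    have "\<bar>lin x\<bar> \<le> \<bar>(proj1 x + proj2 x) / \<Delta>\<bar> + 2 * \<bar>\<theta>\<bar> + \<bar>\<theta> * (1 - 2 * p) / \<Delta> * (snd x - p)\<bar>"
      unfolding lin_def times_divide_eq_left by (rule tri)
    also have "\<bar>(proj1 x + proj2 x) / \<Delta>\<bar> \<le> ((\<integral>w. \<bar>V w\<bar> \<partial>M) + (\<integral>w. \<bar>1 - V w\<bar> \<partial>M)) / \<bar>\<Delta>\<bar> * ?a"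
      using proj1_bound[of x] proj2_bound[of x]
      by (simp add: abs_divide divide_right_mono algebra_simps add_divide_distrib[symmetric])
    also have "2 * \<bar>\<theta>\<bar> \<le> 2 * \<bar>\<theta>\<bar> * ?a" by (simp add: algebra_simps)
    also have "\<bar>\<theta> * (1 - 2 * p) / \<Delta> * (snd x - p)\<bar> \<le> \<bar>\<theta> * (1 - 2 * p) / \<Delta>\<bar> * ((1 + \<bar>p\<bar>) * ?a)"
    proof -
      have "\<bar>snd x - p\<bar> \<le> \<bar>snd x\<bar> + \<bar>p\<bar>" by (rule abs_triangle_ineq4)
      also have "\<dots> \<le> (1 + \<bar>p\<bar>) * ?a" by (simp add: algebra_simps)
      finally show ?thesis unfolding abs_mult by (intro mult_left_mono) auto
    qed
    finally show ?thesis by (simp add: c_def algebra_simps)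
  qed
  then show "integrable \<mu> (\<lambda>x. (lin x)\<^sup>2)" "integrable \<mu> lin"
    by (rule integrable_square_of_bound[OF lin_measurable])+
qed

lemma integral_lin: "(\<integral>x. lin x \<partial>\<mu>) = 0"
proof -
  have i: "integrable \<mu> (\<lambda>x. snd x - p)" using weighted_snd_square(2) by simp
  have "(\<integral>x. lin x \<partial>\<mu>) = (\<integral>x. proj1 x / \<Delta> + proj2 x / \<Delta> - 2 * \<theta> - \<theta> * (1 - 2 * p) / \<Delta> * (snd x - p) \<partial>\<mu>)"
    by (simp add: lin_def add_divide_distrib mult_ac)
  also have "\<dots> = numer / \<Delta> + numer / \<Delta> - 2 * \<theta>"
    using proj1_square(2) proj2_square(2) i integral_snd_minus_p
    by (simp add: integral_proj2 numer_def[symmetric] \<mu>.prob_space)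
  finally show ?thesis by (simp add: target_eq)
qed

text \<open>\<open>\<phi>\<close> integrates over \<open>R w \<le> r\<close> where \<open>proj2\<close> has \<open>R w < r\<close>. The difference lives on the
  atoms of \<open>R\<close>; at such an atom either \<open>1 - V\<close> integrates to \<open>0\<close> or, as \<open>V \<ge> 0\<close>, \<open>V\<close> vanishes a.e.\<close>

lemma influence_eq_lin: "AE x in \<mu>. \<phi> x = lin x"
proof -
  \<comment> \<open>The integral of \<open>1 - V\<close> over a level set of \<open>R\<close>: the
    gap between the weak inequality in \<open>\<phi>\<close> and the strict one in
    \<open>H\<close>.\<close>
  define J where "J r = (\<integral>w. of_bool (R w = r) * (1 - V w) \<partial>M)" for r
  have iV: "integrable M (\<lambda>w. 1 - V w)" using V_integrable by simp
  have HJ: "(\<integral>w. of_bool (R w \<le> r) * (1 - V w) \<partial>M) = H r + J r" for r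
    unfolding H_def J_def
    by (subst Bochner_Integration.integral_add[symmetric])
      (auto intro!: integrable_of_bool_mult[OF iV] Bochner_Integration.integral_cong)
  have eq: "\<phi> x = lin x + snd x * J (fst x) / \<Delta>" for x
  proof (cases x)
    case (Pair r v)
    have nz: "1 - p \<noteq> 0" "p \<noteq> 0" using \<Delta>_nonzero by auto
    have 1: "(1 - v) / (1 - p) * (1 - a / p) = (1 - v) * (p - a) / \<Delta>" for a
    proof -
      have "1 - a / p = (p - a) / p" using nz by (simp add: diff_divide_distrib)
      then show ?thesis by (simp only: times_divide_times_eq \<Delta>_def mult.commute)
    qed
    have 2: "v / p * ((H r + J r) / (1 - p)) = v * H r / \<Delta> + v * J r / \<Delta>"
      by (simp add: \<Delta>_def add_divide_distrib distrib_left)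
    have "(1 - v) / (1 - p) + v / p = ((1 - v) * p + v * (1 - p)) / \<Delta>"
      using nz unfolding \<Delta>_def by (subst add_frac_eq) (auto simp: mult.commute)
    \<comment> \<open>Expansion at \<open>v = p\<close>; it splits the factor of the target in
      \<open>\<phi>\<close> into the constant 2 and the slope term of \<open>lin\<close>.\<close>
    also have "(1 - v) * p + v * (1 - p) = 2 * \<Delta> + (1 - 2 * p) * (v - p)"
      by (simp add: \<Delta>_def algebra_simps)
    finally have 3: "(1 - v) / (1 - p) + v / p = 2 + (1 - 2 * p) * (v - p) / \<Delta>"
      using \<Delta>_nonzero by (simp add: add_divide_distrib)
    show ?thesis
      unfolding Pair auc_influence_def lin_def proj1_def proj2_def integral_one_minus_V p_def[symmetric] HJ
        case_prod_conv fst_conv snd_conv G_eq 1 2 3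
      by (simp only: add_divide_distrib distrib_right) (simp add: mult_ac)
  qed
  \<comment> \<open>The exceptional null set found below depends on \<open>r\<close>. Away from the
    countably many atoms of \<open>R\<close> the integral \<open>J\<close> vanishes, so a countable
    union of null sets is enough.\<close>
  interpret Rd: real_distribution "distr M borel R" by (rule real_distribution_distr) simp
  define S where "S = {r. measure (distr M borel R) {r} > 0}"
  have cS: "countable S" unfolding S_def by (rule Rd.countable_atoms)
  have nS: "J r = 0" if "r \<notin> S" for r
  proof -
    have "prob (R -` {r} \<inter> space M) = 0"
      using that by (simp add: S_def measure_distr zero_less_measure_iff)
    then have "AE w in M. R w \<noteq> r"
      by (subst AE_iff_measurable[of "R -` {r} \<inter> space M"]) (auto simp: emeasure_eq_measure)
    then have "J r = (\<integral>w. 0 \<partial>M)" unfolding J_def by (intro integral_cong_AE) auto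
    then show ?thesis by simp
  qed
  have "AE w in M. R w = r \<longrightarrow> V w * J r = 0" for r
  proof (cases "isCont (\<lambda>\<alpha>. \<integral>w. of_bool (R w \<le> \<alpha>) * (1 - V w) \<partial>M) r")
    case True
    then show ?thesis unfolding J_def using integral_eq_level_0[OF R iV True] by simp
  next
    case False
    then have "isCont G r"
      using no_common_jump unfolding auc_no_common_jump_def G_def[abs_def] by auto
    then have "isCont (\<lambda>\<alpha>. p - G \<alpha>) r" by (intro continuous_intros)
    then have "isCont (\<lambda>\<alpha>. \<integral>w. of_bool (R w \<le> \<alpha>) * V w \<partial>M) r" by (simp add: G_eq)
    then have "(\<integral>w. of_bool (R w = r) * V w \<partial>M) = 0"
      by (rule integral_eq_level_0[OF R V_integrable])
    moreover have "AE w in M. 0 \<le> of_bool (R w = r) * V w" using V_nonneg by eventually_elim simp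
    ultimately have "AE w in M. of_bool (R w = r) * V w = 0"
      by (subst (asm) integral_nonneg_eq_0_iff_AE) (auto intro!: integrable_of_bool_mult V_integrable)
    then show ?thesis by eventually_elim auto
  qed
  then have "AE w in M. \<forall>r\<in>S. R w = r \<longrightarrow> V w * J r = 0"
    using cS by (subst AE_ball_countable) auto
  then have "AE w in M. V w * J (R w) = 0" by eventually_elim (use nS in auto)
  then have "AE w in M. \<phi> (R w, V w) = lin (R w, V w)"
    unfolding eq by eventually_elim simp
  moreover have "\<phi> \<in> borel_measurable borel"
    unfolding auc_influence_def by measurable
  ultimately show ?thesis
    unfolding \<mu>_def by (subst AE_distr_iff) auto
qed

lemma influence_measurable[measurable]: "\<phi> \<in> borel_measurable borel"
  unfolding auc_influence_def by measurable

lemma influence_square: "integrable \<mu> (\<lambda>x. (\<phi> x)\<^sup>2)" and integral_influence: "(\<integral>x. \<phi> x \<partial>\<mu>) = 0"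
proof -
  have "AE x in \<mu>. (\<phi> x)\<^sup>2 = (lin x)\<^sup>2" using influence_eq_lin by eventually_elim simp
  then show "integrable \<mu> (\<lambda>x. (\<phi> x)\<^sup>2)"
    using lin_square(1) by (subst integrable_cong_AE) auto
  show "(\<integral>x. \<phi> x \<partial>\<mu>) = 0"
    using influence_eq_lin integral_lin by (subst integral_cong_AE) auto
qed

end

section \<open>Convergence in probability and characteristic functions\<close>

context prob_space
begin

lemma converges_in_prob_measurable: "converges_in_prob M Z c \<Longrightarrow> Z n \<in> borel_measurable M"
  by (simp add: converges_in_prob_def)

lemma converges_in_probD:
  "converges_in_prob M Z c \<Longrightarrow> \<epsilon> > 0 \<Longrightarrow> (\<lambda>n. \<P>(w in M. \<bar>Z n w - c\<bar> > \<epsilon>)) \<longlonglongrightarrow> 0"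
  by (simp add: converges_in_prob_def)

lemma converges_in_prob_le:
  assumes "\<And>n. Z n \<in> borel_measurable M"
    and "\<And>\<epsilon>. \<epsilon> > 0 \<Longrightarrow> \<exists>b. b \<longlonglongrightarrow> 0 \<and> (\<forall>\<^sub>F n in sequentially. \<P>(w in M. \<bar>Z n w - c\<bar> > \<epsilon>) \<le> b n)"
  shows "converges_in_prob M Z c"
  unfolding converges_in_prob_def
proof (intro conjI allI impI assms(1))
  fix \<epsilon> :: real assume "\<epsilon> > 0"
  from assms(2)[OF this] obtain b where "b \<longlonglongrightarrow> 0"
    "\<forall>\<^sub>F n in sequentially. \<P>(w in M. \<bar>Z n w - c\<bar> > \<epsilon>) \<le> b n" by blast
  then show "(\<lambda>n. \<P>(w in M. \<bar>Z n w - c\<bar> > \<epsilon>)) \<longlonglongrightarrow> 0"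
    by (intro tendsto_sandwich[OF _ _ tendsto_const \<open>b \<longlonglongrightarrow> 0\<close>]) auto
qed

lemma prob_union_le:
  assumes [measurable]: "Measurable.pred M P" "Measurable.pred M Q" "Measurable.pred M A"
    and "\<And>w. w \<in> space M \<Longrightarrow> A w \<Longrightarrow> P w \<or> Q w"
  shows "\<P>(w in M. A w) \<le> \<P>(w in M. P w) + \<P>(w in M. Q w)"
proof -
  have "\<P>(w in M. A w) \<le> prob ({w \<in> space M. P w} \<union> {w \<in> space M. Q w})"
    using assms(4) by (intro finite_measure_mono) auto
  also have "\<dots> \<le> \<P>(w in M. P w) + \<P>(w in M. Q w)"
    by (intro measure_Un_le) auto
  finally show ?thesis .
qed

lemma converges_in_prob_add:
  assumes Z: "converges_in_prob M Z 0" and W: "converges_in_prob M W 0"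
  shows "converges_in_prob M (\<lambda>n w. Z n w + W n w) 0"
proof (rule converges_in_prob_le)
  have [measurable]: "Z n \<in> borel_measurable M" "W n \<in> borel_measurable M" for n
    using Z W by (auto dest: converges_in_prob_measurable)
  show "(\<lambda>w. Z n w + W n w) \<in> borel_measurable M" for n by measurable
  fix \<epsilon> :: real assume e: "\<epsilon> > 0"
  let ?b = "\<lambda>n. \<P>(w in M. \<bar>Z n w - 0\<bar> > \<epsilon> / 2) + \<P>(w in M. \<bar>W n w - 0\<bar> > \<epsilon> / 2)"
  have "?b \<longlonglongrightarrow> 0 + 0" using e by (intro tendsto_add converges_in_probD[OF Z] converges_in_probD[OF W]) auto
  moreover have "\<P>(w in M. \<bar>Z n w + W n w - 0\<bar> > \<epsilon>) \<le> ?b n" for n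
    by (rule prob_union_le) auto
  ultimately show "\<exists>b. b \<longlonglongrightarrow> 0 \<and> (\<forall>\<^sub>F n in sequentially. \<P>(w in M. \<bar>Z n w + W n w - 0\<bar> > \<epsilon>) \<le> b n)"
    by (intro exI[of _ ?b]) auto
qed

lemma converges_in_prob_cmult:
  assumes Z: "converges_in_prob M Z 0"
  shows "converges_in_prob M (\<lambda>n w. c * Z n w) 0"
proof (cases "c = 0")
  case True
  then show ?thesis by (simp add: converges_in_prob_def)
next
  case False
  have [measurable]: "Z n \<in> borel_measurable M" for n
    using Z by (auto dest: converges_in_prob_measurable)
  have "\<bar>c * Z n w\<bar> > \<epsilon> \<longleftrightarrow> \<bar>Z n w\<bar> > \<epsilon> / \<bar>c\<bar>" for n w \<epsilon>
    using False by (simp add: abs_mult field_simps)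
  then show ?thesis
    using converges_in_probD[OF Z, of "_ / \<bar>c\<bar>"] False unfolding converges_in_prob_def by simp
qed

text \<open>An \<open>o_p(1)\<close> sequence times one bounded in probability: the product exceeds
  \<open>\<epsilon>\<close> only if \<open>W\<close> exceeds \<open>K\<close> or \<open>Z\<close>
  exceeds \<open>\<epsilon> / K\<close>. Boundedness is asked for eventually, since the pooling
  weights are controlled for large \<open>n\<close> by their limits.\<close>

lemma converges_in_prob_mult:
  assumes Z: "converges_in_prob M Z 0" and [measurable]: "\<And>n. W n \<in> borel_measurable M"
    and W: "\<And>\<eta>. \<eta> > 0 \<Longrightarrow> \<exists>K>0. \<forall>\<^sub>F n in sequentially. \<P>(w in M. \<bar>W n w\<bar> > K) \<le> \<eta>"
  shows "converges_in_prob M (\<lambda>n w. Z n w * W n w) 0"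
  unfolding converges_in_prob_def
proof (intro conjI allI impI)
  have [measurable]: "Z n \<in> borel_measurable M" for n
    using Z by (auto dest: converges_in_prob_measurable)
  show "(\<lambda>w. Z n w * W n w) \<in> borel_measurable M" for n by measurable
  fix \<epsilon> :: real assume e: "\<epsilon> > 0"
  show "(\<lambda>n. \<P>(w in M. \<bar>Z n w * W n w - 0\<bar> > \<epsilon>)) \<longlonglongrightarrow> 0"
  proof (rule order_tendstoI)
    fix a :: real assume "0 < a"
    then have a: "a / 3 > 0" by simp
    obtain K where K: "K > 0" "\<forall>\<^sub>F n in sequentially. \<P>(w in M. \<bar>W n w\<bar> > K) \<le> a / 3"
      using W[OF a] by blast
    have "(\<lambda>n. \<P>(w in M. \<bar>Z n w - 0\<bar> > \<epsilon> / K)) \<longlonglongrightarrow> 0"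
      using e K(1) by (intro converges_in_probD[OF Z]) auto
    then have "\<forall>\<^sub>F n in sequentially. \<P>(w in M. \<bar>Z n w - 0\<bar> > \<epsilon> / K) < a / 3"
      using a by (rule order_tendstoD(2))
    with K(2) show "\<forall>\<^sub>F n in sequentially. \<P>(w in M. \<bar>Z n w * W n w - 0\<bar> > \<epsilon>) < a"
    proof eventually_elim
      fix n
      assume 1: "\<P>(w in M. \<bar>W n w\<bar> > K) \<le> a / 3" and 2: "\<P>(w in M. \<bar>Z n w - 0\<bar> > \<epsilon> / K) < a / 3"
      have "\<P>(w in M. \<bar>Z n w * W n w - 0\<bar> > \<epsilon>) \<le> \<P>(w in M. \<bar>Z n w - 0\<bar> > \<epsilon> / K) + \<P>(w in M. \<bar>W n w\<bar> > K)"
      proof (rule prob_union_le)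
        fix w assume "\<bar>Z n w * W n w - 0\<bar> > \<epsilon>"
        moreover have "\<bar>Z n w\<bar> * \<bar>W n w\<bar> \<le> \<epsilon> / K * K" if "\<bar>Z n w\<bar> \<le> \<epsilon> / K" "\<bar>W n w\<bar> \<le> K"
          using that K(1) e by (intro mult_mono) auto
        ultimately show "\<bar>Z n w - 0\<bar> > \<epsilon> / K \<or> \<bar>W n w\<bar> > K"
          using K(1) by (auto simp: abs_mult not_less[symmetric])
      qed measurable
      with 1 2 \<open>0 < a\<close> show "\<P>(w in M. \<bar>Z n w * W n w - 0\<bar> > \<epsilon>) < a" by linarith
    qed
  next
    fix a :: real assume "a < 0"
    then show "\<forall>\<^sub>F n in sequentially. a < \<P>(w in M. \<bar>Z n w * W n w - 0\<bar> > \<epsilon>)"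
      by (intro always_eventually allI less_le_trans[OF _ measure_nonneg])
  qed
qed

lemma prob_abs_gt_le_second_moment:
  assumes [measurable]: "W \<in> borel_measurable M" and "integrable M (\<lambda>w. (W w)\<^sup>2)" and "K > 0"
  shows "\<P>(w in M. \<bar>W w\<bar> > K) \<le> expectation (\<lambda>w. (W w)\<^sup>2) / K\<^sup>2"
proof -
  have "\<P>(w in M. \<bar>W w\<bar> > K) \<le> \<P>(w in M. (W w)\<^sup>2 \<ge> K\<^sup>2)"
    using \<open>K > 0\<close> by (intro finite_measure_mono) (auto simp: abs_le_square_iff[symmetric])
  also have "\<dots> \<le> expectation (\<lambda>w. (W w)\<^sup>2) / K\<^sup>2"
    using integral_Markov_inequality_measure[OF assms(2), of "{}" "K\<^sup>2"] \<open>K > 0\<close> by simp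
  finally show ?thesis .
qed

lemma converges_in_prob_L2:
  assumes [measurable]: "\<And>n. W n \<in> borel_measurable M" and i: "\<And>n. integrable M (\<lambda>w. (W n w)\<^sup>2)"
    and lim: "(\<lambda>n. expectation (\<lambda>w. (W n w)\<^sup>2)) \<longlonglongrightarrow> 0"
  shows "converges_in_prob M W 0"
proof (rule converges_in_prob_le)
  fix \<epsilon> :: real assume e: "\<epsilon> > 0"
  have "(\<lambda>n. expectation (\<lambda>w. (W n w)\<^sup>2) / \<epsilon>\<^sup>2) \<longlonglongrightarrow> 0 / \<epsilon>\<^sup>2"
    using e by (intro tendsto_divide lim tendsto_const) auto
  then show "\<exists>b. b \<longlonglongrightarrow> 0 \<and> (\<forall>\<^sub>F n in sequentially. \<P>(w in M. \<bar>W n w - 0\<bar> > \<epsilon>) \<le> b n)"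
    using prob_abs_gt_le_second_moment[OF assms(1) i e] by (intro exI[of _ "\<lambda>n. expectation (\<lambda>w. (W n w)\<^sup>2) / \<epsilon>\<^sup>2"]) auto
qed simp

lemma L2_bounded_in_prob:
  fixes W :: "nat \<Rightarrow> 'a \<Rightarrow> real"
  assumes [measurable]: "\<And>n. W n \<in> borel_measurable M" and i: "\<And>n. integrable M (\<lambda>w. (W n w)\<^sup>2)"
    and b: "\<forall>\<^sub>F n in sequentially. expectation (\<lambda>w. (W n w)\<^sup>2) \<le> B" and "\<eta> > 0"
  shows "\<exists>K>0. \<forall>\<^sub>F n in sequentially. \<P>(w in M. \<bar>W n w\<bar> > K) \<le> \<eta>"
proof (intro exI conjI)
  \<comment> \<open>Chebyshev gives \<open>B / K\<^sup>2 \<le> \<eta>\<close> for this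
    \<open>K\<close>; the added 1 keeps it positive whatever \<open>B\<close> is.\<close>
  let ?K = "sqrt ((\<bar>B\<bar> + 1) / \<eta>)"
  show K: "?K > 0" using \<open>\<eta> > 0\<close> by simp
  show "\<forall>\<^sub>F n in sequentially. \<P>(w in M. \<bar>W n w\<bar> > ?K) \<le> \<eta>"
    using b
  proof eventually_elim
    fix n assume le: "expectation (\<lambda>w. (W n w)\<^sup>2) \<le> B"
    have "\<P>(w in M. \<bar>W n w\<bar> > ?K) \<le> expectation (\<lambda>w. (W n w)\<^sup>2) / ?K\<^sup>2"
      by (rule prob_abs_gt_le_second_moment[OF assms(1) i K])
    also have "\<dots> \<le> (\<bar>B\<bar> + 1) / ?K\<^sup>2" using le by (intro divide_right_mono) auto
    also have "\<dots> = \<eta>" using \<open>\<eta> > 0\<close> by (simp add: add_pos_nonneg)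
    finally show "\<P>(w in M. \<bar>W n w\<bar> > ?K) \<le> \<eta>" .
  qed
qed

section \<open>Characteristic functions and normalised sums that vanish\<close>

lemma norm_iexp_diff_le: "cmod (iexp x - iexp y) \<le> min 2 \<bar>x - y\<bar>"
proof -
  have "iexp x - iexp y = iexp y * (iexp (x - y) - 1)"
    by (simp add: algebra_simps flip: exp_add)
  then have "cmod (iexp x - iexp y) = cmod (iexp (x - y) - 1)"
    by (simp add: norm_mult)
  also have "\<dots> \<le> min 2 \<bar>x - y\<bar>"
    using iexp_approx1[of "x - y" 0] iexp_approx2[of "x - y" 0] by simp
  finally show ?thesis .
qed

text \<open>Slutsky's argument on the level of characteristic functions, applicable before the limit
  of \<open>W\<close> is known. The integrand is at most \<open>\<bar>t\<bar> * e\<close> where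
  \<open>Z\<close> is small and at most 2 elsewhere.\<close>

lemma char_diff_tendsto_0:
  assumes Z: "converges_in_prob M Z 0" and [measurable]: "\<And>n. W n \<in> borel_measurable M"
  shows "(\<lambda>n. char (distr M borel (\<lambda>w. W n w + Z n w)) t - char (distr M borel (W n)) t) \<longlonglongrightarrow> 0"
proof (rule LIMSEQ_I)
  have [measurable]: "Z n \<in> borel_measurable M" for n
    using Z by (auto dest: converges_in_prob_measurable)
  fix r :: real assume r: "r > 0"
  \<comment> \<open>Chosen so that the region of small \<open>Z\<close> contributes at most
    \<open>r / 2\<close>; the rest then contributes less than \<open>2 * r / 4\<close>. Adding 1
    covers \<open>t = 0\<close>.\<close>
  define e where "e = r / (2 * (\<bar>t\<bar> + 1))"
  have e: "e > 0" "\<bar>t\<bar> * e \<le> r / 2" using r by (auto simp: e_def field_simps)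
  have "\<forall>\<^sub>F n in sequentially. \<P>(w in M. \<bar>Z n w - 0\<bar> > e) < r / 4"
    using converges_in_probD[OF Z e(1)] r by (intro order_tendstoD(2)) auto
  then obtain N where N: "\<And>n. n \<ge> N \<Longrightarrow> \<P>(w in M. \<bar>Z n w\<bar> > e) < r / 4"
    by (auto simp: eventually_sequentially)
  have "norm (char (distr M borel (\<lambda>w. W n w + Z n w)) t - char (distr M borel (W n)) t - 0) < r" if "n \<ge> N" for n
  proof -
    have i: "integrable M (\<lambda>w. iexp (t * f w))" if [measurable]: "f \<in> borel_measurable M" for f
      by (rule integrable_iexp) auto
    have "char (distr M borel (\<lambda>w. W n w + Z n w)) t - char (distr M borel (W n)) t =
      (CLINT w|M. iexp (t * (W n w + Z n w)) - iexp (t * W n w))"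
    proof -
      have "char (distr M borel f) t = (CLINT w|M. iexp (t * f w))" if [measurable]: "f \<in> borel_measurable M" for f
        unfolding char_def by (rule integral_distr) auto
      moreover have "integrable M (\<lambda>w. iexp (t * (W n w + Z n w)))" "integrable M (\<lambda>w. iexp (t * W n w))"
        by (rule i, measurable)+
      ultimately show ?thesis
        by (subst Bochner_Integration.integral_diff) (simp_all only: borel_measurable_add \<open>\<And>n. W n \<in> borel_measurable M\<close> \<open>\<And>n. Z n \<in> borel_measurable M\<close>)
    qed
    also have "norm \<dots> \<le> (LINT w|M. cmod (iexp (t * (W n w + Z n w)) - iexp (t * W n w)))"
      by (rule integral_norm_bound)
    also have "\<dots> \<le> (LINT w|M. r / 2 + 2 * indicator {w \<in> space M. \<bar>Z n w\<bar> > e} w)"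
    proof (rule integral_mono)
      show "integrable M (\<lambda>w. cmod (iexp (t * (W n w + Z n w)) - iexp (t * W n w)))"
        by (intro integrable_norm Bochner_Integration.integrable_diff i) auto
      show "integrable M (\<lambda>w. r / 2 + 2 * indicator {w \<in> space M. \<bar>Z n w\<bar> > e} w)"
        by (intro Bochner_Integration.integrable_add integrable_mult_right integrable_real_indicator)
          (auto simp: emeasure_eq_measure)
      fix w assume w: "w \<in> space M"
      have le: "cmod (iexp (t * (W n w + Z n w)) - iexp (t * W n w)) \<le> min 2 \<bar>t * Z n w\<bar>"
        using norm_iexp_diff_le[of "t * (W n w + Z n w)" "t * W n w"] by (simp add: algebra_simps)
      have "\<bar>t * Z n w\<bar> \<le> r / 2" if "\<bar>Z n w\<bar> \<le> e"
        using mult_left_mono[OF that, of "\<bar>t\<bar>"] e(2) by (simp add: abs_mult)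
      then show "cmod (iexp (t * (W n w + Z n w)) - iexp (t * W n w)) \<le>
          r / 2 + 2 * indicator {w \<in> space M. \<bar>Z n w\<bar> > e} w"
        using le r w by (auto split: split_indicator)
    qed
    also have "\<dots> = r / 2 + 2 * \<P>(w in M. \<bar>Z n w\<bar> > e)"
      by (subst Bochner_Integration.integral_add)
        (auto simp: prob_space emeasure_eq_measure intro!: integrable_mult_right integrable_real_indicator)
    also have "\<dots> < r" using N[OF that] by simp
    finally show ?thesis by simp
  qed
  then show "\<exists>no. \<forall>n\<ge>no. norm (char (distr M borel (\<lambda>w. W n w + Z n w)) t - char (distr M borel (W n)) t - 0) < r"
    by blast
qed

lemma char_scaled_sum:
  assumes I: "indep_vars (\<lambda>_. borel) X {..<n}" and "\<And>i. i < n \<Longrightarrow> distr M borel (X i) = \<nu>"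
  shows "char (distr M borel (\<lambda>w. a * (\<Sum>i<n. X i w))) t = char \<nu> (a * t) ^ n"
proof -
  have [measurable]: "X i \<in> borel_measurable M" if "i < n" for i
    using I that by (auto simp: indep_vars_def2)
  have "char (distr M borel (\<lambda>w. a * (\<Sum>i<n. X i w))) t = char (distr M borel (\<lambda>w. \<Sum>i<n. X i w)) (a * t)"
    by (simp add: char_def integral_distr mult_ac)
  also have "\<dots> = (\<Prod>i<n. char (distr M borel (X i)) (a * t))"
    by (rule char_distr_sum[OF I])
  also have "\<dots> = char \<nu> (a * t) ^ n" using assms(2) by simp
  finally show ?thesis .
qed

end

text \<open>By the half-angle formula the sequence is \<open>u\<^sup>2 / 2\<close> times the square
  of \<open>sin z / z\<close> with \<open>z = u / (2 * sqrt n)\<close>.\<close>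

lemma tendsto_scaled_one_minus_cos: "(\<lambda>n. real n * (1 - cos (u / sqrt (real n)))) \<longlonglongrightarrow> u\<^sup>2 / 2"
proof (cases "u = 0")
  case False
  have d: "((\<lambda>x::real. sin x / x) \<longlongrightarrow> 1) (at 0)"
    using DERIV_sin[of "0::real"] by (simp add: DERIV_def)
  have z: "(\<lambda>n. u / 2 * inverse (sqrt (real n))) \<longlonglongrightarrow> u / 2 * 0"
    by (intro tendsto_intros tendsto_inverse_0_at_top filterlim_compose[OF sqrt_at_top filterlim_real_sequentially])
  have "filterlim (\<lambda>n. u / 2 * inverse (sqrt (real n))) (at 0) sequentially"
    unfolding filterlim_at using z False
    by (auto intro!: eventually_sequentiallyI[of 1])
  from filterlim_compose[OF d this]
  have lim: "(\<lambda>n. (sin (u / 2 * inverse (sqrt (real n))) / (u / 2 * inverse (sqrt (real n))))\<^sup>2 * (u\<^sup>2 / 2)) \<longlonglongrightarrow> 1\<^sup>2 * (u\<^sup>2 / 2)"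
    by (intro tendsto_intros)
  have "\<forall>\<^sub>F n in sequentially. (sin (u / 2 * inverse (sqrt (real n))) / (u / 2 * inverse (sqrt (real n))))\<^sup>2 * (u\<^sup>2 / 2) =
      real n * (1 - cos (u / sqrt (real n)))"
  proof (rule eventually_sequentiallyI[of 1])
    fix n :: nat assume n: "1 \<le> n"
    define z where "z = u / 2 * inverse (sqrt (real n))"
    have "u / sqrt (real n) = 2 * z" unfolding z_def inverse_eq_divide by simp
    then have c: "1 - cos (u / sqrt (real n)) = 2 * (sin z)\<^sup>2" by (simp add: cos_double_sin)
    have z2: "z\<^sup>2 = u\<^sup>2 / (4 * real n)" using n unfolding z_def inverse_eq_divide by (simp add: power_mult_distrib power_divide)
    show "(sin (u / 2 * inverse (sqrt (real n))) / (u / 2 * inverse (sqrt (real n))))\<^sup>2 * (u\<^sup>2 / 2) =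
      real n * (1 - cos (u / sqrt (real n)))"
      unfolding z_def[symmetric] c power_divide z2 using n False by (simp add: field_simps)
  qed
  from Lim_transform_eventually[OF lim this] show ?thesis by simp
qed simp

text \<open>The law of the difference of two independent copies has characteristic function
  \<open>(cmod (char \<nu> s))\<^sup>2\<close>; Fatou's lemma applied to \<open>n * (1 - cos (u / sqrt n))\<close> shows that it
  has second moment \<open>0\<close>, and no moment of \<open>\<nu>\<close> has to be finite a priori.\<close>

lemma point_mass_of_char_power:
  fixes \<nu> :: "real measure"
  assumes "real_distribution \<nu>" and lim: "(\<lambda>n. char \<nu> (1 / sqrt (real n)) ^ n) \<longlonglongrightarrow> 1"
  shows "\<exists>c. AE x in \<nu>. x = c"
proof -
  interpret real_distribution \<nu> by fact
  interpret pp: pair_prob_space \<nu> \<nu> ..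
  define a where "a n = (cmod (char \<nu> (1 / sqrt (real n))))\<^sup>2" for n :: nat
  have a01: "0 \<le> a n" "a n \<le> 1" for n
    using cmod_char_le_1 by (auto simp: a_def power_le_one)
  have "(\<lambda>n. (cmod (char \<nu> (1 / sqrt (real n)) ^ n))\<^sup>2) \<longlonglongrightarrow> (cmod 1)\<^sup>2"
    by (intro tendsto_intros lim)
  then have an: "(\<lambda>n. a n ^ n) \<longlonglongrightarrow> 1"
    by (simp add: a_def norm_power power_mult[symmetric] mult.commute)
  \<comment> \<open>The inequality \<open>1 - a \<le> - ln a\<close> turns convergence of the powers
    into the rate \<open>1 - a n = o(1 / n)\<close>.\<close>
  have small: "(\<lambda>n. real n * (1 - a n)) \<longlonglongrightarrow> 0"
  proof (rule tendsto_sandwich)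
    show "\<forall>\<^sub>F n in sequentially. 0 \<le> real n * (1 - a n)" using a01 by simp
    have "(\<lambda>n. - ln (a n ^ n)) \<longlonglongrightarrow> - ln 1" by (intro tendsto_intros an) auto
    then show "(\<lambda>n. - ln (a n ^ n)) \<longlonglongrightarrow> 0" by simp
    have "\<forall>\<^sub>F n in sequentially. a n ^ n > 0" using order_tendstoD(1)[OF an, of 0] by simp
    then show "\<forall>\<^sub>F n in sequentially. real n * (1 - a n) \<le> - ln (a n ^ n)"
      using eventually_gt_at_top[of 0]
    proof eventually_elim
      case (elim n)
      then have "a n > 0" using a01(1)[of n] by (cases "a n = 0") (auto simp: power_0_left)
      then show ?case
        using mult_left_mono[OF ln_le_minus_one[of "a n"], of "real n"] by (simp add: ln_realpow algebra_simps)
    qed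
  qed simp
  have icos: "integrable (\<nu> \<Otimes>\<^sub>M \<nu>) (\<lambda>z. cos (s * (fst z - snd z)))" for s
    by (rule pp.integrable_const_bound[where B=1]) auto
  have c: "integrable \<nu> (\<lambda>x. cos (s * x))" "integrable \<nu> (\<lambda>x. sin (s * x))" for s
    by (rule integrable_const_bound[where B=1]; auto)+
  \<comment> \<open>Addition theorem for the cosine: the squares of real and imaginary part combine
    to the expectation of \<open>cos (s * (x - y))\<close> under two independent copies.\<close>
  have sq: "(cmod (char \<nu> s))\<^sup>2 = (\<integral>z. cos (s * (fst z - snd z)) \<partial>(\<nu> \<Otimes>\<^sub>M \<nu>))" for s
  proof -
    let ?C = "\<integral>x. cos (s * x) \<partial>\<nu>" and ?S = "\<integral>x. sin (s * x) \<partial>\<nu>"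
    have "char \<nu> s = complex_of_real ?C + \<i> * complex_of_real ?S"
    proof -
      have "char \<nu> s = (CLINT x|\<nu>. complex_of_real (cos (s * x)) + \<i> * complex_of_real (sin (s * x)))"
        unfolding char_def by (simp add: exp_Euler cos_of_real sin_of_real flip: of_real_mult)
      then show ?thesis using c by simp
    qed
    then have "(cmod (char \<nu> s))\<^sup>2 = ?C\<^sup>2 + ?S\<^sup>2" by (simp add: cmod_power2)
    also have "\<dots> = (\<integral>x. cos (s * x) * ?C + sin (s * x) * ?S \<partial>\<nu>)"
      using c by (simp add: power2_eq_square)
    also have "\<dots> = (\<integral>x. (\<integral>y. cos (s * (x - y)) \<partial>\<nu>) \<partial>\<nu>)"
      using c by (simp add: right_diff_distrib cos_diff)
    also have "\<dots> = (\<integral>z. cos (s * (fst z - snd z)) \<partial>(\<nu> \<Otimes>\<^sub>M \<nu>))"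
      using pp.integral_fst'[OF icos[of s]] by simp
    finally show ?thesis .
  qed
  let ?h = "\<lambda>n z. real n * (1 - cos ((fst z - snd z) / sqrt (real n)))"
  have h0: "0 \<le> ?h n z" for n z by simp
  have hint: "(\<integral>\<^sup>+z. ennreal (?h n z) \<partial>(\<nu> \<Otimes>\<^sub>M \<nu>)) = ennreal (real n * (1 - a n))" for n
  proof -
    have "integrable (\<nu> \<Otimes>\<^sub>M \<nu>) (?h n)" using icos[of "1 / sqrt (real n)"] by simp
    then have "(\<integral>\<^sup>+z. ennreal (?h n z) \<partial>(\<nu> \<Otimes>\<^sub>M \<nu>)) = ennreal (\<integral>z. ?h n z \<partial>(\<nu> \<Otimes>\<^sub>M \<nu>))"
      using h0 by (intro nn_integral_eq_integral) auto
    also have "(\<integral>z. ?h n z \<partial>(\<nu> \<Otimes>\<^sub>M \<nu>)) = real n * (1 - a n)"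
      unfolding a_def sq using icos[of "1 / sqrt (real n)"] by (simp add: pp.prob_space)
    finally show ?thesis .
  qed
  have "(\<integral>\<^sup>+z. ennreal ((fst z - snd z)\<^sup>2 / 2) \<partial>(\<nu> \<Otimes>\<^sub>M \<nu>)) =
      (\<integral>\<^sup>+z. liminf (\<lambda>n. ennreal (?h n z)) \<partial>(\<nu> \<Otimes>\<^sub>M \<nu>))"
    by (intro nn_integral_cong lim_imp_Liminf[symmetric] tendsto_ennrealI tendsto_scaled_one_minus_cos) simp
  also have "\<dots> \<le> liminf (\<lambda>n. \<integral>\<^sup>+z. ennreal (?h n z) \<partial>(\<nu> \<Otimes>\<^sub>M \<nu>))"
    by (rule nn_integral_liminf) measurable
  also have "\<dots> = liminf (\<lambda>n. ennreal (real n * (1 - a n)))" unfolding hint ..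
  also have "\<dots> = ennreal 0"
    by (intro lim_imp_Liminf tendsto_ennrealI small) simp
  finally have "(\<integral>\<^sup>+z. ennreal ((fst z - snd z)\<^sup>2 / 2) \<partial>(\<nu> \<Otimes>\<^sub>M \<nu>)) = 0" by simp
  then have "AE z in \<nu> \<Otimes>\<^sub>M \<nu>. ennreal ((fst z - snd z)\<^sup>2 / 2) = 0"
    by (subst (asm) nn_integral_0_iff_AE) auto
  then have "AE z in \<nu> \<Otimes>\<^sub>M \<nu>. fst z = snd z"
    by eventually_elim simp
  \<comment> \<open>Almost every section of a null set is null, and a single such section already
    names the constant.\<close>
  then have "AE x in \<nu>. AE y in \<nu>. fst (x, y) = snd (x, y)"
    by (rule pp.AE_pair)
  then have "AE x in \<nu>. AE y in \<nu>. x = y" by simp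
  then obtain x where "AE y in \<nu>. x = y"
    using AE_False by (metis (mono_tags, lifting) eventually_mono)
  then show ?thesis by (intro exI[of _ x]) (auto elim: eventually_mono)
qed

text \<open>The characteristic functions of the normalised sums tend to 1, so the summands are
  almost surely a constant \<open>c\<close>. The normalised sum is then \<open>sqrt n * c\<close>,
  which is small in probability only for \<open>c = 0\<close>.\<close>

lemma (in prob_space) iid_scaled_sum_vanishes:
  fixes X :: "nat \<Rightarrow> 'a \<Rightarrow> real"
  assumes ind: "indep_vars (\<lambda>_. borel) X UNIV" and law: "\<And>i. distr M borel (X i) = \<nu>"
    and conv: "converges_in_prob M (\<lambda>n w. (\<Sum>i<n. X i w) / sqrt (real n)) 0"
  shows "AE x in \<nu>. x = 0"
proof -
  have Xm[measurable]: "X i \<in> borel_measurable M" for i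
    using ind by (auto simp: indep_vars_def2)
  have rd: "real_distribution \<nu>" unfolding law[of 0, symmetric] by (rule real_distribution_distr) simp
  \<comment> \<open>The leading \<open>0\<close> casts the sum as a perturbation of the zero
    variable, the form that \<open>char_diff_tendsto_0\<close> expects.\<close>
  have "char (distr M borel (\<lambda>w. 0 + (\<Sum>i<n. X i w) / sqrt (real n))) 1 = char \<nu> (1 / sqrt (real n)) ^ n" for n
    using char_scaled_sum[OF indep_vars_subset[OF ind] law, of n "1 / sqrt (real n)" 1] by simp
  moreover have "char (distr M borel (\<lambda>w. 0)) 1 = 1" by (simp add: char_def integral_distr prob_space del: distr_const)
  ultimately have "(\<lambda>n. char \<nu> (1 / sqrt (real n)) ^ n - 1) \<longlonglongrightarrow> 0"
    using char_diff_tendsto_0[OF conv, of "\<lambda>n w. 0" 1] by simp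
  then have "(\<lambda>n. char \<nu> (1 / sqrt (real n)) ^ n) \<longlonglongrightarrow> 1" by (simp add: LIM_zero_iff)
  from point_mass_of_char_power[OF rd this] obtain c where c: "AE x in \<nu>. x = c" by blast
  have Xc: "AE w in M. X i w = c" for i
    using c unfolding law[of i, symmetric] by (rule AE_distrD[rotated]) simp
  have "c = 0"
  proof (rule ccontr)
    assume "c \<noteq> 0"
    have "\<P>(w in M. \<bar>(\<Sum>i<n. X i w) / sqrt (real n) - 0\<bar> > \<bar>c\<bar> / 2) = 1" if "n \<ge> 1" for n
    proof -
      have "AE w in M. \<forall>i\<in>{..<n}. X i w = c" using Xc by (intro AE_finite_allI) auto
      then have "AE w in M. \<bar>(\<Sum>i<n. X i w) / sqrt (real n) - 0\<bar> > \<bar>c\<bar> / 2"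
      proof eventually_elim
        case (elim w)
        have "\<bar>c\<bar> / 2 < \<bar>c\<bar>" using \<open>c \<noteq> 0\<close> by simp
        also have "\<dots> \<le> sqrt (real n) * \<bar>c\<bar>" using that mult_right_mono[of 1 "sqrt (real n)" "\<bar>c\<bar>"] by simp
        also have "\<dots> = \<bar>(\<Sum>i<n. X i w) / sqrt (real n) - 0\<bar>"
        proof -
          have "(\<Sum>i<n. X i w) = real n * c" using elim by simp
          then have "(\<Sum>i<n. X i w) / sqrt (real n) = sqrt (real n) * c"
            using real_div_sqrt[of "real n"] by (metis of_nat_0_le_iff times_divide_eq_left)
          then show ?thesis by (simp add: abs_mult)
        qed
        finally show ?case .
      qed
      then show ?thesis by (subst prob_Collect_eq_1) auto
    qed
    then have "(\<lambda>n. \<P>(w in M. \<bar>(\<Sum>i<n. X i w) / sqrt (real n) - 0\<bar> > \<bar>c\<bar> / 2)) \<longlonglongrightarrow> 1"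
      by (intro tendsto_eventually eventually_sequentiallyI[of 1])
    moreover have "(\<lambda>n. \<P>(w in M. \<bar>(\<Sum>i<n. X i w) / sqrt (real n) - 0\<bar> > \<bar>c\<bar> / 2)) \<longlonglongrightarrow> 0"
      using \<open>c \<noteq> 0\<close> by (intro converges_in_probD[OF conv]) simp
    ultimately have "(1::real) = 0" by (rule LIMSEQ_unique)
    then show False by simp
  qed
  with c show ?thesis by simp
qed

section \<open>Influence functions\<close>

lemma (in prob_space)
  fixes Z :: "nat \<Rightarrow> 'a \<Rightarrow> 'b::topological_space" and g :: "'b \<Rightarrow> real"
  assumes ind: "indep_vars (\<lambda>_. borel) Z {..<m}" and law: "\<And>i. i < m \<Longrightarrow> distr M borel (Z i) = \<mu>"
    and g[measurable]: "g \<in> borel_measurable borel"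
    and sq: "integrable \<mu> (\<lambda>x. (g x)\<^sup>2)" and mean: "(\<integral>x. g x \<partial>\<mu>) = 0"
  shows iid_sum_square_integrable: "integrable M (\<lambda>w. (\<Sum>i<m. g (Z i w))\<^sup>2)"
    and iid_sum_mean_square: "expectation (\<lambda>w. (\<Sum>i<m. g (Z i w))\<^sup>2) = real m * (\<integral>x. (g x)\<^sup>2 \<partial>\<mu>)"
proof -
  have [measurable]: "Z i \<in> borel_measurable M" if "i < m" for i
    using ind that by (auto simp: indep_vars_def2)
  have *: "integrable M (\<lambda>w. (g (Z i w))\<^sup>2)" "expectation (\<lambda>w. (g (Z i w))\<^sup>2) = (\<integral>x. (g x)\<^sup>2 \<partial>\<mu>)"
    "expectation (\<lambda>w. g (Z i w)) = 0" if "i < m" for i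
    using sq mean that law[OF that, symmetric] by (simp_all add: integrable_distr_eq integral_distr)
  show "integrable M (\<lambda>w. (\<Sum>i<m. g (Z i w))\<^sup>2)"
    using * by (intro integrable_square_sum) auto
  have "indep_vars (\<lambda>_. borel) (\<lambda>i w. g (Z i w)) {..<m}"
    by (rule indep_vars_compose2[OF ind]) simp
  from indep_vars_mean_square_sum[OF _ this] *
  show "expectation (\<lambda>w. (\<Sum>i<m. g (Z i w))\<^sup>2) = real m * (\<integral>x. (g x)\<^sup>2 \<partial>\<mu>)"
    by simp
qed

text \<open>Deterministic part of the expansion. Dividing \<open>\<Delta> * L\<close> by the true
  denominator instead of \<open>\<Delta>\<close> costs \<open>L * (\<Delta> - b * (1 - b))\<close>,
  which is of second order in \<open>L\<close> and \<open>b - p\<close>. The bounds on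
  \<open>b\<close> keep the denominator at least \<open>\<bar>\<Delta>\<bar> / 2\<close> in absolute
  value, whatever its sign; \<open>\<kappa>\<close> bounds the difference quotient of
  \<open>b * (1 - b)\<close> at \<open>p\<close>.\<close>

lemma ratio_remainder_le:
  fixes a b p t L U :: real
  defines "\<Delta> \<equiv> p * (1 - p)" and "\<kappa> \<equiv> \<bar>1 - 2 * p\<bar> + 1"
  assumes \<Delta>: "\<Delta> \<noteq> 0" and a: "a - t * (b * (1 - b)) = U + \<Delta> * L + t * (b - p)\<^sup>2"
    and b: "\<bar>b - p\<bar> \<le> 1" "\<kappa> * \<bar>b - p\<bar> \<le> \<bar>\<Delta>\<bar> / 2"
  shows "\<bar>a / (b * (1 - b)) - t - L\<bar> \<le> 2 / \<bar>\<Delta>\<bar> * (\<bar>U\<bar> + \<kappa> * L\<^sup>2 + (\<kappa> + \<bar>t\<bar>) * (b - p)\<^sup>2)"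
proof -
  let ?d = "b * (1 - b)" and ?e = "b - p"
  have "\<Delta> - ?d = ?e * (?e - (1 - 2 * p))"
    by (simp add: \<Delta>_def algebra_simps)
  then have "\<bar>\<Delta> - ?d\<bar> = \<bar>?e\<bar> * \<bar>?e - (1 - 2 * p)\<bar>" by (simp only: abs_mult)
  also have "\<dots> \<le> \<bar>?e\<bar> * \<kappa>" using b(1) unfolding \<kappa>_def by (intro mult_left_mono) linarith+
  finally have dd: "\<bar>\<Delta> - ?d\<bar> \<le> \<kappa> * \<bar>?e\<bar>" by (simp only: mult.commute)
  have d: "\<bar>\<Delta>\<bar> / 2 \<le> \<bar>?d\<bar>" using dd b(2) by linarith
  then have d0: "?d \<noteq> 0" using \<Delta> by auto
  have \<kappa>: "0 \<le> \<kappa>" by (simp add: \<kappa>_def)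
  define num where "num = U + L * (\<Delta> - ?d) + t * ?e\<^sup>2"
  have "a = t * ?d + L * ?d + num"
    unfolding num_def using a by (simp add: right_diff_distrib mult.commute)
  then have "a / ?d = t + L + num / ?d"
    using d0 by (simp only: add_divide_distrib nonzero_mult_div_cancel_right not_False_eq_True)
  then have "\<bar>a / ?d - t - L\<bar> = \<bar>num\<bar> / \<bar>?d\<bar>" by (simp only: abs_divide[symmetric])
  also have "\<dots> \<le> \<bar>num\<bar> / (\<bar>\<Delta>\<bar> / 2)"
    using d \<Delta> by (intro divide_left_mono mult_pos_pos) auto
  also have "\<dots> = 2 / \<bar>\<Delta>\<bar> * \<bar>num\<bar>" by simp
  also have "\<dots> \<le> 2 / \<bar>\<Delta>\<bar> * (\<bar>U\<bar> + \<kappa> * L\<^sup>2 + (\<kappa> + \<bar>t\<bar>) * ?e\<^sup>2)"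
  proof (rule mult_left_mono)
    have "2 * \<bar>L\<bar> * \<bar>?e\<bar> \<le> L\<^sup>2 + ?e\<^sup>2" using sum_squares_bound[of "\<bar>L\<bar>" "\<bar>?e\<bar>"] by (simp only: power2_abs)
    then have 1: "\<bar>L\<bar> * \<bar>?e\<bar> \<le> L\<^sup>2 + ?e\<^sup>2"
      using mult_nonneg_nonneg[OF abs_ge_zero abs_ge_zero, of L ?e] unfolding mult.assoc by linarith
    have "\<bar>L * (\<Delta> - ?d)\<bar> \<le> \<bar>L\<bar> * (\<kappa> * \<bar>?e\<bar>)" unfolding abs_mult[of L] using dd by (intro mult_left_mono) auto
    also have "\<dots> = \<kappa> * (\<bar>L\<bar> * \<bar>?e\<bar>)" by (simp only: mult.left_commute)
    also have "\<dots> \<le> \<kappa> * (L\<^sup>2 + ?e\<^sup>2)" using 1 \<kappa> by (intro mult_left_mono)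
    finally have 2: "\<bar>L * (\<Delta> - ?d)\<bar> \<le> \<kappa> * L\<^sup>2 + \<kappa> * ?e\<^sup>2" by (simp only: distrib_left)
    have "\<bar>num\<bar> \<le> \<bar>U\<bar> + \<bar>L * (\<Delta> - ?d)\<bar> + \<bar>t * ?e\<^sup>2\<bar>" unfolding num_def by linarith
    moreover have "\<bar>t * ?e\<^sup>2\<bar> = \<bar>t\<bar> * ?e\<^sup>2" by (simp add: abs_mult)
    moreover have "(\<kappa> + \<bar>t\<bar>) * ?e\<^sup>2 = \<kappa> * ?e\<^sup>2 + \<bar>t\<bar> * ?e\<^sup>2" by (rule distrib_right)
    ultimately show "\<bar>num\<bar> \<le> \<bar>U\<bar> + \<kappa> * L\<^sup>2 + (\<kappa> + \<bar>t\<bar>) * ?e\<^sup>2" using 2 by linarith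
  qed simp
  finally show ?thesis .
qed

section \<open>A remainder bound uniform in the sample\<close>

context auc_population
begin

abbreviation auc_of :: "nat \<Rightarrow> (nat \<Rightarrow> 'a \<Rightarrow> real \<times> real) \<Rightarrow> 'a \<Rightarrow> real"
  where "auc_of m Z w \<equiv> auc_estimate m (\<lambda>i. fst (Z i w)) (\<lambda>i. snd (Z i w))"

lemma auc_of_measurable:
  assumes "\<And>i. i < m \<Longrightarrow> Z i \<in> borel_measurable M"
  shows "(\<lambda>w. auc_of m Z w) \<in> borel_measurable M"
proof -
  have [measurable]: "Z i \<in> borel_measurable M" if "i < m" for i using assms that by simp
  have [measurable]: "(\<lambda>w. of_bool (fst (Z i w) < fst (Z j w)) * snd (Z j w) * (1 - snd (Z i w))) \<in> borel_measurable M"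
    if "i < m" "j < m" for i j using that by measurable
  show ?thesis unfolding auc_estimate_eq by measurable
qed

text \<open>An exact identity: the Hoeffding decomposition of the V-statistic combined with the
  expansion of \<open>b * (1 - b)\<close> at \<open>p\<close>, whose quadratic term survives as
  \<open>\<theta> * (b - p)\<^sup>2\<close>. The witness is the V-statistic over all
  \<open>m\<^sup>2\<close> pairs, diagonal included.\<close>

lemma auc_decomposition:
  fixes x :: "nat \<Rightarrow> real \<times> real"
  assumes m: "m > 0"
  defines "b \<equiv> (\<Sum>i<m. snd (x i)) / m" and "U \<equiv> (\<Sum>i<m. \<Sum>j<m. degen (x i) (x j)) / (real m)\<^sup>2"
    and "L \<equiv> (\<Sum>i<m. lin (x i)) / m"
  obtains a where "auc_estimate m (\<lambda>i. fst (x i)) (\<lambda>i. snd (x i)) = a / (b * (1 - b))"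
    and "a - \<theta> * (b * (1 - b)) = U + \<Delta> * L + \<theta> * (b - p)\<^sup>2"
proof
  let ?a = "(\<Sum>i<m. \<Sum>j<m. kern (x i) (x j)) / (real m)\<^sup>2"
  have S: "(\<Sum>i<m. snd (x i)) = m * b" using m by (simp add: b_def)
  have "(\<Sum>i<m. 1 - snd (x i)) = m - m * b" by (simp add: sum_subtractf S)
  then have T: "(\<Sum>i<m. 1 - snd (x i)) = m * (1 - b)" by (simp add: right_diff_distrib)
  have "auc_estimate m (\<lambda>i. fst (x i)) (\<lambda>i. snd (x i)) =
      (\<Sum>i<m. \<Sum>j<m. kern (x i) (x j)) / ((m * b) * (m * (1 - b)))"
    unfolding auc_estimate_eq S T kern_def ..
  also have "\<dots> = ?a / (b * (1 - b))" by (simp add: power2_eq_square mult_ac)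
  finally show "auc_estimate m (\<lambda>i. fst (x i)) (\<lambda>i. snd (x i)) = ?a / (b * (1 - b))" .
  let ?P = "(\<Sum>i<m. proj1 (x i) + proj2 (x i)) / m"
  have "(\<Sum>i<m. \<Sum>j<m. degen (x i) (x j)) = (\<Sum>i<m. \<Sum>j<m. kern (x i) (x j)) -
      m * (\<Sum>i<m. proj1 (x i)) - m * (\<Sum>i<m. proj2 (x i)) + m * m * numer"
    by (simp add: degen_def sum.distrib sum_subtractf sum_distrib_left)
  then have U: "U = ?a - ?P + numer"
    using m unfolding U_def by (simp add: add_divide_distrib diff_divide_distrib sum.distrib power2_eq_square)
  have "\<Delta> * lin y = proj1 y + proj2 y - 2 * numer - \<theta> * (1 - 2 * p) * (snd y - p)" for y
    using \<Delta>_nonzero(1) unfolding lin_def target_eq by (simp add: field_simps)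
  moreover have "(\<Sum>i<m. \<theta> * (1 - 2 * p) * (snd (x i) - p)) = \<theta> * (1 - 2 * p) * ((\<Sum>i<m. snd (x i)) - m * p)"
    unfolding sum_distrib_left[symmetric] by (simp add: sum_subtractf)
  ultimately have "\<Delta> * (\<Sum>i<m. lin (x i)) = (\<Sum>i<m. proj1 (x i) + proj2 (x i)) - m * (2 * numer)
      - \<theta> * (1 - 2 * p) * ((\<Sum>i<m. snd (x i)) - m * p)"
    by (simp add: sum_distrib_left sum_subtractf sum.distrib)
  then have "\<Delta> * L = ((\<Sum>i<m. proj1 (x i) + proj2 (x i)) - m * (2 * numer)
      - \<theta> * (1 - 2 * p) * (m * (b - p))) / m"
    unfolding L_def S by (simp add: right_diff_distrib)
  also have "\<dots> = ?P - 2 * numer - \<theta> * (1 - 2 * p) * (b - p)"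
    using m by (simp add: diff_divide_distrib)
  finally have L: "\<Delta> * L = ?P - 2 * numer - \<theta> * (1 - 2 * p) * (b - p)" .
  have n: "numer = \<theta> * (p * (1 - p))" using \<Delta>_nonzero(1) by (simp add: target_eq \<Delta>_def)
  show "?a - \<theta> * (b * (1 - b)) = U + \<Delta> * L + \<theta> * (b - p)\<^sup>2"
    unfolding U L n by (simp add: algebra_simps power2_eq_square)
qed

text \<open>The term \<open>C / m\<close> pays, by Chebyshev, for sample means far from
  \<open>p\<close>, where the quotient is out of control; \<open>C / (m * \<epsilon>)\<close> is
  Markov's inequality for the bound on the remainder, whose expectation is of order
  \<open>1 / m\<close>. \<open>C\<close> is fixed before the sample, so it serves all rows of an
  array at once.\<close>

lemma remainder_prob_le:
  obtains C where "\<And>m Z \<epsilon>. m > 0 \<Longrightarrow> indep_vars (\<lambda>_. borel) Z {..<m} \<Longrightarrow>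
    (\<And>i. i < m \<Longrightarrow> distr M borel (Z i) = \<mu>) \<Longrightarrow> \<epsilon> > 0 \<Longrightarrow>
    \<P>(w in M. \<bar>auc_of m Z w - \<theta> - (\<Sum>i<m. lin (Z i w)) / m\<bar> > \<epsilon>) \<le> C / m + C / (m * \<epsilon>)"
proof -
  define cU where "cU = 4 * (\<integral>(x, y). (degen x y)\<^sup>2 \<partial>(\<mu> \<Otimes>\<^sub>M \<mu>)) + 2 * (\<integral>x. (degen x x)\<^sup>2 \<partial>\<mu>)"
  define vL where "vL = (\<integral>x. (lin x)\<^sup>2 \<partial>\<mu>)"
  define vP where "vP = (\<integral>x. (snd x - p)\<^sup>2 \<partial>\<mu>)"
  define \<kappa> where "\<kappa> = \<bar>1 - 2 * p\<bar> + 1"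
  \<comment> \<open>Within \<open>\<delta>\<close> of \<open>p\<close> both smallness conditions of
    \<open>ratio_remainder_le\<close> hold.\<close>
  define \<delta> where "\<delta> = min 1 (\<bar>\<Delta>\<bar> / (2 * \<kappa>))"
  have \<kappa>: "\<kappa> > 0" by (simp add: \<kappa>_def add_nonneg_pos)
  have \<delta>: "\<delta> > 0" using \<kappa> \<Delta>_nonzero by (simp add: \<delta>_def)
  have nonneg: "0 \<le> cU" "0 \<le> vL" "0 \<le> vP"
    unfolding cU_def vL_def vP_def by (auto intro!: add_nonneg_nonneg integral_nonneg_AE simp: case_prod_beta)
  define c1 where "c1 = vP / \<delta>\<^sup>2"
  define c2 where "c2 = 2 / \<bar>\<Delta>\<bar> * ((1 + cU) + \<kappa> * vL + (\<kappa> + \<bar>\<theta>\<bar>) * vP)"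
  have c: "0 \<le> c1" "0 \<le> c2"
    unfolding c1_def c2_def using nonneg \<kappa> by (auto intro!: mult_nonneg_nonneg add_nonneg_nonneg)
  show ?thesis
  proof (rule that[of "c1 + c2"])
    fix m :: nat and Z :: "nat \<Rightarrow> 'a \<Rightarrow> real \<times> real" and \<epsilon> :: real
    assume m: "m > 0" and ind: "indep_vars (\<lambda>_. borel) Z {..<m}"
      and law: "\<And>i. i < m \<Longrightarrow> distr M borel (Z i) = \<mu>" and \<epsilon>: "\<epsilon> > 0"
    have Zm[measurable]: "Z i \<in> borel_measurable M" if "i < m" for i
      using ind that by (auto simp: indep_vars_def2)
    define U where "U w = (\<Sum>i<m. \<Sum>j<m. degen (Z i w) (Z j w)) / (real m)\<^sup>2" for w
    define L where "L w = (\<Sum>i<m. lin (Z i w)) / m" for w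
    define e where "e w = (\<Sum>i<m. snd (Z i w)) / m - p" for w
    have e_eq: "e w = (\<Sum>i<m. snd (Z i w) - p) / m" for w
      using m by (simp add: e_def sum_subtractf diff_divide_distrib)
    have [measurable]: "(\<lambda>w. degen (Z i w) (Z j w)) \<in> borel_measurable M" if "i < m" "j < m" for i j
      using measurable_compose[OF measurable_Pair[OF Zm Zm] degen_measurable, OF that] by simp
    have Um[measurable]: "U \<in> borel_measurable M" and Lm[measurable]: "L \<in> borel_measurable M"
      and em[measurable]: "e \<in> borel_measurable M"
      unfolding U_def[abs_def] L_def[abs_def] e_def[abs_def] by measurable
    note dk = degenerate_kernel_mean_square[OF ind law degen_measurable degen_left degen_right degen_square]
    have U2: "integrable M (\<lambda>w. (U w)\<^sup>2)" unfolding U_def power_divide using dk(1) by simp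
    have EU2: "expectation (\<lambda>w. (U w)\<^sup>2) \<le> cU / (real m)\<^sup>2"
    proof -
      have "expectation (\<lambda>w. (U w)\<^sup>2) = expectation (\<lambda>w. (\<Sum>i<m. \<Sum>j<m. degen (Z i w) (Z j w))\<^sup>2) / ((real m)\<^sup>2)\<^sup>2"
        unfolding U_def power_divide by simp
      also have "\<dots> \<le> ((real m)\<^sup>2 * cU) / ((real m)\<^sup>2)\<^sup>2"
        unfolding cU_def by (intro divide_right_mono dk(2)) auto
      also have "\<dots> = cU / (real m)\<^sup>2" using m by (simp add: power2_eq_square)
      finally show ?thesis .
    qed
    have U1: "integrable M (\<lambda>w. \<bar>U w\<bar>)" by (intro integrable_abs square_integrable_imp_integrable[OF Um U2])
    have EU: "expectation (\<lambda>w. \<bar>U w\<bar>) \<le> (1 + cU) / m"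
    proof -
      \<comment> \<open>Pointwise AM-GM in place of Jensen: a second moment of order
        \<open>1 / m\<^sup>2\<close> becomes a first absolute moment of order
        \<open>1 / m\<close>.\<close>
      have "\<bar>u\<bar> \<le> 1 / m + m * u\<^sup>2" for u :: real
      proof -
        have "2 * (1 * (m * \<bar>u\<bar>)) \<le> 1\<^sup>2 + (m * \<bar>u\<bar>)\<^sup>2"
          using sum_squares_bound[of 1 "m * \<bar>u\<bar>"] by simp
        moreover have "0 \<le> m * \<bar>u\<bar>" by simp
        ultimately have "m * \<bar>u\<bar> \<le> 1 + (m * \<bar>u\<bar>)\<^sup>2"
          unfolding mult_1_left power_one by linarith
        then have "m * \<bar>u\<bar> \<le> 1 + m * (m * u\<^sup>2)"
          by (simp add: power_mult_distrib power2_eq_square[of "real m"] mult.assoc)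
        then have "m * \<bar>u\<bar> / m \<le> (1 + m * (m * u\<^sup>2)) / m" by (intro divide_right_mono) auto
        then show ?thesis using m by (simp add: add_divide_distrib)
      qed
      then have "expectation (\<lambda>w. \<bar>U w\<bar>) \<le> expectation (\<lambda>w. 1 / m + m * (U w)\<^sup>2)"
        using U1 U2 by (intro integral_mono) auto
      also have "\<dots> = 1 / m + m * expectation (\<lambda>w. (U w)\<^sup>2)" using U2 by (simp add: prob_space)
      also have "\<dots> \<le> 1 / m + m * (cU / (real m)\<^sup>2)"
        using EU2 by (intro add_left_mono mult_left_mono) auto
      also have "\<dots> = (1 + cU) / m" using m by (simp add: power2_eq_square add_divide_distrib)
      finally show ?thesis .
    qed
    note sqL = iid_sum_square_integrable[OF ind law lin_measurable lin_square(1) integral_lin]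
      iid_sum_mean_square[OF ind law lin_measurable lin_square(1) integral_lin]
    have gm: "(\<lambda>x :: real \<times> real. snd x - p) \<in> borel_measurable borel" by measurable
    note sqe = iid_sum_square_integrable[OF ind law gm weighted_snd_square(1) integral_snd_minus_p]
      iid_sum_mean_square[OF ind law gm weighted_snd_square(1) integral_snd_minus_p]
    have L2: "integrable M (\<lambda>w. (L w)\<^sup>2)" "expectation (\<lambda>w. (L w)\<^sup>2) = vL / m"
      unfolding L_def power_divide using sqL m by (simp_all add: vL_def power2_eq_square)
    have e2: "integrable M (\<lambda>w. (e w)\<^sup>2)" "expectation (\<lambda>w. (e w)\<^sup>2) = vP / m"
      unfolding e_eq power_divide using sqe m by (simp_all add: vP_def power2_eq_square)
    define Q where "Q w = 2 / \<bar>\<Delta>\<bar> * (\<bar>U w\<bar> + \<kappa> * (L w)\<^sup>2 + (\<kappa> + \<bar>\<theta>\<bar>) * (e w)\<^sup>2)" for w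
    have Q1: "integrable M Q" unfolding Q_def[abs_def] using U1 L2 e2 by simp
    have Q0: "0 \<le> Q w" for w unfolding Q_def using \<kappa> by (auto intro!: mult_nonneg_nonneg add_nonneg_nonneg divide_nonneg_nonneg)
    have Qm[measurable]: "Q \<in> borel_measurable M" unfolding Q_def[abs_def] by measurable
    have EQ: "expectation Q \<le> c2 / m"
    proof -
      have "expectation Q = 2 / \<bar>\<Delta>\<bar> * (expectation (\<lambda>w. \<bar>U w\<bar>) + \<kappa> * (vL / m) + (\<kappa> + \<bar>\<theta>\<bar>) * (vP / m))"
        unfolding Q_def[abs_def] using U1 L2 e2 by simp
      also have "\<dots> \<le> 2 / \<bar>\<Delta>\<bar> * ((1 + cU) / m + \<kappa> * (vL / m) + (\<kappa> + \<bar>\<theta>\<bar>) * (vP / m))"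
        using EU by (intro mult_left_mono add_right_mono) auto
      also have "\<dots> = c2 / m" unfolding c2_def by (simp add: add_divide_distrib mult.commute)
      finally show ?thesis .
    qed
    let ?T = "\<lambda>w. auc_of m Z w"
    have Tm[measurable]: "?T \<in> borel_measurable M" by (rule auc_of_measurable) simp
    have "\<P>(w in M. \<bar>?T w - \<theta> - L w\<bar> > \<epsilon>) \<le> \<P>(w in M. \<bar>e w\<bar> > \<delta>) + \<P>(w in M. Q w \<ge> \<epsilon>)"
    proof (rule prob_union_le)
      fix w assume gt: "\<bar>?T w - \<theta> - L w\<bar> > \<epsilon>"
      have "Q w \<ge> \<epsilon> \<or> \<bar>e w\<bar> > \<delta>"
      proof (rule disjCI)
        assume "\<not> \<bar>e w\<bar> > \<delta>"
        then have e: "\<bar>e w\<bar> \<le> 1" "\<bar>e w\<bar> \<le> \<bar>\<Delta>\<bar> / (2 * \<kappa>)" by (auto simp: \<delta>_def)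
        then have "\<kappa> * \<bar>e w\<bar> \<le> \<bar>\<Delta>\<bar> / 2" using \<kappa> by (simp add: field_simps)
        obtain a where a: "?T w = a / ((\<Sum>i<m. snd (Z i w)) / m * (1 - (\<Sum>i<m. snd (Z i w)) / m))"
          and "a - \<theta> * ((\<Sum>i<m. snd (Z i w)) / m * (1 - (\<Sum>i<m. snd (Z i w)) / m)) = U w + \<Delta> * L w + \<theta> * (e w)\<^sup>2"
          using auc_decomposition[OF m, of "\<lambda>i. Z i w"] unfolding U_def L_def e_def by blast
        with ratio_remainder_le[of p a \<theta> "(\<Sum>i<m. snd (Z i w)) / m" "U w" "L w"] e(1) \<Delta>_nonzero(1) \<open>\<kappa> * \<bar>e w\<bar> \<le> \<bar>\<Delta>\<bar> / 2\<close>
        have "\<bar>?T w - \<theta> - L w\<bar> \<le> Q w"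
          unfolding Q_def a \<Delta>_def \<kappa>_def e_def by blast
        then show "Q w \<ge> \<epsilon>" using gt by linarith
      qed
      then show "\<bar>e w\<bar> > \<delta> \<or> Q w \<ge> \<epsilon>" by blast
    qed measurable
    also have "\<dots> \<le> c1 / m + c2 / (m * \<epsilon>)"
    proof (rule add_mono)
      have "\<P>(w in M. \<bar>e w\<bar> > \<delta>) \<le> expectation (\<lambda>w. (e w)\<^sup>2) / \<delta>\<^sup>2"
        by (rule prob_abs_gt_le_second_moment[OF em e2(1) \<delta>])
      then show "\<P>(w in M. \<bar>e w\<bar> > \<delta>) \<le> c1 / m" by (simp add: e2(2) c1_def mult.commute)
      have "\<P>(w in M. Q w \<ge> \<epsilon>) \<le> expectation Q / \<epsilon>"
        using integral_Markov_inequality_measure[OF Q1, of "{}" \<epsilon>] Q0 \<epsilon> by simp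
      also have "\<dots> \<le> c2 / m / \<epsilon>" using EQ \<epsilon> by (intro divide_right_mono) auto
      finally show "\<P>(w in M. Q w \<ge> \<epsilon>) \<le> c2 / (m * \<epsilon>)" by simp
    qed
    also have "\<dots> \<le> (c1 + c2) / m + (c1 + c2) / (m * \<epsilon>)"
      using c \<epsilon> by (intro add_mono divide_right_mono) auto
    finally show "\<P>(w in M. \<bar>?T w - \<theta> - (\<Sum>i<m. lin (Z i w)) / m\<bar> > \<epsilon>) \<le>
        (c1 + c2) / m + (c1 + c2) / (m * \<epsilon>)"
      unfolding L_def .
  qed
qed

text \<open>The samples may form a triangular array, as the pooled ones do.\<close>

lemma scaled_remainder_vanishes:
  fixes Z :: "nat \<Rightarrow> nat \<Rightarrow> 'a \<Rightarrow> real \<times> real" and m :: "nat \<Rightarrow> nat"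
  assumes ind: "\<And>n. indep_vars (\<lambda>_. borel) (Z n) {..<m n}"
    and law: "\<And>n i. i < m n \<Longrightarrow> distr M borel (Z n i) = \<mu>" and m: "\<And>n. n \<le> m n"
  shows "converges_in_prob M (\<lambda>n w. sqrt (real n) *
    ((auc_of (m n) (Z n) w - \<theta>) - (\<Sum>i<m n. \<phi> (Z n i w)) / real (m n))) 0"
proof -
  have Zm[measurable]: "Z n i \<in> borel_measurable M" if "i < m n" for n i
    using ind[of n] that by (auto simp: indep_vars_def2)
  have [measurable]: "(\<lambda>w. auc_of (m n) (Z n) w) \<in> borel_measurable M" for n
    by (rule auc_of_measurable) simp
  obtain C where C: "\<And>m Z \<epsilon>. m > 0 \<Longrightarrow> indep_vars (\<lambda>_. borel) Z {..<m} \<Longrightarrow>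
    (\<And>i. i < m \<Longrightarrow> distr M borel (Z i) = \<mu>) \<Longrightarrow> \<epsilon> > 0 \<Longrightarrow>
    \<P>(w in M. \<bar>auc_of m Z w - \<theta> - (\<Sum>i<m. lin (Z i w)) / m\<bar> > \<epsilon>) \<le> C / m + C / (m * \<epsilon>)"
    using remainder_prob_le by blast
  show ?thesis
  proof (rule converges_in_prob_le)
    fix \<epsilon> :: real assume \<epsilon>: "\<epsilon> > 0"
    \<comment> \<open>Undoing the factor \<open>sqrt n\<close> leaves the threshold
      \<open>\<epsilon> / sqrt n\<close>, so the Markov term is of order
      \<open>1 / (\<epsilon> * sqrt n)\<close>; \<open>n \<le> m n\<close> allows the sample size to
      be replaced by \<open>n\<close>.\<close>
    let ?b = "\<lambda>n. \<bar>C\<bar> * inverse (real n) + \<bar>C\<bar> / \<epsilon> * inverse (sqrt (real n))"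
    have "?b \<longlonglongrightarrow> \<bar>C\<bar> * 0 + \<bar>C\<bar> / \<epsilon> * 0"
      by (intro tendsto_intros tendsto_inverse_0_at_top filterlim_real_sequentially
        filterlim_compose[OF sqrt_at_top filterlim_real_sequentially])
    moreover have "\<P>(w in M. \<bar>sqrt (real n) * ((auc_of (m n) (Z n) w - \<theta>) - (\<Sum>i<m n. \<phi> (Z n i w)) / real (m n)) - 0\<bar> > \<epsilon>) \<le> ?b n"
      if n: "n \<ge> 1" for n
    proof -
      let ?s = "sqrt (real n)"
      have s: "?s > 0" using n by simp
      have mn: "m n > 0" "real n \<le> real (m n)" using m[of n] n by auto
      \<comment> \<open>\<open>\<phi>\<close> and \<open>lin\<close> agree only almost surely under
        the law of one observation, which passes to the finitely many sample points.\<close>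
      have "AE w in M. \<forall>i\<in>{..<m n}. \<phi> (Z n i w) = lin (Z n i w)"
      proof (rule AE_finite_allI)
        fix i assume i: "i \<in> {..<m n}"
        show "AE w in M. \<phi> (Z n i w) = lin (Z n i w)"
          using influence_eq_lin i unfolding law[of i n, symmetric, OF i[simplified]] by (intro AE_distrD[OF Zm]) auto
      qed simp
      then have "\<P>(w in M. \<bar>?s * ((auc_of (m n) (Z n) w - \<theta>) - (\<Sum>i<m n. \<phi> (Z n i w)) / real (m n)) - 0\<bar> > \<epsilon>) =
        \<P>(w in M. \<bar>auc_of (m n) (Z n) w - \<theta> - (\<Sum>i<m n. lin (Z n i w)) / real (m n)\<bar> > \<epsilon> / ?s)"
      proof (intro prob_eq_AE)
        assume "AE w in M. \<forall>i\<in>{..<m n}. \<phi> (Z n i w) = lin (Z n i w)"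
        then show "AE w in M. (\<bar>?s * ((auc_of (m n) (Z n) w - \<theta>) - (\<Sum>i<m n. \<phi> (Z n i w)) / real (m n)) - 0\<bar> > \<epsilon>) =
          (\<bar>auc_of (m n) (Z n) w - \<theta> - (\<Sum>i<m n. lin (Z n i w)) / real (m n)\<bar> > \<epsilon> / ?s)"
        proof eventually_elim
          case (elim w)
          then have "(\<Sum>i<m n. \<phi> (Z n i w)) = (\<Sum>i<m n. lin (Z n i w))" by (intro sum.cong) auto
          moreover have "(\<bar>?s * x - 0\<bar> > \<epsilon>) = (\<bar>x\<bar> > \<epsilon> / ?s)" for x
            using s by (simp add: abs_mult pos_divide_less_eq mult.commute)
          ultimately show ?case by (simp only:)
        qed
      qed measurable
      also have "\<dots> \<le> C / m n + C / (m n * (\<epsilon> / ?s))"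
        by (rule C[OF mn(1) ind law]) (use \<epsilon> s in auto)
      also have "\<dots> \<le> \<bar>C\<bar> / m n + \<bar>C\<bar> / (m n * (\<epsilon> / ?s))"
        using \<epsilon> s by (intro add_mono divide_right_mono) auto
      also have "\<dots> \<le> \<bar>C\<bar> / n + \<bar>C\<bar> / (n * (\<epsilon> / ?s))"
        using mn \<epsilon> s n by (intro add_mono divide_left_mono mult_right_mono mult_pos_pos) auto
      also have "\<bar>C\<bar> / (n * (\<epsilon> / ?s)) = \<bar>C\<bar> / \<epsilon> * inverse ?s"
      proof -
        have "n * (\<epsilon> / ?s) = \<epsilon> * (real n / ?s)" by simp
        also have "real n / ?s = ?s" by (simp add: real_div_sqrt)
        finally show ?thesis by (simp only: divide_inverse inverse_mult_distrib mult.assoc)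
      qed
      finally show ?thesis by (simp add: divide_inverse)
    qed
    ultimately show "\<exists>b. b \<longlonglongrightarrow> 0 \<and> (\<forall>\<^sub>F n in sequentially. \<P>(w in M. \<bar>sqrt (real n) *
        ((auc_of (m n) (Z n) w - \<theta>) - (\<Sum>i<m n. \<phi> (Z n i w)) / real (m n)) - 0\<bar> > \<epsilon>) \<le> b n)"
      by (intro exI[of _ ?b] conjI eventually_sequentiallyI[of 1]) auto
  qed measurable
qed

lemma is_influence_function_auc:
  assumes ind: "indep_vars (\<lambda>_. borel) Z UNIV" and law: "\<And>i. distr M borel (Z i) = \<mu>"
  shows "is_influence_function M Z (\<lambda>n w. auc_of n Z w) \<theta> \<phi>"
  unfolding is_influence_function_def
  using scaled_remainder_vanishes[of "\<lambda>_. Z" "\<lambda>n. n"] indep_vars_subset[OF ind] law by simp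

end

text \<open>Subtracting the two expansions eliminates the estimator and leaves the normalised sum of
  \<open>\<psi> - \<phi>\<close>, about which no more than measurability is known.\<close>

lemma (in prob_space) influence_function_unique:
  fixes Z :: "nat \<Rightarrow> 'a \<Rightarrow> 'b::topological_space"
  assumes ind: "indep_vars (\<lambda>_. borel) Z UNIV" and law: "\<And>i. distr M borel (Z i) = \<mu>"
    and f1: "is_influence_function M Z T t \<phi>" and f2: "is_influence_function M Z T t \<psi>"
  shows "AE x in \<mu>. \<psi> x = \<phi> x"
proof -
  have [measurable]: "\<phi> \<in> borel_measurable borel" "\<psi> \<in> borel_measurable borel"
    using f1 f2 by (auto simp: is_influence_function_def)
  have Zm[measurable]: "Z i \<in> borel_measurable M" for i
    using ind by (auto simp: indep_vars_def2)
  let ?X = "\<lambda>i w. \<psi> (Z i w) - \<phi> (Z i w)"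
  have "converges_in_prob M (\<lambda>n w. sqrt (real n) * ((T n w - t) - (\<Sum>i<n. \<phi> (Z i w)) / real n) +
      -1 * (sqrt (real n) * ((T n w - t) - (\<Sum>i<n. \<psi> (Z i w)) / real n))) 0"
    using f1 f2 unfolding is_influence_function_def
    by (intro converges_in_prob_add converges_in_prob_cmult) auto
  also have "(\<lambda>n w. sqrt (real n) * ((T n w - t) - (\<Sum>i<n. \<phi> (Z i w)) / real n) +
      -1 * (sqrt (real n) * ((T n w - t) - (\<Sum>i<n. \<psi> (Z i w)) / real n))) =
    (\<lambda>n w. (\<Sum>i<n. ?X i w) / sqrt (real n))"
  proof (intro ext)
    fix n w
    have "sqrt (real n) * (s / real n) = s / sqrt (real n)" for s
      by (metis real_div_sqrt of_nat_0_le_iff times_divide_eq_left times_divide_eq_right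
          divide_divide_eq_right mult.commute)
    then show "sqrt (real n) * ((T n w - t) - (\<Sum>i<n. \<phi> (Z i w)) / real n) +
      -1 * (sqrt (real n) * ((T n w - t) - (\<Sum>i<n. \<psi> (Z i w)) / real n)) = (\<Sum>i<n. ?X i w) / sqrt (real n)"
      by (simp only: right_diff_distrib sum_subtractf diff_divide_distrib)
  qed
  finally have conv: "converges_in_prob M (\<lambda>n w. (\<Sum>i<n. ?X i w) / sqrt (real n)) 0" .
  have "AE x in distr \<mu> borel (\<lambda>x. \<psi> x - \<phi> x). x = 0"
  proof (rule iid_scaled_sum_vanishes[OF _ _ conv])
    show "indep_vars (\<lambda>_. borel) ?X UNIV"
      by (rule indep_vars_compose2[OF ind, of "\<lambda>i z. \<psi> z - \<phi> z"]) simp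
    show "distr M borel (?X i) = distr \<mu> borel (\<lambda>x. \<psi> x - \<phi> x)" for i
      unfolding law[of i, symmetric] by (subst distr_distr) (auto simp: comp_def)
  qed
  then have "AE x in \<mu>. \<psi> x - \<phi> x = 0"
    by (rule AE_distrD[rotated]) (simp add: law[of 0, symmetric])
  then show ?thesis by eventually_elim simp
qed

section \<open>The central limit theorem for two samples\<close>

text \<open>Limits of the weights that the labeled and the unlabeled sum get in the difference
  between pooled and labeled mean. A finite limit of \<open>n / N n\<close> forces
  \<open>N n\<close> to grow at least linearly, so the unlabeled sum has its own limit theorem, also
  for \<open>\<rho> = 0\<close>.\<close>

lemma tendsto_div_add_1:
  fixes N :: "nat \<Rightarrow> nat"
  assumes N: "\<And>n. 0 < N n" and lim: "(\<lambda>n. real n / real (N n)) \<longlonglongrightarrow> \<rho>"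
  shows "0 \<le> \<rho>" and "filterlim N at_top sequentially"
    and "(\<lambda>n. real (N n) / real (n + N n)) \<longlonglongrightarrow> 1 / (1 + \<rho>)"
    and "(\<lambda>n. sqrt (real n) * sqrt (real (N n)) / real (n + N n)) \<longlonglongrightarrow> sqrt \<rho> / (1 + \<rho>)"
proof -
  show \<rho>: "0 \<le> \<rho>" by (rule LIMSEQ_le_const[OF lim]) auto
  have "filterlim (\<lambda>n. real (N n)) at_top sequentially"
  proof (rule filterlim_at_top_mono)
    show "filterlim (\<lambda>n. 1 / (\<rho> + 1) * real n) at_top sequentially"
      using \<rho> by (intro filterlim_tendsto_pos_mult_at_top[OF tendsto_const] filterlim_real_sequentially) auto
    have "\<forall>\<^sub>F n in sequentially. real n / real (N n) < \<rho> + 1"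
      using lim by (rule order_tendstoD(2)) simp
    then show "\<forall>\<^sub>F n in sequentially. 1 / (\<rho> + 1) * real n \<le> real (N n)"
      by eventually_elim (use \<rho> N in \<open>simp add: divide_le_eq pos_divide_less_eq mult.commute less_imp_le\<close>)
  qed
  then show "filterlim N at_top sequentially"
    by (simp add: filterlim_sequentially_iff_filterlim_real)
  have eq: "real (N n) / real (n + N n) = 1 / (1 + real n / real (N n))" for n
    using N[of n] by (simp add: field_simps)
  show k: "(\<lambda>n. real (N n) / real (n + N n)) \<longlonglongrightarrow> 1 / (1 + \<rho>)"
    unfolding eq using \<rho> by (intro tendsto_intros lim) auto
  have eq2: "sqrt (real n) * sqrt (real (N n)) / real (n + N n) = sqrt (real n / real (N n)) * (real (N n) / real (n + N n))" for n
  proof -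
    have "sqrt (real n) * sqrt (real (N n)) = sqrt (real n / real (N n)) * real (N n)"
      using real_div_sqrt[of "real (N n)"] by (simp add: real_sqrt_divide flip: times_divide_eq_right)
    then show ?thesis by simp
  qed
  have "(\<lambda>n. sqrt (real n / real (N n)) * (real (N n) / real (n + N n))) \<longlonglongrightarrow> sqrt \<rho> * (1 / (1 + \<rho>))"
    by (intro tendsto_mult tendsto_real_sqrt lim k)
  then show "(\<lambda>n. sqrt (real n) * sqrt (real (N n)) / real (n + N n)) \<longlonglongrightarrow> sqrt \<rho> / (1 + \<rho>)"
    unfolding eq2 by simp
qed

lemma
  assumes "0 \<le> v"
  shows char_normal_law: "char (normal_law 0 v) t = complex_of_real (exp (- (v * t\<^sup>2) / 2))"
    and real_distribution_normal_law: "real_distribution (normal_law 0 v)"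
proof -
  interpret real_distribution std_normal_distribution by (rule real_dist_normal_dist)
  have "char (normal_law 0 v) t = char std_normal_distribution (sqrt v * t)"
    unfolding normal_law_def char_def by (subst integral_distr) (auto simp: mult_ac)
  then show "char (normal_law 0 v) t = complex_of_real (exp (- (v * t\<^sup>2) / 2))"
    using assms by (simp add: char_std_normal_distribution power_mult_distrib)
  show "real_distribution (normal_law 0 v)"
    unfolding normal_law_def by (intro real_distribution_distr) simp
qed

context prob_space
begin

text \<open>The central limit theorem as a statement about powers of one characteristic function, so
  that it can be evaluated along \<open>N n\<close> and for each factor separately. Variance zero is
  split off because the normalisation divides by \<open>\<sigma>\<close>; there the limit is
  1.\<close>

lemma char_power_tendsto:
  fixes X :: "nat \<Rightarrow> 'a \<Rightarrow> real"
  assumes ind: "indep_vars (\<lambda>_. borel) X UNIV" and law: "\<And>i. distr M borel (X i) = \<nu>"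
    and sq: "integrable \<nu> (\<lambda>x. x\<^sup>2)" and mean: "(\<integral>x. x \<partial>\<nu>) = 0"
  shows "(\<lambda>n. char \<nu> (1 / sqrt (real n) * t) ^ n) \<longlonglongrightarrow> exp (- ((\<integral>x. x\<^sup>2 \<partial>\<nu>) * t\<^sup>2) / 2)"
proof -
  have [measurable]: "X i \<in> borel_measurable M" for i
    using ind by (auto simp: indep_vars_def2)
  have sets[simp, measurable_cong]: "sets \<nu> = sets borel" unfolding law[of 0, symmetric] by simp
  interpret N: prob_space \<nu> unfolding law[of 0, symmetric] by (rule prob_space_distr) simp
  have Xsq: "integrable M (\<lambda>w. (X i w)\<^sup>2)" "expectation (\<lambda>w. (X i w)\<^sup>2) = (\<integral>x. x\<^sup>2 \<partial>\<nu>)"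
    "expectation (X i) = 0" for i
    using sq mean unfolding law[of i, symmetric] by (simp_all add: integrable_distr_eq integral_distr)
  show ?thesis
  proof (cases "(\<integral>x. x\<^sup>2 \<partial>\<nu>) = 0")
    case True
    have "AE x in \<nu>. x\<^sup>2 = 0"
      using True sq by (subst (asm) integral_nonneg_eq_0_iff_AE) auto
    then have "char \<nu> s = (CLINT x|\<nu>. 1)" for s
      unfolding char_def by (intro integral_cong_AE) (auto elim!: eventually_mono)
    also have "(CLINT x|\<nu>. 1) = 1"
      using N.prob_space by simp
    finally show ?thesis using True by simp
  next
    case False
    define \<sigma> where "\<sigma> = sqrt (\<integral>x. x\<^sup>2 \<partial>\<nu>)"
    have "0 \<le> (\<integral>x. x\<^sup>2 \<partial>\<nu>)" by (rule integral_nonneg_AE) simp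
    with False have "0 < (\<integral>x. x\<^sup>2 \<partial>\<nu>)" by linarith
    then have \<sigma>: "\<sigma> > 0" "\<sigma>\<^sup>2 = (\<integral>x. x\<^sup>2 \<partial>\<nu>)" by (simp_all add: \<sigma>_def)
    have "weak_conv_m (\<lambda>n. distr M borel (\<lambda>w. (\<Sum>i<n. X i w) / sqrt (real n * \<sigma>\<^sup>2))) std_normal_distribution"
      using Xsq \<sigma> law by (intro central_limit_theorem_zero_mean[OF ind]) auto
    \<comment> \<open>Evaluating at \<open>\<sigma> * t\<close> undoes the division by
      \<open>\<sigma>\<close>.\<close>
    from levy_continuity1[OF _ real_dist_normal_dist this, of "\<sigma> * t"]
    have "(\<lambda>n. char (distr M borel (\<lambda>w. (\<Sum>i<n. X i w) / sqrt (real n * \<sigma>\<^sup>2))) (\<sigma> * t)) \<longlonglongrightarrow>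
        exp (- (\<sigma> * t)\<^sup>2 / 2)"
      by (simp add: char_std_normal_distribution real_distribution_distr)
    moreover have "char (distr M borel (\<lambda>w. (\<Sum>i<n. X i w) / sqrt (real n * \<sigma>\<^sup>2))) (\<sigma> * t) =
        char \<nu> (1 / sqrt (real n) * t) ^ n" for n
    proof -
      have "char (distr M borel (\<lambda>w. (\<Sum>i<n. X i w) / sqrt (real n * \<sigma>\<^sup>2))) (\<sigma> * t) =
          char \<nu> (1 / sqrt (real n * \<sigma>\<^sup>2) * (\<sigma> * t)) ^ n"
        using char_scaled_sum[OF indep_vars_subset[OF ind] law, of n "1 / sqrt (real n * \<sigma>\<^sup>2)"] by simp
      also have "1 / sqrt (real n * \<sigma>\<^sup>2) * (\<sigma> * t) = 1 / sqrt (real n) * t"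
        using \<sigma>(1) by (simp add: real_sqrt_mult)
      finally show ?thesis .
    qed
    ultimately show ?thesis using \<sigma>(2) by (simp add: power_mult_distrib)
  qed
qed

text \<open>The second moment is bounded rather than computed on account of \<open>n = 0\<close>,
  where the quotient is 0 by convention.\<close>

lemma scaled_sum_L2:
  fixes X :: "nat \<Rightarrow> 'a \<Rightarrow> real"
  assumes ind: "indep_vars (\<lambda>_. borel) X UNIV" and law: "\<And>i. distr M borel (X i) = \<nu>"
    and sq: "integrable \<nu> (\<lambda>x. x\<^sup>2)" and mean: "(\<integral>x. x \<partial>\<nu>) = 0"
  shows "integrable M (\<lambda>w. ((\<Sum>i<n. X i w) / sqrt (real n))\<^sup>2)"
    and "expectation (\<lambda>w. ((\<Sum>i<n. X i w) / sqrt (real n))\<^sup>2) \<le> (\<integral>x. x\<^sup>2 \<partial>\<nu>)"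
proof -
  note * = indep_vars_subset[OF ind, of "{..<n}"]
  have **: "integrable M (\<lambda>w. (\<Sum>i<n. X i w)\<^sup>2)" "expectation (\<lambda>w. (\<Sum>i<n. X i w)\<^sup>2) = n * (\<integral>x. x\<^sup>2 \<partial>\<nu>)"
    using iid_sum_square_integrable[OF * law, of "\<lambda>x. x"] iid_sum_mean_square[OF * law, of "\<lambda>x. x"] sq mean by auto
  show "integrable M (\<lambda>w. ((\<Sum>i<n. X i w) / sqrt (real n))\<^sup>2)" using ** by (simp add: power_divide)
  show "expectation (\<lambda>w. ((\<Sum>i<n. X i w) / sqrt (real n))\<^sup>2) \<le> (\<integral>x. x\<^sup>2 \<partial>\<nu>)"
    using ** by (cases "n = 0") (simp_all add: power_divide)
qed

lemma converges_in_prob_deterministic_mult: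
  assumes [measurable]: "\<And>n. W n \<in> borel_measurable M" and i: "\<And>n. integrable M (\<lambda>w. (W n w)\<^sup>2)"
    and b: "\<And>n. expectation (\<lambda>w. (W n w)\<^sup>2) \<le> B" and a: "a \<longlonglongrightarrow> (0::real)"
  shows "converges_in_prob M (\<lambda>n w. a n * W n w) 0"
proof (rule converges_in_prob_L2)
  show "integrable M (\<lambda>w. (a n * W n w)\<^sup>2)" for n using i by (simp add: power_mult_distrib)
  show "(\<lambda>n. expectation (\<lambda>w. (a n * W n w)\<^sup>2)) \<longlonglongrightarrow> 0"
  proof (rule tendsto_sandwich[where f="\<lambda>_. 0"])
    have "(\<lambda>n. (a n)\<^sup>2 * B) \<longlonglongrightarrow> 0\<^sup>2 * B" by (intro tendsto_intros a)
    then show "(\<lambda>n. (a n)\<^sup>2 * B) \<longlonglongrightarrow> 0" by simp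
    show "\<forall>\<^sub>F n in sequentially. expectation (\<lambda>w. (a n * W n w)\<^sup>2) \<le> (a n)\<^sup>2 * B"
      using b by (simp add: power_mult_distrib mult_left_mono)
  qed (auto intro!: always_eventually)
qed measurable

text \<open>Independence of the labeled and the unlabeled sample makes the characteristic function of the
  leading term a product of two powers, each with a Gaussian limit.\<close>

lemma prediction_powered_clt:
  fixes W :: "nat + nat \<Rightarrow> 'a \<Rightarrow> real \<times> real" and N :: "nat \<Rightarrow> nat" and \<nu>L :: "(real \<times> real) measure"
  defines "A \<equiv> \<lambda>n w. (\<Sum>i<n. fst (W (Inl i) w)) / sqrt (real n)"
    and "A' \<equiv> \<lambda>n w. (\<Sum>i<n. snd (W (Inl i) w)) / sqrt (real n)"
    and "B \<equiv> \<lambda>n w. (\<Sum>j<n. snd (W (Inr j) w)) / sqrt (real n)"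
    and "\<kappa> \<equiv> \<lambda>n. real (N n) / real (n + N n)"
    and "\<beta> \<equiv> \<lambda>n. sqrt (real n) * sqrt (real (N n)) / real (n + N n)"
    and "v11 \<equiv> (\<integral>x. (fst x)\<^sup>2 \<partial>\<nu>L)" and "v12 \<equiv> (\<integral>x. fst x * snd x \<partial>\<nu>L)" and "v22 \<equiv> (\<integral>x. (snd x)\<^sup>2 \<partial>\<nu>L)"
  assumes ind: "indep_vars (\<lambda>_. borel) W UNIV"
    and lawL: "\<And>i. distr M borel (W (Inl i)) = \<nu>L"
    and lawU: "\<And>j. distr M borel (\<lambda>w. snd (W (Inr j) w)) = distr \<nu>L borel snd"
    and sq: "integrable \<nu>L (\<lambda>x. (fst x)\<^sup>2)" "integrable \<nu>L (\<lambda>x. (snd x)\<^sup>2)"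
    and mean: "(\<integral>x. fst x \<partial>\<nu>L) = 0" "(\<integral>x. snd x \<partial>\<nu>L) = 0"
    and v22: "v22 \<noteq> 0"
    and N: "\<And>n. 0 < N n" and ratio: "(\<lambda>n. real n / real (N n)) \<longlonglongrightarrow> \<rho>"
    and \<omega>: "converges_in_prob M \<omega> (v12 / v22)"
    and E: "converges_in_prob M E 0" and E': "converges_in_prob M E' 0"
  shows "weak_conv_m (\<lambda>n. distr M borel (\<lambda>w. A n w + E n w +
      \<omega> n w * (- \<kappa> n * A' n w + \<beta> n * B (N n) w + E' n w)))
    (normal_law 0 (v11 - v12\<^sup>2 / ((1 + \<rho>) * v22)))"
proof -
  have Wm[measurable]: "W s \<in> borel_measurable M" for s
    using ind by (auto simp: indep_vars_def2)
  have [measurable]: "A n \<in> borel_measurable M" "A' n \<in> borel_measurable M" "B n \<in> borel_measurable M" for n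
    unfolding A_def A'_def B_def by measurable
  have [measurable]: "E n \<in> borel_measurable M" "E' n \<in> borel_measurable M" "\<omega> n \<in> borel_measurable M" for n
    using E E' \<omega> by (auto dest: converges_in_prob_measurable)
  have sets[simp, measurable_cong]: "sets \<nu>L = sets borel" unfolding lawL[of 0, symmetric] by simp
  have fm: "fst \<in> borel_measurable \<nu>L" and sm: "snd \<in> borel_measurable \<nu>L" by measurable
  have v12: "integrable \<nu>L (\<lambda>x. fst x * snd x)" by (rule integrable_mult_square[OF fm sm sq])
  interpret L: prob_space \<nu>L unfolding lawL[of 0, symmetric] by (rule prob_space_distr) simp
  note m1 = L.square_integrable_imp_integrable[OF fm sq(1)] L.square_integrable_imp_integrable[OF sm sq(2)]
  note lims = tendsto_div_add_1[OF N ratio]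
  \<comment> \<open>\<open>c\<close> is the limit of the tuning weight \<open>\<omega>\<close>;
    \<open>k\<close> and \<open>b\<close> are the limits of the labeled and the unlabeled
    weight.\<close>
  define c where "c = v12 / v22"
  define k where "k = 1 / (1 + \<rho>)"
  define b where "b = sqrt \<rho> / (1 + \<rho>)"
  have \<kappa>k: "\<kappa> \<longlonglongrightarrow> k" and \<beta>b: "\<beta> \<longlonglongrightarrow> b" unfolding \<kappa>_def \<beta>_def k_def b_def by (rule lims)+
  \<comment> \<open>A labeled observation acts twice: through the outcome-based estimator and, with
    limiting weight \<open>- c * k\<close>, through the correction.\<close>
  define g where "g x = fst x - c * k * snd x" for x :: "real \<times> real"
  have g[measurable]: "g \<in> borel_measurable borel" unfolding g_def[abs_def] by measurable
  define \<nu>g where "\<nu>g = distr \<nu>L borel g"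
  define \<nu>s where "\<nu>s = distr \<nu>L borel (snd :: real \<times> real \<Rightarrow> real)"
  have gs: "(\<lambda>x. (g x)\<^sup>2) = (\<lambda>x. (fst x)\<^sup>2 - 2 * c * k * (fst x * snd x) + (c * k)\<^sup>2 * (snd x)\<^sup>2)"
    by (simp add: g_def[abs_def] power2_diff fun_eq_iff power_mult_distrib)
  have g_sq: "integrable \<nu>g (\<lambda>x. x\<^sup>2)" "(\<integral>x. x\<^sup>2 \<partial>\<nu>g) = v11 - 2 * c * k * v12 + (c * k)\<^sup>2 * v22" "(\<integral>x. x \<partial>\<nu>g) = 0"
    unfolding \<nu>g_def using sq v12 m1 mean
    by (simp_all add: integrable_distr_eq integral_distr gs v11_def v12_def v22_def)
      (simp add: g_def)
  have s_sq: "integrable \<nu>s (\<lambda>x. x\<^sup>2)" "(\<integral>x. x\<^sup>2 \<partial>\<nu>s) = v22" "(\<integral>x. x \<partial>\<nu>s) = 0"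
    unfolding \<nu>s_def using sq mean by (simp_all add: integrable_distr_eq integral_distr v22_def)
  have indI: "indep_vars (\<lambda>_. borel) (\<lambda>i w. h (W (q i) w)) UNIV"
    if [measurable]: "h \<in> borel_measurable borel" and "inj q" for h :: "real \<times> real \<Rightarrow> real" and q :: "nat \<Rightarrow> nat + nat"
  proof -
    have "indep_vars (\<lambda>_. borel) (\<lambda>i. W (q i)) UNIV"
      using indep_vars_reindex[OF \<open>inj q\<close> indep_vars_subset[OF ind]] by simp
    then show ?thesis by (rule indep_vars_compose2) simp
  qed
  have lawh: "distr M borel (\<lambda>w. h (W (Inl i) w)) = distr \<nu>L borel h"
    if [measurable]: "h \<in> borel_measurable borel" for h :: "real \<times> real \<Rightarrow> real" and i
    unfolding lawL[of i, symmetric] by (subst distr_distr) (auto simp: comp_def)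
  note indg = indI[OF g, of Inl, OF inj_Inl] and indA = indI[OF measurable_snd_borel, of Inl, OF inj_Inl]
    and indB = indI[OF measurable_snd_borel, of Inr, OF inj_Inr]
  note lawg = lawh[OF g, folded \<nu>g_def] and lawA = lawh[OF measurable_snd_borel, folded \<nu>s_def]
    and lawB = lawU[folded \<nu>s_def]
  have A'_L2: "integrable M (\<lambda>w. (A' n w)\<^sup>2)" "expectation (\<lambda>w. (A' n w)\<^sup>2) \<le> v22" for n
    using scaled_sum_L2[OF indA lawA s_sq(1,3), of n] unfolding A'_def s_sq(2) .
  have B_L2: "integrable M (\<lambda>w. (B n w)\<^sup>2)" "expectation (\<lambda>w. (B n w)\<^sup>2) \<le> v22" for n
    using scaled_sum_L2[OF indB lawB s_sq(1,3), of n] unfolding B_def s_sq(2) .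

  \<comment> \<open>Random and \<open>n\<close>-dependent coefficients are replaced by their limits
    here; the error of doing so is collected in \<open>Z\<close> below.\<close>
  define Main where "Main n w = (\<Sum>i<n. g (W (Inl i) w)) / sqrt (real n) + c * b * B (N n) w" for n w
  have [measurable]: "Main n \<in> borel_measurable M" for n unfolding Main_def[abs_def] by measurable
  have Main_eq: "Main n w = A n w - c * k * A' n w + c * b * B (N n) w" for n w
    by (simp add: Main_def g_def A_def A'_def sum_subtractf diff_divide_distrib sum_distrib_left[symmetric])

  have char_Main: "char (distr M borel (Main n)) t =
      char \<nu>g (1 / sqrt (real n) * t) ^ n * char \<nu>s (1 / sqrt (real (N n)) * (c * b * t)) ^ N n" for n t
  proof -
    \<comment> \<open>Labeled and unlabeled summands, each with its own normalisation, form one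
      finite independent family, so that a single product formula factors the characteristic
      function.\<close>
    define X where "X s w = (case s of Inl _ \<Rightarrow> g (W s w) / sqrt (real n) | Inr _ \<Rightarrow> c * b * snd (W s w) / sqrt (real (N n)))" for s :: "nat + nat" and w
    let ?I = "Inl ` {..<n} \<union> Inr ` {..<N n} :: (nat + nat) set"
    have iX: "indep_vars (\<lambda>_. borel) X ?I"
    proof -
      have "indep_vars (\<lambda>_. borel) (\<lambda>s w. (case s of Inl _ \<Rightarrow> \<lambda>x. g x / sqrt (real n) | Inr _ \<Rightarrow> \<lambda>x. c * b * snd x / sqrt (real (N n))) (W s w)) ?I"
        by (rule indep_vars_compose2[OF indep_vars_subset[OF ind]]) (auto split: sum.split)
      also have "(\<lambda>s w. (case s of Inl _ \<Rightarrow> \<lambda>x. g x / sqrt (real n) | Inr _ \<Rightarrow> \<lambda>x. c * b * snd x / sqrt (real (N n))) (W s w)) = X"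
        by (auto simp: X_def fun_eq_iff split: sum.split)
      finally show ?thesis .
    qed
    have sums: "(\<Sum>s\<in>?I. F s) = (\<Sum>i<n. F (Inl i)) + (\<Sum>j<N n. F (Inr j))" for F :: "nat + nat \<Rightarrow> real"
      by (subst sum.union_disjoint) (auto simp: sum.reindex)
    have prods: "(\<Prod>s\<in>?I. F s) = (\<Prod>i<n. F (Inl i)) * (\<Prod>j<N n. F (Inr j))" for F :: "nat + nat \<Rightarrow> complex"
      by (subst prod.union_disjoint) (auto simp: prod.reindex)
    have "Main n = (\<lambda>w. \<Sum>s\<in>?I. X s w)"
      by (rule ext) (simp only: sums, simp add: X_def Main_def B_def sum_divide_distrib sum_distrib_left)
    then have "char (distr M borel (Main n)) t = (\<Prod>s\<in>?I. char (distr M borel (X s)) t)"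
      using char_distr_sum[OF iX, of t] by simp
    also note prods
    finally have "char (distr M borel (Main n)) t =
      (\<Prod>i<n. char (distr M borel (X (Inl i))) t) * (\<Prod>j<N n. char (distr M borel (X (Inr j))) t)" .
    moreover have "char (distr M borel (X (Inl i))) t = char \<nu>g (1 / sqrt (real n) * t)" for i
      unfolding lawg[of i, symmetric] X_def by (simp add: char_def integral_distr)
    moreover have "char (distr M borel (X (Inr j))) t = char \<nu>s (1 / sqrt (real (N n)) * (c * b * t))" for j
      unfolding lawB[of j, symmetric] X_def by (simp add: char_def integral_distr mult_ac)
    ultimately show ?thesis by simp
  qed
  define V where "V = v11 - v12\<^sup>2 / ((1 + \<rho>) * v22)"
  \<comment> \<open>With \<open>b\<^sup>2 = \<rho> * k\<^sup>2\<close> the quadratic terms add up to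
    \<open>c\<^sup>2 * k\<^sup>2 * v22 * (1 + \<rho>)\<close>; as \<open>c * v22 = v12\<close> and
    \<open>k * (1 + \<rho>) = 1\<close>, they cancel half of the cross term
    \<open>2 * c * k * v12\<close>.\<close>
  have V_eq: "V = (\<integral>x. x\<^sup>2 \<partial>\<nu>g) + v22 * (c * b)\<^sup>2"
  proof -
    have r: "1 + \<rho> \<noteq> 0" "0 \<le> \<rho>" using lims(1) by auto
    have b2: "b\<^sup>2 = \<rho> * k\<^sup>2" using r by (simp add: b_def k_def power_divide)
    have k1: "(1 + \<rho>) * k = 1" using r by (simp add: k_def)
    have cv: "c * v22 = v12" using v22 by (simp add: c_def)
    have "(\<integral>x. x\<^sup>2 \<partial>\<nu>g) + v22 * (c * b)\<^sup>2 = v11 - 2 * c * k * v12 + c * k * (c * v22) * (k * (1 + \<rho>))"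
      unfolding g_sq(2) power_mult_distrib b2 by (simp add: power2_eq_square algebra_simps)
    also have "\<dots> = v11 - c * k * v12" unfolding cv using k1 by (simp add: mult.commute)
    also have "c * k * v12 = v12\<^sup>2 / ((1 + \<rho>) * v22)" by (simp add: c_def k_def power2_eq_square)
    finally show ?thesis unfolding V_def by simp
  qed
  \<comment> \<open>Needed for the square root in \<open>normal_law\<close>; visible from the form
    of \<open>V\<close> as a sum of two variances.\<close>
  have V0: "0 \<le> V" unfolding V_eq v22_def by simp
  have Main_lim: "(\<lambda>n. char (distr M borel (Main n)) t) \<longlonglongrightarrow> char (normal_law 0 V) t" for t
  proof -
    have 1: "(\<lambda>n. char \<nu>g (1 / sqrt (real n) * t) ^ n) \<longlonglongrightarrow> exp (- ((\<integral>x. x\<^sup>2 \<partial>\<nu>g) * t\<^sup>2) / 2)"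
      by (rule char_power_tendsto[OF indg lawg g_sq(1,3)])
    \<comment> \<open>\<open>\<nu>s\<close> is also the law of the labeled second coordinates, so
      their limit theorem applies; it is composed with \<open>N\<close>, which tends to
      infinity.\<close>
    have 2: "(\<lambda>n. char \<nu>s (1 / sqrt (real (N n)) * (c * b * t)) ^ N n) \<longlonglongrightarrow> exp (- (v22 * (c * b * t)\<^sup>2) / 2)"
      using filterlim_compose[OF char_power_tendsto[OF indA lawA s_sq(1,3), of "c * b * t"] lims(2)]
      by (simp add: s_sq(2))
    have "char (normal_law 0 V) t = complex_of_real (exp (- ((\<integral>x. x\<^sup>2 \<partial>\<nu>g) * t\<^sup>2) / 2)) * complex_of_real (exp (- (v22 * (c * b * t)\<^sup>2) / 2))"
    proof -
      have "- (V * t\<^sup>2) / 2 = - ((\<integral>x. x\<^sup>2 \<partial>\<nu>g) * t\<^sup>2) / 2 + - (v22 * (c * b * t)\<^sup>2) / 2"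
        unfolding V_eq by (simp add: power_mult_distrib field_simps)
      then show ?thesis by (simp only: char_normal_law[OF V0] exp_add of_real_mult)
    qed
    then show ?thesis unfolding char_Main using tendsto_mult[OF 1 2] by simp
  qed

  define D where "D n w = - \<kappa> n * A' n w + \<beta> n * B (N n) w" for n w
  have [measurable]: "D n \<in> borel_measurable M" for n unfolding D_def[abs_def] by measurable
  have \<omega>0: "converges_in_prob M (\<lambda>n w. \<omega> n w - c) 0"
    using \<omega> unfolding converges_in_prob_def c_def by simp
  have D_bounded: "\<exists>K>0. \<forall>\<^sub>F n in sequentially. \<P>(w in M. \<bar>D n w\<bar> > K) \<le> \<eta>" if \<eta>: "\<eta> > 0" for \<eta>
  proof (rule L2_bounded_in_prob[OF _ _ _ \<eta>])
    have sum2: "(x + y)\<^sup>2 \<le> 2 * x\<^sup>2 + 2 * y\<^sup>2" for x y :: real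
      using sum_squares_bound[of x y] by (simp add: power2_sum)
    have i: "integrable M (\<lambda>w. 2 * (- \<kappa> n * A' n w)\<^sup>2 + 2 * (\<beta> n * B (N n) w)\<^sup>2)" for n
      using A'_L2(1) B_L2(1) by (simp add: power_mult_distrib)
    show iD: "integrable M (\<lambda>w. (D n w)\<^sup>2)" for n
    proof (rule Bochner_Integration.integrable_bound[OF i[of n]])
      show "AE w in M. norm ((D n w)\<^sup>2) \<le> norm (2 * (- \<kappa> n * A' n w)\<^sup>2 + 2 * (\<beta> n * B (N n) w)\<^sup>2)"
        using sum2[of "- \<kappa> n * A' n _" "\<beta> n * B (N n) _"]
        by (intro AE_I2) (simp only: D_def real_norm_def abs_of_nonneg zero_le_power2 add_nonneg_nonneg mult_nonneg_nonneg zero_le_numeral)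
    qed measurable
    have "\<forall>\<^sub>F n in sequentially. (\<kappa> n)\<^sup>2 < k\<^sup>2 + 1" "\<forall>\<^sub>F n in sequentially. (\<beta> n)\<^sup>2 < b\<^sup>2 + 1"
      by (rule order_tendstoD(2)[OF tendsto_power[OF \<kappa>k, of 2]] order_tendstoD(2)[OF tendsto_power[OF \<beta>b, of 2]], simp)+
    then show "\<forall>\<^sub>F n in sequentially. expectation (\<lambda>w. (D n w)\<^sup>2) \<le> 2 * ((k\<^sup>2 + 1) * v22) + 2 * ((b\<^sup>2 + 1) * v22)"
    proof eventually_elim
      case (elim n)
      have "expectation (\<lambda>w. (D n w)\<^sup>2) \<le> expectation (\<lambda>w. 2 * (- \<kappa> n * A' n w)\<^sup>2 + 2 * (\<beta> n * B (N n) w)\<^sup>2)"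
        by (rule integral_mono[OF iD i]) (simp only: D_def sum2)
      also have "\<dots> = 2 * ((\<kappa> n)\<^sup>2 * expectation (\<lambda>w. (A' n w)\<^sup>2)) + 2 * ((\<beta> n)\<^sup>2 * expectation (\<lambda>w. (B (N n) w)\<^sup>2))"
        using A'_L2(1) B_L2(1) by (simp add: power_mult_distrib)
      also have "\<dots> \<le> 2 * ((k\<^sup>2 + 1) * v22) + 2 * ((b\<^sup>2 + 1) * v22)"
        using elim A'_L2(2) B_L2(2) by (intro add_mono mult_left_mono mult_mono) auto
      finally show ?case .
    qed
  qed measurable
  have E'_bounded: "\<exists>K>0. \<forall>\<^sub>F n in sequentially. \<P>(w in M. \<bar>E' n w\<bar> > K) \<le> \<eta>" if \<eta>: "\<eta> > 0" for \<eta>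
  proof (intro exI[of _ 1] conjI)
    show "\<forall>\<^sub>F n in sequentially. \<P>(w in M. \<bar>E' n w\<bar> > 1) \<le> \<eta>"
      using order_tendstoD(2)[OF converges_in_probD[OF E', of 1] \<eta>] by (auto elim: eventually_mono)
  qed simp
  \<comment> \<open>From \<open>\<omega> * (D + E') = (\<omega> - c) * D + (\<omega> - c) * E' + c *
    E' + c * D\<close>, with the limiting weights subtracted in \<open>c * D\<close>. Each summand
    vanishes by assumption or pairs a vanishing factor with one bounded in probability.\<close>
  define Z where "Z n w = E n w + ((\<omega> n w - c) * D n w + ((\<omega> n w - c) * E' n w + (c * E' n w +
     ((c * (k - \<kappa> n)) * A' n w + (c * (\<beta> n - b)) * B (N n) w))))" for n w
  have Z: "converges_in_prob M Z 0"
    unfolding Z_def[abs_def]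
  proof (intro converges_in_prob_add converges_in_prob_cmult E E')
    show "converges_in_prob M (\<lambda>n w. (\<omega> n w - c) * D n w) 0"
      by (rule converges_in_prob_mult[OF \<omega>0 _ D_bounded]) measurable
    show "converges_in_prob M (\<lambda>n w. (\<omega> n w - c) * E' n w) 0"
      by (rule converges_in_prob_mult[OF \<omega>0 _ E'_bounded]) measurable
    have "(\<lambda>n. c * (k - \<kappa> n)) \<longlonglongrightarrow> c * (k - k)" by (intro tendsto_intros \<kappa>k)
    then show "converges_in_prob M (\<lambda>n w. (c * (k - \<kappa> n)) * A' n w) 0"
      by (intro converges_in_prob_deterministic_mult[OF _ A'_L2]) auto
    have "(\<lambda>n. c * (\<beta> n - b)) \<longlonglongrightarrow> c * (b - b)" by (intro tendsto_intros \<beta>b)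
    then show "converges_in_prob M (\<lambda>n w. (c * (\<beta> n - b)) * B (N n) w) 0"
      by (intro converges_in_prob_deterministic_mult[OF _ B_L2]) auto
  qed
  have eq: "(\<lambda>w. A n w + E n w + \<omega> n w * (- \<kappa> n * A' n w + \<beta> n * B (N n) w + E' n w)) = (\<lambda>w. Main n w + Z n w)" for n
    by (rule ext) (simp add: Main_eq Z_def D_def algebra_simps)
  have "weak_conv_m (\<lambda>n. distr M borel (\<lambda>w. Main n w + Z n w)) (normal_law 0 V)"
  proof (rule levy_continuity)
    have [measurable]: "Z n \<in> borel_measurable M" for n using Z by (rule converges_in_prob_measurable)
    show "real_distribution (distr M borel (\<lambda>w. Main n w + Z n w))" for n
      by (intro real_distribution_distr) measurable
    show "real_distribution (normal_law 0 V)" by (rule real_distribution_normal_law[OF V0])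
    show "(\<lambda>n. char (distr M borel (\<lambda>w. Main n w + Z n w)) t) \<longlonglongrightarrow> char (normal_law 0 V) t" for t
      using tendsto_add[OF char_diff_tendsto_0[OF Z, of Main t] Main_lim[of t]] by simp
  qed
  then show ?thesis unfolding eq V_def .
qed

end

section \<open>The prediction-powered estimator\<close>

text \<open>Measurability of the samples is contained in \<open>indep_sets\<close>, which makes
  every generated event an event of \<open>M\<close>; this recovers it.\<close>

lemma measurable_of_generated_events:
  assumes "generated_events M Z \<subseteq> sets M"
  shows "Z \<in> borel_measurable M"
proof (rule measurableI)
  show "Z -` A \<inter> space M \<in> sets M" if "A \<in> sets borel" for A
    using assms that by (auto simp: generated_events_def)
qed simp

lemma (in prob_space) expectation_of_bool:
  "expectation (\<lambda>w. of_bool (P w)) = \<P>(w in M. P w)"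
proof -
  have "expectation (\<lambda>w. of_bool (P w)) = expectation (indicator {w \<in> space M. P w})"
    by (intro Bochner_Integration.integral_cong) (auto simp: indicator_def)
  also have "\<dots> = prob ({w \<in> space M. P w} \<inter> space M)" by simp
  also have "{w \<in> space M. P w} \<inter> space M = {w \<in> space M. P w}" by blast
  finally show ?thesis .
qed

text \<open>A binary outcome is its own indicator, so the weighted integrals are joint probabilities
  and their quotients conditional ones.\<close>

lemma (in prob_space) auc_true_eq_target:
  assumes Y: "\<And>w. w \<in> space M \<Longrightarrow> Y w \<in> {0, 1 :: real}"
  shows "auc_true M R Y = auc_target M R Y"
proof -
  have Y': "Y w = of_bool (Y w = 1)" "1 - Y w = of_bool (Y w = 0)" if "w \<in> space M" for w
    using Y[OF that] by auto
  have 1: "(\<integral>w. of_bool (Q w) * Y w \<partial>M) = \<P>(w in M. Q w \<and> Y w = 1)" for Q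
    unfolding expectation_of_bool[symmetric]
    by (intro Bochner_Integration.integral_cong refl) (subst Y'(1), auto)
  have 2: "(\<integral>w. of_bool (Q w) * (1 - Y w) \<partial>M) = \<P>(w in M. Q w \<and> Y w = 0)" for Q
    unfolding expectation_of_bool[symmetric]
    by (intro Bochner_Integration.integral_cong refl) (subst Y'(2), auto)
  have "(\<integral>w. Y w \<partial>M) = \<P>(w in M. Y w = 1)" "(\<integral>w. 1 - Y w \<partial>M) = \<P>(w in M. Y w = 0)"
    using 1[of "\<lambda>_. True"] 2[of "\<lambda>_. True"] by simp_all
  then show ?thesis unfolding auc_true_def auc_target_def cond_prob_def 1 2 by simp
qed

text \<open>Pooled minus labeled mean is \<open>N / (n + N)\<close> times unlabeled minus labeled
  mean. Here \<open>h\<close> and \<open>u\<close> are the two sums, and each gets normalised by the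
  root of its own sample size.\<close>

lemma pooled_mean_difference:
  fixes h u n N :: real
  assumes "0 \<le> n" "0 < N" "n = 0 \<Longrightarrow> h = 0"
  shows "sqrt n * ((h + u) / (n + N)) - sqrt n * (h / n) =
    - (N / (n + N)) * (h / sqrt n) + sqrt n * sqrt N / (n + N) * (u / sqrt N)"
proof (cases "n = 0")
  case False
  define a where "a = sqrt n"
  have n: "n = a * a" "a > 0" using assms False by (auto simp: a_def)
  have N: "sqrt N > 0" using assms by simp
  have s: "a * a + N > 0" using assms(2) n by (simp add: add_pos_pos)
  have "a * ((h + u) / (a * a + N)) - a * (h / (a * a)) = - (N / (a * a + N)) * (h / a) + a * u / (a * a + N)"
  proof -
    let ?S = "a * a + N"
    have "h / a = (a * a + N) / ?S * (h / a)" using s by simp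
    also have "\<dots> = a * a / ?S * (h / a) + N / ?S * (h / a)"
      by (simp only: add_divide_distrib[of "a * a" N] distrib_right)
    also have "a * a / ?S * (h / a) = a * h / ?S" using n(2) by simp
    finally have "h / a = a * h / ?S + N / ?S * (h / a)" .
    moreover have "a * (h / (a * a)) = h / a" using n(2) by simp
    moreover have "a * ((h + u) / ?S) = a * h / ?S + a * u / ?S"
      by (simp only: distrib_left add_divide_distrib times_divide_eq_right)
    moreover have "- (N / ?S) * (h / a) = - (N / ?S * (h / a))" by (rule mult_minus_left)
    ultimately show ?thesis by linarith
  qed
  then show ?thesis using N n(2) unfolding a_def[symmetric] unfolding n(1) by simp
qed (use assms in simp)

lemma sum_lessThan_add: "(\<Sum>i<n + N. F i) = (\<Sum>i<n. F i) + (\<Sum>j<N. F (n + j))" for F :: "nat \<Rightarrow> real"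
  by (induction N) (simp_all add: add.assoc)

theorem corollary5p1p3:
  fixes M :: "'a measure"
    and f :: "real ^ 'd \<Rightarrow> real" and k :: 'd
    and X :: "'a \<Rightarrow> real ^ 'd" and R Y :: "'a \<Rightarrow> real"
    and XL :: "nat \<Rightarrow> 'a \<Rightarrow> real ^ 'd" and RL YL :: "nat \<Rightarrow> 'a \<Rightarrow> real"
    and XU :: "nat \<Rightarrow> 'a \<Rightarrow> real ^ 'd" and RU :: "nat \<Rightarrow> 'a \<Rightarrow> real"
  assumes "prob_space M"
    and "X \<in> borel_measurable M" and "Y \<in> borel_measurable M" and "f \<in> borel_measurable borel"
    and "R = (\<lambda>w. X w $ k)"
    and "RL = (\<lambda>i w. XL i w $ k)"
    and "RU = (\<lambda>j w. XU j w $ k)"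
    and "\<And>w. w \<in> space M \<Longrightarrow> Y w \<in> {0, 1}"
    and "0 < \<P>(w in M. Y w = 1)" and "0 < \<P>(w in M. Y w = 0)"
    and "AE w in M. 0 \<le> f (X w)"
    and "(\<integral>w. f (X w) \<partial>M) * (1 - (\<integral>w. f (X w) \<partial>M)) \<noteq> 0"
    and "integrable M (\<lambda>w. (f (X w))\<^sup>2)"
    and "auc_no_common_jump M R Y"
    and "auc_no_common_jump M R (\<lambda>w. f (X w))"
    and "prob_space.indep_sets M
           (case_sum (\<lambda>i. generated_events M (\<lambda>w. (RL i w, f (XL i w), YL i w)))
                     (\<lambda>j. generated_events M (\<lambda>w. (RU j w, f (XU j w)))))
           (UNIV :: (nat + nat) set)"
    and "\<And>i. distr M borel (\<lambda>w. (RL i w, f (XL i w), YL i w)) =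
             distr M borel (\<lambda>w. (R w, f (X w), Y w))"
    and "\<And>j. distr M borel (\<lambda>w. (RU j w, f (XU j w))) = distr M borel (\<lambda>w. (R w, f (X w)))"
  shows "let
       \<theta>0 = auc_true M R Y;
       \<theta>_f = auc_target M R (\<lambda>w. f (X w));
       est = (\<lambda>n w. auc_estimate n (\<lambda>i. RL i w) (\<lambda>i. YL i w));
       est_f = (\<lambda>n w. auc_estimate n (\<lambda>i. RL i w) (\<lambda>i. f (XL i w)));
       est_f_pooled = (\<lambda>n N w. auc_estimate (n + N)
          (pooled n (\<lambda>i. RL i w) (\<lambda>j. RU j w)) (pooled n (\<lambda>i. f (XL i w)) (\<lambda>j. f (XU j w))));
       \<phi> = (\<lambda>w. auc_influence M R Y (R w, Y w));
       \<phi>_f = (\<lambda>w. auc_influence M R (\<lambda>w. f (X w)) (R w, f (X w)))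
     in
       is_influence_function M (\<lambda>i w. (RL i w, YL i w)) est \<theta>0 (auc_influence M R Y) \<and>
       (\<forall>\<psi>. is_influence_function M (\<lambda>i w. (RL i w, YL i w)) est \<theta>0 \<psi> \<longrightarrow>
          (AE w in M. \<psi> (R w, Y w) = \<phi> w)) \<and>
       is_influence_function M (\<lambda>i w. (RL i w, f (XL i w))) est_f \<theta>_f
          (auc_influence M R (\<lambda>w. f (X w))) \<and>
       (\<forall>\<psi>. is_influence_function M (\<lambda>i w. (RL i w, f (XL i w))) est_f \<theta>_f \<psi> \<longrightarrow>
          (AE w in M. \<psi> (R w, f (X w)) = \<phi>_f w)) \<and>
       (\<forall>(N :: nat \<Rightarrow> nat) (ratio :: real) (\<omega> :: nat \<Rightarrow> 'a \<Rightarrow> real).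
          (\<integral>w. (\<phi>_f w)\<^sup>2 \<partial>M) \<noteq> 0 \<longrightarrow>
          (\<forall>n. 0 < N n) \<longrightarrow>
          (\<lambda>n. real n / real (N n)) \<longlonglongrightarrow> ratio \<longrightarrow>
          converges_in_prob M \<omega> ((\<integral>w. \<phi> w * \<phi>_f w \<partial>M) / (\<integral>w. (\<phi>_f w)\<^sup>2 \<partial>M)) \<longrightarrow>
          weak_conv_m
            (\<lambda>n. distr M borel (\<lambda>w. sqrt (real n) *
               ((est n w + \<omega> n w * (est_f_pooled n (N n) w - est_f n w)) - \<theta>0)))
            (normal_law 0 ((\<integral>w. (\<phi> w)\<^sup>2 \<partial>M) -
               (\<integral>w. \<phi> w * \<phi>_f w \<partial>M)\<^sup>2 / ((1 + ratio) * (\<integral>w. (\<phi>_f w)\<^sup>2 \<partial>M)))))"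
proof -
  interpret prob_space M by fact
  define V where "V w = f (X w)" for w
  have V_eq: "V = (\<lambda>w. f (X w))" by (simp add: V_def[abs_def])
  note X = assms(2) and Ym = assms(3) and fm = assms(4) and R_def = assms(5) and Y01 = assms(8)
  note ind = assms(16) and lawL = assms(17) and lawU = assms(18)
  have coord: "(\<lambda>x :: real ^ 'd. x $ k) \<in> borel_measurable borel"
    by (intro borel_measurable_continuous_onI continuous_intros)
  have Rm[measurable]: "R \<in> borel_measurable M" unfolding R_def by (rule measurable_compose[OF X coord])
  have Vm[measurable]: "V \<in> borel_measurable M" unfolding V_def by (rule measurable_compose[OF X fm])
  note Ym[measurable]
  have EY: "expectation Y = \<P>(w in M. Y w = 1)" "1 - expectation Y = \<P>(w in M. Y w = 0)"
  proof -
    have "expectation Y = expectation (\<lambda>w. of_bool (Y w = 1))"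
      using Y01 by (intro Bochner_Integration.integral_cong) auto
    then show 1: "expectation Y = \<P>(w in M. Y w = 1)" by (simp add: expectation_of_bool)
    have "\<P>(w in M. Y w = 0) = \<P>(w in M. Y w \<noteq> 1)"
      using Y01 by (intro arg_cong[where f=prob]) auto
    then show "1 - expectation Y = \<P>(w in M. Y w = 0)"
      unfolding 1 by (subst prob_neg[symmetric]) auto
  qed
  interpret PY: auc_population M R Y
  proof
    show "integrable M (\<lambda>w. (Y w)\<^sup>2)"
      using Y01 by (intro integrable_const_bound[where B=1]) (auto intro!: AE_I2 dest!: Y01)
    show "AE w in M. 0 \<le> Y w" by (intro AE_I2) (auto dest!: Y01)
    show "expectation Y * (1 - expectation Y) \<noteq> 0" unfolding EY(2) unfolding EY(1) using assms(9,10) by simp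
  qed (rule Rm Ym assms(14))+
  interpret PF: auc_population M R V
    by (unfold_locales, unfold V_eq) (rule Rm Vm[unfolded V_eq] assms(11,12,13,15))+

  \<comment> \<open>One family needs one value type: unlabeled observations get the dummy outcome 0,
    a constant that generates no further events.\<close>
  define T where "T s w = (case s of Inl i \<Rightarrow> (RL i w, f (XL i w), YL i w) | Inr j \<Rightarrow> (RU j w, f (XU j w), 0))"
    for s :: "nat + nat" and w
  define qY where "qY t = (fst t, snd (snd t))" for t :: "real \<times> real \<times> real"
  define qF where "qF t = (fst t, fst (snd t))" for t :: "real \<times> real \<times> real"
  have qm[measurable]: "qY \<in> borel_measurable borel" "qF \<in> borel_measurable borel"
    unfolding qY_def[abs_def] qF_def[abs_def] by (intro borel_measurable_continuous_onI continuous_intros)+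
  have em[measurable]: "(\<lambda>x :: real \<times> real. (fst x, snd x, 0 :: real)) \<in> borel_measurable borel"
    by (intro borel_measurable_continuous_onI continuous_intros)
  have ev: "case_sum (\<lambda>i. generated_events M (\<lambda>w. (RL i w, f (XL i w), YL i w)))
      (\<lambda>j. generated_events M (\<lambda>w. (RU j w, f (XU j w)))) s \<subseteq> sets M" for s
    using ind unfolding indep_sets_def by blast
  have TL[measurable]: "(\<lambda>w. (RL i w, f (XL i w), YL i w)) \<in> borel_measurable M" for i
    using ev[of "Inl i"] by (intro measurable_of_generated_events) simp
  have TU[measurable]: "(\<lambda>w. (RU j w, f (XU j w))) \<in> borel_measurable M" for j
    using ev[of "Inr j"] by (intro measurable_of_generated_events) simp
  have TU0: "(\<lambda>w. (RU j w, f (XU j w), 0 :: real)) \<in> borel_measurable M" for j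
    using measurable_compose[OF TU em] by simp
  have indT: "indep_vars (\<lambda>_. borel) T UNIV"
    unfolding indep_vars_def2
  proof (intro conjI ballI)
    show "T s \<in> borel_measurable M" for s
      using TL TU0 by (cases s) (simp_all add: T_def[abs_def])
    show "indep_sets (\<lambda>s. {T s -` A \<inter> space M |A. A \<in> sets borel}) UNIV"
    proof (rule indep_sets_mono_sets[OF ind])
      fix s :: "nat + nat"
      show "{T s -` A \<inter> space M |A. A \<in> sets borel} \<subseteq>
        case_sum (\<lambda>i. generated_events M (\<lambda>w. (RL i w, f (XL i w), YL i w)))
          (\<lambda>j. generated_events M (\<lambda>w. (RU j w, f (XU j w)))) s"
      proof (cases s)
        case (Inl i)
        then show ?thesis by (auto simp: T_def[abs_def] generated_events_def)
      next
        case (Inr j)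
        have "\<exists>B. T s -` A \<inter> space M = (\<lambda>w. (RU j w, f (XU j w))) -` B \<inter> space M \<and> B \<in> sets borel"
          if "A \<in> sets borel" for A
        proof (intro exI conjI)
          show "(\<lambda>x :: real \<times> real. (fst x, snd x, 0 :: real)) -` A \<in> sets borel"
            using measurable_sets[OF em that] by simp
          show "T s -` A \<inter> space M = (\<lambda>w. (RU j w, f (XU j w))) -`
              ((\<lambda>x :: real \<times> real. (fst x, snd x, 0 :: real)) -` A) \<inter> space M"
            by (auto simp: T_def Inr)
        qed
        then show ?thesis using Inr by (auto simp: generated_events_def)
      qed
    qed
  qed
  have indq: "indep_vars (\<lambda>_. borel) (\<lambda>i w. h (T (q i) w)) UNIV"
    if [measurable]: "h \<in> borel_measurable borel" and "inj q"
    for h :: "real \<times> real \<times> real \<Rightarrow> real \<times> real" and q :: "nat \<Rightarrow> nat + nat"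
  proof -
    have "indep_vars (\<lambda>_. borel) (\<lambda>i. T (q i)) UNIV"
      using indep_vars_reindex[OF \<open>inj q\<close> indep_vars_subset[OF indT]] by simp
    then show ?thesis by (rule indep_vars_compose2) simp
  qed
  have RVY[measurable]: "(\<lambda>w. (R w, V w, Y w)) \<in> borel_measurable M" "(\<lambda>w. (R w, V w)) \<in> borel_measurable M"
    by (intro borel_measurable_Pair Rm Vm Ym)+
  have lawq: "distr M borel (\<lambda>w. h (T (Inl i) w)) = distr M borel (\<lambda>w. h (R w, V w, Y w))"
    if [measurable]: "h \<in> borel_measurable borel" for h :: "real \<times> real \<times> real \<Rightarrow> real \<times> real" and i
  proof -
    have "distr M borel (\<lambda>w. h (T (Inl i) w)) = distr (distr M borel (\<lambda>w. (RL i w, f (XL i w), YL i w))) borel h"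
      by (subst distr_distr) (auto simp: comp_def T_def)
    also have "\<dots> = distr (distr M borel (\<lambda>w. (R w, V w, Y w))) borel h"
      using lawL[of i] by (simp add: V_def)
    also have "\<dots> = distr M borel (\<lambda>w. h (R w, V w, Y w))"
      by (subst distr_distr) (auto simp: comp_def)
    finally show ?thesis .
  qed

  define ZY where "ZY i w = (RL i w, YL i w)" for i w
  define ZF where "ZF i w = (RL i w, f (XL i w))" for i w
  define P where "P n i w = (if i < n then (RL i w, f (XL i w)) else (RU (i - n) w, f (XU (i - n) w)))" for n i w
  \<comment> \<open>For each \<open>n\<close> an injection into \<open>nat + nat\<close> that lists
    the first \<open>n\<close> labeled observations and then the unlabeled ones; row
    \<open>n\<close> of the pooled array is a reindexing along it.\<close>
  define pick where "pick n i = (if i < n then Inl i else Inr (i - n))" for n i :: nat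
  have inj_pick: "inj (pick n)" for n
    by (rule injI) (auto simp: pick_def split: if_splits)
  have ZY_eq: "ZY = (\<lambda>i w. qY (T (Inl i) w))" and ZF_eq: "ZF = (\<lambda>i w. qF (T (Inl i) w))"
    and P_eq: "P n = (\<lambda>i w. qF (T (pick n i) w))" for n
    by (auto simp: fun_eq_iff ZY_def ZF_def P_def pick_def qY_def qF_def T_def)
  have indY: "indep_vars (\<lambda>_. borel) ZY UNIV" unfolding ZY_eq by (rule indq[OF qm(1) inj_Inl])
  have indF: "indep_vars (\<lambda>_. borel) ZF UNIV" unfolding ZF_eq by (rule indq[OF qm(2) inj_Inl])
  have indP: "indep_vars (\<lambda>_. borel) (P n) UNIV" for n unfolding P_eq by (rule indq[OF qm(2) inj_pick])
  have lawY: "distr M borel (ZY i) = PY.\<mu>" for i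
    unfolding ZY_eq lawq[OF qm(1)] PY.\<mu>_def by (simp add: qY_def)
  have lawF: "distr M borel (ZF i) = PF.\<mu>" for i
    unfolding ZF_eq lawq[OF qm(2)] PF.\<mu>_def by (simp add: qF_def)
  have lawU': "distr M borel (\<lambda>w. (RU j w, f (XU j w))) = PF.\<mu>" for j
    using lawU[of j] by (simp add: PF.\<mu>_def V_def)
  have lawP: "distr M borel (P n i) = PF.\<mu>" for n i
    using lawF[of i] lawU'[of "i - n"] by (cases "i < n") (simp_all add: P_def[abs_def] ZF_def[abs_def])

  define \<phi> where "\<phi> = auc_influence M R Y"
  define \<phi>f where "\<phi>f = auc_influence M R V"
  have \<phi>m[measurable]: "\<phi> \<in> borel_measurable borel" "\<phi>f \<in> borel_measurable borel"
    unfolding \<phi>_def \<phi>f_def by (rule PY.influence_measurable PF.influence_measurable)+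
  define est where "est n w = auc_estimate n (\<lambda>i. RL i w) (\<lambda>i. YL i w)" for n w
  define estf where "estf n w = auc_estimate n (\<lambda>i. RL i w) (\<lambda>i. f (XL i w))" for n w
  define estP where "estP n N w = auc_estimate (n + N)
    (pooled n (\<lambda>i. RL i w) (\<lambda>j. RU j w)) (pooled n (\<lambda>i. f (XL i w)) (\<lambda>j. f (XU j w)))" for n N w
  have est_eq: "est = (\<lambda>n w. auc_estimate n (\<lambda>i. fst (ZY i w)) (\<lambda>i. snd (ZY i w)))"
    and estf_eq: "estf = (\<lambda>n w. auc_estimate n (\<lambda>i. fst (ZF i w)) (\<lambda>i. snd (ZF i w)))"
    by (simp_all add: est_def[abs_def] estf_def[abs_def] ZY_def ZF_def)
  have estP_eq: "estP n N w = auc_estimate (n + N) (\<lambda>i. fst (P n i w)) (\<lambda>i. snd (P n i w))" for n N w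
    unfolding estP_def by (intro arg_cong2[where f="auc_estimate (n + N)"]) (auto simp: fun_eq_iff pooled_def P_def)
  define \<theta>0 where "\<theta>0 = auc_target M R Y"
  define \<theta>f where "\<theta>f = auc_target M R V"

  have infY: "is_influence_function M ZY est \<theta>0 \<phi>"
    unfolding est_eq \<theta>0_def \<phi>_def by (rule PY.is_influence_function_auc[OF indY lawY])
  have infF: "is_influence_function M ZF estf \<theta>f \<phi>f"
    unfolding estf_eq \<theta>f_def \<phi>f_def by (rule PF.is_influence_function_auc[OF indF lawF])
  have uniqY: "AE w in M. \<psi> (R w, Y w) = \<phi> (R w, Y w)" if "is_influence_function M ZY est \<theta>0 \<psi>" for \<psi>
    using influence_function_unique[OF indY lawY infY that] unfolding PY.\<mu>_def
    by (rule AE_distrD[rotated]) simp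
  have uniqF: "AE w in M. \<psi> (R w, V w) = \<phi>f (R w, V w)" if "is_influence_function M ZF estf \<theta>f \<psi>" for \<psi>
    using influence_function_unique[OF indF lawF infF that] unfolding PF.\<mu>_def
    by (rule AE_distrD[rotated]) simp

  have clt: "weak_conv_m (\<lambda>n. distr M borel (\<lambda>w. sqrt (real n) *
       ((est n w + \<omega> n w * (estP n (N n) w - estf n w)) - \<theta>0)))
     (normal_law 0 ((\<integral>w. (\<phi> (R w, Y w))\<^sup>2 \<partial>M) -
       (\<integral>w. \<phi> (R w, Y w) * \<phi>f (R w, V w) \<partial>M)\<^sup>2 / ((1 + ratio) * (\<integral>w. (\<phi>f (R w, V w))\<^sup>2 \<partial>M))))"
    if vf: "(\<integral>w. (\<phi>f (R w, V w))\<^sup>2 \<partial>M) \<noteq> 0" and N: "\<And>n. 0 < N n"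
      and ratio: "(\<lambda>n. real n / real (N n)) \<longlonglongrightarrow> ratio"
      and \<omega>: "converges_in_prob M \<omega> ((\<integral>w. \<phi> (R w, Y w) * \<phi>f (R w, V w) \<partial>M) / (\<integral>w. (\<phi>f (R w, V w))\<^sup>2 \<partial>M))"
    for N :: "nat \<Rightarrow> nat" and ratio and \<omega>
  proof -
    \<comment> \<open>The first coordinate of an unlabeled entry is a dummy; only the law of the
      second is compared with the labeled one.\<close>
    define W where "W s w = (case s of Inl i \<Rightarrow> (\<phi> (ZY i w), \<phi>f (ZF i w)) | Inr j \<Rightarrow> (0, \<phi>f (RU j w, f (XU j w))))"
      for s :: "nat + nat" and w
    define \<nu> where "\<nu> = distr M borel (\<lambda>w. (\<phi> (R w, Y w), \<phi>f (R w, V w)))"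
    have pm: "(\<lambda>t. (\<phi> (qY t), \<phi>f (qF t))) \<in> borel_measurable borel" "(\<lambda>t. (0 :: real, \<phi>f (qF t))) \<in> borel_measurable borel"
      by (intro borel_measurable_Pair measurable_compose[OF qm(1) \<phi>m(1)] measurable_compose[OF qm(2) \<phi>m(2)] measurable_const; simp)+
    have W_eq: "W = (\<lambda>s w. (case s of Inl i \<Rightarrow> \<lambda>t. (\<phi> (qY t), \<phi>f (qF t)) | Inr j \<Rightarrow> \<lambda>t. (0, \<phi>f (qF t))) (T s w))"
      by (auto simp: fun_eq_iff W_def ZY_eq ZF_eq qF_def T_def split: sum.split)
    have indW: "indep_vars (\<lambda>_. borel) W UNIV"
      unfolding W_eq by (rule indep_vars_compose2[OF indT]) (auto split: sum.split intro: pm)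
    have RV[measurable]: "(\<lambda>w. (R w, Y w)) \<in> borel_measurable M" by (intro borel_measurable_Pair Rm Ym)
    have lawW: "distr M borel (W (Inl i)) = \<nu>" for i
      using lawq[OF pm(1), of i] unfolding W_eq \<nu>_def by (simp add: qY_def qF_def)
    have \<nu>m: "(\<lambda>w. (\<phi> (R w, Y w), \<phi>f (R w, V w))) \<in> borel_measurable M"
      by (intro borel_measurable_Pair) measurable
    have lawWU: "distr M borel (\<lambda>w. snd (W (Inr j) w)) = distr \<nu> borel snd" for j
    proof -
      have "distr M borel (\<lambda>w. snd (W (Inr j) w)) = distr (distr M borel (\<lambda>w. (RU j w, f (XU j w)))) borel \<phi>f"
        by (subst distr_distr) (auto simp: comp_def W_def)
      also have "\<dots> = distr M borel (\<lambda>w. \<phi>f (R w, V w))"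
        unfolding lawU' PF.\<mu>_def by (subst distr_distr) (auto simp: comp_def)
      also have "\<dots> = distr \<nu> borel snd"
        unfolding \<nu>_def using \<nu>m by (subst distr_distr) (auto simp: comp_def)
      finally show ?thesis .
    qed
    have int\<nu>: "(\<integral>x. h x \<partial>\<nu>) = (\<integral>w. h (\<phi> (R w, Y w), \<phi>f (R w, V w)) \<partial>M)"
      and integ\<nu>: "integrable \<nu> h = integrable M (\<lambda>w. h (\<phi> (R w, Y w), \<phi>f (R w, V w)))"
      if "h \<in> borel_measurable borel" for h :: "real \<times> real \<Rightarrow> real"
      unfolding \<nu>_def using that \<nu>m by (simp_all add: integral_distr integrable_distr_eq)
    have sqs: "integrable \<nu> (\<lambda>x. (fst x)\<^sup>2)" "integrable \<nu> (\<lambda>x. (snd x)\<^sup>2)"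
      using PY.influence_square PF.influence_square
      by (simp_all add: integ\<nu> PY.integrable_\<mu> PF.integrable_\<mu> \<phi>_def \<phi>f_def)
    have means: "(\<integral>x. fst x \<partial>\<nu>) = 0" "(\<integral>x. snd x \<partial>\<nu>) = 0"
      using PY.integral_influence PF.integral_influence
      by (simp_all add: int\<nu> PY.integral_\<mu> PF.integral_\<mu> \<phi>_def \<phi>f_def)
    define E where "E n w = sqrt (real n) * ((est n w - \<theta>0) - (\<Sum>i<n. \<phi> (ZY i w)) / real n)" for n w
    define EF where "EF n w = sqrt (real n) * ((estf n w - \<theta>f) - (\<Sum>i<n. \<phi>f (ZF i w)) / real n)" for n w
    define EP where "EP n w = sqrt (real n) * ((estP n (N n) w - \<theta>f) - (\<Sum>i<n + N n. \<phi>f (P n i w)) / real (n + N n))" for n w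
    have E0: "converges_in_prob M E 0" "converges_in_prob M EF 0"
      using infY infF unfolding is_influence_function_def E_def EF_def by auto
    \<comment> \<open>Row \<open>n\<close> has \<open>n + N n\<close> points, at least
      \<open>n\<close>, so the array version applies with the factor \<open>sqrt n\<close>.\<close>
    have "converges_in_prob M EP 0"
      unfolding EP_def estP_eq \<theta>f_def \<phi>f_def
      by (rule PF.scaled_remainder_vanishes[OF indep_vars_subset[OF indP] lawP]) auto
    then have E': "converges_in_prob M (\<lambda>n w. EP n w + -1 * EF n w) 0"
      by (intro converges_in_prob_add converges_in_prob_cmult E0)
    \<comment> \<open>The target \<open>\<theta>f\<close> cancels between the pooled and the labeled
      prediction-based estimator; beside the means only the expansion errors \<open>EP\<close> and
      \<open>EF\<close> remain.\<close>
    have key: "sqrt (real n) * ((est n w + \<omega> n w * (estP n (N n) w - estf n w)) - \<theta>0) =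
       (\<Sum>i<n. fst (W (Inl i) w)) / sqrt (real n) + E n w +
       \<omega> n w * (- (real (N n) / real (n + N n)) * ((\<Sum>i<n. snd (W (Inl i) w)) / sqrt (real n)) +
         sqrt (real n) * sqrt (real (N n)) / real (n + N n) * ((\<Sum>j<N n. snd (W (Inr j) w)) / sqrt (real (N n))) +
         (EP n w + -1 * EF n w))" for n w
    proof -
      let ?s = "sqrt (real n)" and ?h = "\<Sum>i<n. snd (W (Inl i) w)" and ?u = "\<Sum>j<N n. snd (W (Inr j) w)"
      have 1: "?s * (est n w - \<theta>0) = (\<Sum>i<n. fst (W (Inl i) w)) / ?s + E n w"
      proof -
        have "?s * (x / real n) = x / ?s" for x
          by (cases "n = 0") (simp_all add: field_simps)
        then show ?thesis unfolding E_def right_diff_distrib by (simp add: W_def)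
      qed
      have P: "(\<Sum>i<n + N n. \<phi>f (P n i w)) = ?h + ?u"
        unfolding sum_lessThan_add by (simp add: P_def W_def ZF_def)
      have "?s * (estP n (N n) w - estf n w) = (EP n w - EF n w) + (?s * ((?h + ?u) / (real n + real (N n))) - ?s * (?h / real n))"
        unfolding EP_def EF_def P by (simp add: W_def algebra_simps)
      also have "?s * ((?h + ?u) / (real n + real (N n))) - ?s * (?h / real n) =
          - (real (N n) / (real n + real (N n))) * (?h / ?s) + ?s * sqrt (real (N n)) / (real n + real (N n)) * (?u / sqrt (real (N n)))"
        using N[of n] by (intro pooled_mean_difference) auto
      finally have 2: "?s * (estP n (N n) w - estf n w) = - (real (N n) / real (n + N n)) * (?h / ?s) +
          ?s * sqrt (real (N n)) / real (n + N n) * (?u / sqrt (real (N n))) + (EP n w + -1 * EF n w)"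
        by simp
      have "?s * ((est n w + \<omega> n w * (estP n (N n) w - estf n w)) - \<theta>0) =
          ?s * (est n w - \<theta>0) + \<omega> n w * (?s * (estP n (N n) w - estf n w))"
        by (simp add: algebra_simps)
      then show ?thesis unfolding 1 2 .
    qed
    have sq11: "(\<integral>x. (fst x)\<^sup>2 \<partial>\<nu>) = (\<integral>w. (\<phi> (R w, Y w))\<^sup>2 \<partial>M)"
      and sq12: "(\<integral>x. fst x * snd x \<partial>\<nu>) = (\<integral>w. \<phi> (R w, Y w) * \<phi>f (R w, V w) \<partial>M)"
      and sq22: "(\<integral>x. (snd x)\<^sup>2 \<partial>\<nu>) = (\<integral>w. (\<phi>f (R w, V w))\<^sup>2 \<partial>M)"
      by (simp_all add: int\<nu>)
    show ?thesis
      unfolding key sq11[symmetric] sq12[symmetric] sq22[symmetric]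
      by (rule prediction_powered_clt[OF indW lawW lawWU sqs means _ N ratio _ E0(1) E'])
        (use vf \<omega> in \<open>simp_all only: sq12 sq22 not_False_eq_True\<close>)
  qed
  have true: "auc_true M R Y = \<theta>0" unfolding \<theta>0_def using Y01 by (rule auc_true_eq_target)
  show ?thesis
    unfolding Let_def true
    using infY uniqY infF uniqF clt
    unfolding est_def[abs_def] estf_def[abs_def] estP_def[abs_def] ZY_def[abs_def] ZF_def[abs_def]
      \<phi>_def \<phi>f_def \<theta>f_def V_def[abs_def]
    by blast
qed

end
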